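(* Let $X=\{X(t):t\ge 0\}$ be any $L_2$-bounded right-continuous martingale, with last term $X(\infty)=\lim_{t\to\infty}X(t)$. Then $$E\Big[\sup_{t\ge 0}X(t)-\inf_{t\ge 0}X(t)\Big]\le \sqrt{3}\,\sqrt{\mathrm{Var}(X(\infty))}.$$ Moreover, the bound $\sqrt{3}$ is attained as follows. Let $B$ be standard Brownian Motion with $B(0)=0$, $M(t)=\max_{0\le s\le t}B(s)$, $m(t)=\min_{0\le s\le t}B(s)$, and for $d>0$ let $\mathcal{T}_d=\inf\{t\ge 0:(M(t)-B(t))\wedge(B(t)-m(t))\ge d\}$. Then for every $d>0$ the martingale $\{B(t):t\le\mathcal{T}_d\}$ (i.e. $t\mapsto B(t\wedge\mathcal{T}_d)$) satisfies $$E[M(\mathcal{T}_d)-m(\mathcal{T}_d)]=\sqrt{3}\,\sqrt{\mathrm{Var}(B(\mathcal{T}_d))}.$$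
   Context: The diameter of a process $X$ is $\sup_t X(t)-\inf_t X(t)$. An $L_2$-bounded martingale, i.e. one with $\sup_t E[X(t)^2]<\infty$, is uniformly integrable and has a well-defined terminal element (last term) $X(\infty)$, the a.s. and $L_2$ limit of $X(t)$ as $t\to\infty$. Discrete-time martingales are included by extending them to be constant between consecutive integer times (which makes them right-continuous). Here $a\wedge b=\min(a,b)$. *)

theory Defs
  imports "HOL-Probability.Probability"
begin

text \<open>Processes are functions \<open>X :: real \<Rightarrow> 'a \<Rightarrow> real\<close>; only times \<open>t \<ge> 0\<close> matter.
  The library's \<open>filtration\<close> is indexed by a whole type, here \<open>real\<close>. This loses no generality:
  a filtration on the nonnegative reals extends by \<open>F t = F 0\<close> for \<open>t < 0\<close>.\<close>

definition martingale ::
    "'a measure \<Rightarrow> (real \<Rightarrow> 'a measure) \<Rightarrow> (real \<Rightarrow> 'a \<Rightarrow> real) \<Rightarrow> bool" where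
  "martingale M F X \<longleftrightarrow>
     filtration (space M) F \<and> (\<forall>t\<ge>0. subalgebra M (F t)) \<and>
     (\<forall>t\<ge>0. X t \<in> borel_measurable (F t) \<and> integrable M (X t)) \<and>
     (\<forall>s\<ge>0. \<forall>t\<ge>s. AE \<omega> in M. real_cond_exp M (F s) (X t) \<omega> = X s \<omega>)"

definition right_continuous_paths :: "'a measure \<Rightarrow> (real \<Rightarrow> 'a \<Rightarrow> real) \<Rightarrow> bool" where
  "right_continuous_paths M X \<longleftrightarrow>
     (AE \<omega> in M. \<forall>t\<ge>0. continuous (at_right t) (\<lambda>s. X s \<omega>))"

definition L2_bounded :: "'a measure \<Rightarrow> (real \<Rightarrow> 'a \<Rightarrow> real) \<Rightarrow> bool" where
  "L2_bounded M X \<longleftrightarrow> (SUP t\<in>{0..}. \<integral>\<^sup>+ \<omega>. ennreal ((X t \<omega>)\<^sup>2) \<partial>M) < \<infinity>"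

definition last_term ::
    "'a measure \<Rightarrow> (real \<Rightarrow> 'a \<Rightarrow> real) \<Rightarrow> ('a \<Rightarrow> real) \<Rightarrow> bool" where
  "last_term M X Y \<longleftrightarrow>
     Y \<in> borel_measurable M \<and> (AE \<omega> in M. ((\<lambda>t. X t \<omega>) \<longlongrightarrow> Y \<omega>) at_top)"

text \<open>The supremum and infimum are taken in the extended reals, so that a path that is unbounded
  has infinite diameter.\<close>

definition path_diameter :: "(real \<Rightarrow> 'a \<Rightarrow> real) \<Rightarrow> 'a \<Rightarrow> ennreal" where
  "path_diameter X \<omega> =
     e2ennreal ((SUP t\<in>{0..}. ereal (X t \<omega>)) - (INF t\<in>{0..}. ereal (X t \<omega>)))"

definition natural_filtration ::
    "'a measure \<Rightarrow> (real \<Rightarrow> 'a \<Rightarrow> real) \<Rightarrow> real \<Rightarrow> 'a measure" where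
  "natural_filtration M X t =
     sigma (space M) (\<Union>s\<in>{0..t}. {X s -` A \<inter> space M | A. A \<in> sets borel})"

definition standard_Brownian_motion :: "'a measure \<Rightarrow> (real \<Rightarrow> 'a \<Rightarrow> real) \<Rightarrow> bool" where
  "standard_Brownian_motion M B \<longleftrightarrow>
     prob_space M \<and>
     (\<forall>t\<ge>0. B t \<in> borel_measurable M) \<and>
     (\<forall>\<omega>\<in>space M. B 0 \<omega> = 0) \<and>
     (\<forall>\<omega>\<in>space M. continuous_on {0..} (\<lambda>t. B t \<omega>)) \<and>
     (\<forall>s\<ge>0. \<forall>t>s. distributed M lborel (\<lambda>\<omega>. B t \<omega> - B s \<omega>)
        (\<lambda>x. ennreal (normal_density 0 (sqrt (t - s)) x))) \<and>
     (\<forall>(n::nat) \<tau>. 0 \<le> \<tau> 0 \<and> (\<forall>i<n. \<tau> i \<le> \<tau> (Suc i)) \<longrightarrow>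
        prob_space.indep_vars M (\<lambda>_. borel) (\<lambda>i \<omega>. B (\<tau> (Suc i)) \<omega> - B (\<tau> i) \<omega>) {..<n})"

definition running_max :: "(real \<Rightarrow> 'a \<Rightarrow> real) \<Rightarrow> real \<Rightarrow> 'a \<Rightarrow> real" where
  "running_max B t \<omega> = (SUP s\<in>{0..t}. B s \<omega>)"

definition running_min :: "(real \<Rightarrow> 'a \<Rightarrow> real) \<Rightarrow> real \<Rightarrow> 'a \<Rightarrow> real" where
  "running_min B t \<omega> = (INF s\<in>{0..t}. B s \<omega>)"

text \<open>The infimum is taken in the extended reals, so that it is \<open>\<infinity>\<close> for the empty set.\<close>

definition centring_time :: "(real \<Rightarrow> 'a \<Rightarrow> real) \<Rightarrow> real \<Rightarrow> 'a \<Rightarrow> ereal" where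
  "centring_time B d \<omega> =
     Inf (ereal ` {t. 0 \<le> t \<and>
       d \<le> min (running_max B t \<omega> - B t \<omega>) (B t \<omega> - running_min B t \<omega>)})"

definition stopped_process ::
    "(real \<Rightarrow> 'a \<Rightarrow> real) \<Rightarrow> ('a \<Rightarrow> ereal) \<Rightarrow> real \<Rightarrow> 'a \<Rightarrow> real" where
  "stopped_process X T t \<omega> = X (real_of_ereal (min (ereal t) (T \<omega>))) \<omega>"

text \<open>The value \<open>X(T)\<close> at a random time. Since \<open>real_of_ereal \<infinity> = 0\<close>, it is the (irrelevant)
  value \<open>X 0 \<omega>\<close> where \<open>T \<omega> = \<infinity>\<close>.\<close>

definition at_time :: "(real \<Rightarrow> 'a \<Rightarrow> real) \<Rightarrow> ('a \<Rightarrow> ereal) \<Rightarrow> 'a \<Rightarrow> real" where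
  "at_time X T \<omega> = X (real_of_ereal (T \<omega>)) \<omega>"

end

theory Submission
  imports Defs
begin

text \<open>
  Fix \<open>d > 0\<close>, and for a path with current value \<open>x\<close>, running maximum \<open>a\<close> and running minimum \<open>b\<close>
  consider the optimal stopping problem with payoff \<open>2 d (a - b) - x\<^sup>2\<close>. Its value function \<open>\<Phi>\<close> is
  explicit, and along each step of a path it is a concave function of the new position. Hence
  \<open>\<Phi>\<close> evaluated along a martingale is a supermartingale that starts at \<open>3 d\<^sup>2 - x\<^sup>2\<close>, which gives
  \<open>2 d E(range) \<le> Var + 3 d\<^sup>2\<close>. The best choice of \<open>d\<close> yields the factor \<open>sqrt 3\<close> for finitely many
  times, and dyadic grids with Fatou's lemma give continuous time.

  For Brownian motion stopped at the centring time, \<open>\<Phi>\<close> is affine in the position on the region that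
  the path visits, up to quadratic overshoots at new extrema. Their total is at most the modulus of
  continuity times the range, so it vanishes in the limit, and \<open>\<Phi>\<close> equals the payoff at the stopping
  time. This gives \<open>Var + 3 d\<^sup>2 \<le> 2 d E(range)\<close>, so \<open>2 sqrt 3 d sqrt Var \<le> 2 d E(range)\<close> by AM-GM.
\<close>

section \<open>The potential function\<close>

text \<open>The constant \<open>3 * d\<^sup>2\<close> comes from matching the two formulas where
  \<open>a - b = 2 * d\<close>: with \<open>c\<close> the midpoint of the range they read
  \<open>c\<^sup>2 + d\<^sup>2 - 2 * c * x + 3 * d\<^sup>2\<close> and
  \<open>4 * d\<^sup>2 - 2 * c * x + c\<^sup>2\<close>. The supermartingale property is used
  pathwise only: the step inequalities add up to a deterministic bound whose remainder is a
  martingale transform of mean zero. The way out is to freeze the stopped process at a fixed time.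
  Then the upper and the lower inequality both apply and combine, for the second moment
  \<open>v\<close>, to \<open>v \<le> 2 * d * sqrt (3 * v)\<close>, so
  \<open>v \<le> 12 * d\<^sup>2\<close> whatever the time. The variance at the centring time is
  never computed; the two bounds and AM-GM squeeze it. That stopping preserves the martingale
  property is shown by Riemann sums of the integrand that is 1 before the centring time and 0
  afterwards.\<close>

text \<open>The value function \<open>\<Phi>\<close>: for \<open>a - b \<ge> 2 d\<close> one stops while \<open>b + d \<le> x \<le> a - d\<close>, and \<open>\<Phi>\<close>
  continues linearly in \<open>x\<close> with smooth fit. For \<open>a - b \<le> 2 d\<close> it is linear in \<open>x\<close>, with coefficients
  fixed by a vanishing \<open>a\<close>-derivative at \<open>x = a\<close> and \<open>b\<close>-derivative at \<open>x = b\<close>.\<close>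

definition potential :: "real \<Rightarrow> real \<Rightarrow> real \<Rightarrow> real \<Rightarrow> real" where
  "potential d x a b = (if a - b \<le> 2 * d
     then (a\<^sup>2 + b\<^sup>2) / 2 - x * (a + b) + 3 * d\<^sup>2
     else 2 * d * (a - b) - x\<^sup>2 + (max 0 (x - a + d))\<^sup>2 + (max 0 (b + d - x))\<^sup>2)"

definition potential_slope :: "real \<Rightarrow> real \<Rightarrow> real \<Rightarrow> real \<Rightarrow> real" where
  "potential_slope d x a b = (if a - b \<le> 2 * d then - (a + b)
     else 2 * (max 0 (x - a + d) - max 0 (b + d - x) - x))"

definition excess :: "real \<Rightarrow> real \<Rightarrow> real \<Rightarrow> real \<Rightarrow> real" where
  "excess d x a b = potential d x a b - 2 * d * (a - b) + x\<^sup>2"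

section \<open>Reflection symmetry and concavity of the potential\<close>

lemma potential_reflect: "potential d (- x) (- b) (- a) = potential d x a b"
  by (simp add: potential_def algebra_simps)

lemma potential_slope_reflect: "potential_slope d (- x) (- b) (- a) = - potential_slope d x a b"
  by (simp add: potential_slope_def algebra_simps)

text \<open>This is the tangent line of a concave function of the position: for
  \<open>a - b > 2 * d\<close> the potential is affine above \<open>a - d\<close> and below
  \<open>b + d\<close>, and minus a square up to a constant in between. In each case on
  \<open>x\<close> the tangent at \<open>z\<close> is the payoff plus one full square, which has to
  dominate the two squared positive parts at \<open>z\<close>.\<close>

lemma potential_concave_inner:
  assumes "0 < d" "b \<le> x" "x \<le> a" "b \<le> z" "z \<le> a"
  shows "potential d z a b \<le> potential d x a b + potential_slope d x a b * (z - x)"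
proof (cases "a - b \<le> 2 * d")
  case True
  then show ?thesis by (simp add: potential_def potential_slope_def algebra_simps)
next
  case False
  consider (u) "x \<ge> a - d" | (m) "b + d \<le> x" "x \<le> a - d" | (l) "x \<le> b + d" by linarith
  then show ?thesis
  proof cases
    case u
    then have mx: "max 0 (x - a + d) = x - a + d" "max 0 (b + d - x) = 0" using False by auto
    have "(max 0 (z - a + d))\<^sup>2 + (max 0 (b + d - z))\<^sup>2 \<le> (z - a + d)\<^sup>2"
    proof -
      consider "z \<ge> a - d" | "b + d \<le> z" "z \<le> a - d" | "z \<le> b + d" by linarith
      then show ?thesis
      proof cases
        case 3
        then have "(b + d - z)\<^sup>2 \<le> (a - d - z)\<^sup>2" using False assms by (intro power_mono) auto
        also have "\<dots> = (z - a + d)\<^sup>2" by algebra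
        finally show ?thesis using 3 False by simp
      qed (use False in auto)
    qed
    then show ?thesis using False unfolding potential_def potential_slope_def mx
      by (simp add: algebra_simps power2_eq_square)
  next
    case m
    then have mx: "max 0 (x - a + d) = 0" "max 0 (b + d - x) = 0" using False by auto
    have "(max 0 (z - a + d))\<^sup>2 + (max 0 (b + d - z))\<^sup>2 \<le> (z - x)\<^sup>2"
    proof -
      consider "z \<ge> a - d" | "b + d \<le> z" "z \<le> a - d" | "z \<le> b + d" by linarith
      then show ?thesis
      proof cases
        case 1
        then have "(z - a + d)\<^sup>2 \<le> (z - x)\<^sup>2" using False m by (intro power_mono) auto
        then show ?thesis using 1 False by simp
      next
        case 3
        then have "(b + d - z)\<^sup>2 \<le> (x - z)\<^sup>2" using False m by (intro power_mono) auto
        also have "\<dots> = (z - x)\<^sup>2" by algebra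
        finally show ?thesis using 3 False by simp
      qed (use False in auto)
    qed
    then show ?thesis using False unfolding potential_def potential_slope_def mx
      by (simp add: algebra_simps power2_eq_square)
  next
    case l
    then have mx: "max 0 (x - a + d) = 0" "max 0 (b + d - x) = b + d - x" using False by auto
    have "(max 0 (z - a + d))\<^sup>2 + (max 0 (b + d - z))\<^sup>2 \<le> (b + d - z)\<^sup>2"
    proof -
      consider "z \<ge> a - d" | "b + d \<le> z" "z \<le> a - d" | "z \<le> b + d" by linarith
      then show ?thesis
      proof cases
        case 1
        then have "(z - a + d)\<^sup>2 \<le> (z - b - d)\<^sup>2" using False assms by (intro power_mono) auto
        also have "\<dots> = (b + d - z)\<^sup>2" by algebra
        finally show ?thesis using 1 False by simp
      qed (use False in auto)
    qed
    then show ?thesis using False unfolding potential_def potential_slope_def mx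
      by (simp add: algebra_simps power2_eq_square)
  qed
qed

lemma potential_slope_ge:
  assumes "0 < d" "b \<le> x" "x \<le> a"
  shows "potential_slope d a a b \<le> potential_slope d x a b"
  using assms by (auto simp: potential_slope_def max_def)

text \<open>When a new maximum is set, position and maximum move together. Along this diagonal
  \<open>potential d z z b\<close> is continuously differentiable in \<open>z\<close> with
  derivative \<open>potential_slope d z z b\<close>; its second derivative is -1 while
  \<open>z - b < 2 * d\<close> and -2 afterwards. So the tangent at \<open>a\<close> exceeds it by
  an amount between 0 and \<open>(z - a)\<^sup>2\<close>.\<close>

lemma potential_overshoot:
  assumes "0 < d" "b \<le> a" "a \<le> z"
  shows "potential d z z b \<le> potential d a a b + potential_slope d a a b * (z - a)"
    and "potential d a a b + potential_slope d a a b * (z - a) \<le> potential d z z b + (z - a)\<^sup>2"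
proof -
  consider "z - b \<le> 2 * d" | "a - b \<le> 2 * d" "z - b > 2 * d" | "a - b > 2 * d" by linarith
  then show "potential d z z b \<le> potential d a a b + potential_slope d a a b * (z - a)"
  proof cases
    case 1
    then show ?thesis using assms zero_le_power2[of "z - a"]
      by (simp add: potential_def potential_slope_def field_simps power2_eq_square)
  next
    case 2
    have *: "max 0 (b + d - z) = 0" "max 0 (z - z + d) = d" using 2 assms by auto
    \<comment> \<open>With u = 2d + b - a and v = z - b - 2d, the difference is u^2/2 + u v + v^2.\<close>
    have "0 \<le> (2*d + b - a)\<^sup>2 + 2 * ((2*d + b - a) * (z - b - 2*d)) + 2 * (z - b - 2*d)\<^sup>2"
      using 2 by (intro add_nonneg_nonneg mult_nonneg_nonneg) auto
    then show ?thesis using 2 unfolding potential_def potential_slope_def *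
      by (simp add: field_simps power2_eq_square)
  next
    case 3
    have *: "max 0 (b + d - z) = 0" "max 0 (b + d - a) = 0" "max 0 (z - z + d) = d" "max 0 (a - a + d) = d"
      using 3 assms by auto
    show ?thesis using 3 assms zero_le_power2[of "z - a"] unfolding potential_def potential_slope_def *
      by (simp add: field_simps power2_eq_square)
  qed
  consider "z - b \<le> 2 * d" | "a - b \<le> 2 * d" "z - b > 2 * d" | "a - b > 2 * d" by linarith
  then show "potential d a a b + potential_slope d a a b * (z - a) \<le> potential d z z b + (z - a)\<^sup>2"
  proof cases
    case 1
    then show ?thesis using assms zero_le_power2[of "z - a"]
      by (simp add: potential_def potential_slope_def field_simps power2_eq_square)
  next
    case 2
    have *: "max 0 (b + d - z) = 0" "max 0 (z - z + d) = d" using 2 assms by auto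
    \<comment> \<open>With the same \<open>u\<close> and \<open>v\<close> one has
      \<open>z - a = u + v\<close>; subtracting the difference from its square leaves half of this
      expression.\<close>
    have "0 \<le> (2*d + b - a)\<^sup>2 + 2 * ((2*d + b - a) * (z - b - 2*d))"
      using 2 by (intro add_nonneg_nonneg mult_nonneg_nonneg) auto
    then show ?thesis using 2 unfolding potential_def potential_slope_def *
      by (simp add: field_simps power2_eq_square)
  next
    case 3
    have *: "max 0 (b + d - z) = 0" "max 0 (b + d - a) = 0" "max 0 (z - z + d) = d" "max 0 (a - a + d) = d"
      using 3 assms by auto
    show ?thesis using 3 assms zero_le_power2[of "z - a"] unfolding potential_def potential_slope_def *
      by (simp add: field_simps power2_eq_square)
  qed
qed

text \<open>The step is split at \<open>a\<close>. Up to \<open>a\<close> the tangent line at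
  \<open>x\<close> lies above; beyond \<open>a\<close> the diagonal tangent applies, whose slope is
  no larger than the one at \<open>x\<close>.\<close>

lemma potential_concave_upper:
  assumes "0 < d" "b \<le> x" "x \<le> a" "a \<le> z"
  shows "potential d z z b \<le> potential d x a b + potential_slope d x a b * (z - x)"
proof -
  have "potential d z z b \<le> potential d a a b + potential_slope d a a b * (z - a)"
    using assms by (intro potential_overshoot) auto
  also have "\<dots> \<le> potential d a a b + potential_slope d x a b * (z - a)"
    using potential_slope_ge[of d b x a] assms by (intro add_left_mono mult_right_mono) auto
  also have "\<dots> \<le> potential d x a b + potential_slope d x a b * (a - x) + potential_slope d x a b * (z - a)"
    using assms by (intro add_right_mono potential_concave_inner) auto
  finally show ?thesis by (simp add: algebra_simps)
qed

lemma potential_step_le: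
  assumes "0 < d" "b \<le> x" "x \<le> a"
  shows "potential d z (max a z) (min b z) \<le> potential d x a b + potential_slope d x a b * (z - x)"
proof -
  consider "b \<le> z" "z \<le> a" | "a < z" | "z < b" by linarith
  then show ?thesis
  proof cases
    case 1
    then show ?thesis using potential_concave_inner[of d b x a z] assms by (simp add: max_def min_def)
  next
    case 2
    then show ?thesis using potential_concave_upper[of d b x a z] assms by (simp add: max_def min_def)
  next
    case 3
    \<comment> \<open>A new minimum is a new maximum of the reflected path.\<close>
    have "potential d (-z) (-z) (-a) \<le> potential d (-x) (-b) (-a) + potential_slope d (-x) (-b) (-a) * (- z + x)"
      using potential_concave_upper[of d "-a" "-x" "-b" "-z"] assms 3 by simp
    then show ?thesis using 3 assms
      by (simp add: potential_reflect potential_slope_reflect max_def min_def algebra_simps)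
  qed
qed

text \<open>A step from \<open>x\<close> to \<open>z\<close> that stays where \<open>potential\<close> is affine in the position, apart from
  movement beyond the current extrema.\<close>

definition same_wing :: "real \<Rightarrow> real \<Rightarrow> real \<Rightarrow> real \<Rightarrow> real \<Rightarrow> bool" where
  "same_wing d a b x z \<longleftrightarrow> a - b < 2 * d \<or> x = z \<or> (a - d \<le> x \<and> a - d \<le> z) \<or> (x \<le> b + d \<and> z \<le> b + d)"

lemma potential_affine_on_wing:
  assumes "0 < d" "same_wing d a b x z" 
  shows "potential d z a b = potential d x a b + potential_slope d x a b * (z - x)"
  using assms unfolding same_wing_def
proof (elim disjE)
  assume "a - d \<le> x \<and> a - d \<le> z"
  then have *: "max 0 (x - a + d) = x - a + d" "max 0 (z - a + d) = z - a + d"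
    "a - b > 2 * d \<Longrightarrow> max 0 (b + d - x) = 0" "a - b > 2 * d \<Longrightarrow> max 0 (b + d - z) = 0" by auto
  show ?thesis
    by (cases "a - b > 2 * d"; simp add: potential_def potential_slope_def *; 
     simp add: algebra_simps power2_eq_square)
next
  assume "x \<le> b + d \<and> z \<le> b + d"
  then have *: "max 0 (b + d - x) = b + d - x" "max 0 (b + d - z) = b + d - z"
    "a - b > 2 * d \<Longrightarrow> max 0 (x - a + d) = 0" "a - b > 2 * d \<Longrightarrow> max 0 (z - a + d) = 0" by auto
  show ?thesis
    by (cases "a - b > 2 * d"; simp add: potential_def potential_slope_def *; 
     simp add: algebra_simps power2_eq_square)
qed (auto simp: potential_def potential_slope_def algebra_simps)

text \<open>Once \<open>2 * d \<le> a - b\<close>, a target above \<open>a\<close> cannot lie in the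
  lower wing, so \<open>x\<close> lies in the upper one, where the slope is constant.\<close>

lemma potential_slope_wing:
  assumes "0 < d" "same_wing d a b x z" "b \<le> x" "x \<le> a" "a < z"
  shows "potential_slope d a a b = potential_slope d x a b"
  using assms unfolding same_wing_def potential_slope_def by (auto simp: max_def)

lemma potential_upper_ge:
  assumes "0 < d" "b \<le> x" "x \<le> a" "a < z" "same_wing d a b x z"
  shows "potential d x a b + potential_slope d x a b * (z - x) \<le> potential d z z b + (z - a)\<^sup>2"
proof -
  have "same_wing d a b x a" using assms unfolding same_wing_def by auto
  then have "potential d a a b = potential d x a b + potential_slope d x a b * (a - x)"
    using potential_affine_on_wing assms by auto
  moreover have "potential_slope d a a b = potential_slope d x a b"
    using potential_slope_wing[of d a b x z] assms by simp
  ultimately show ?thesis using potential_overshoot(2)[of d b a z] assms by (simp add: algebra_simps)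
qed

lemma potential_step_ge:
  assumes "0 < d" "b \<le> x" "x \<le> a" "same_wing d a b x z"
  shows "potential d x a b + potential_slope d x a b * (z - x)
    \<le> potential d z (max a z) (min b z) + ((max a z - a)\<^sup>2 + (b - min b z)\<^sup>2)"
proof -
  consider "b \<le> z" "z \<le> a" | "a < z" | "z < b" by linarith
  then show ?thesis
  proof cases
    case 1
    then show ?thesis using potential_affine_on_wing[of d a b x z] assms by (simp add: max_def min_def)
  next
    case 2
    then show ?thesis using potential_upper_ge[of d b x a z] assms by (simp add: max_def min_def)
  next
    case 3
    have "same_wing d (-b) (-a) (-x) (-z)" using assms unfolding same_wing_def by auto
    then have "potential d (-x) (-b) (-a) + potential_slope d (-x) (-b) (-a) * (- z + x) \<le> potential d (-z) (-z) (-a) + (-z + b)\<^sup>2"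
      using potential_upper_ge[of d "-a" "-x" "-b" "-z"] assms 3 by simp
    then show ?thesis using 3 assms
      by (simp add: potential_reflect potential_slope_reflect max_def min_def algebra_simps)
  qed
qed

section \<open>The gap between the potential and the stopping payoff\<close>

lemma excess_nonneg:
  assumes "0 < d" "b \<le> x" "x \<le> a"
  shows "0 \<le> excess d x a b"
proof (cases "a - b \<le> 2 * d")
  case True
  have "excess d x a b = ((2*x - a - b)\<^sup>2 + (a - b)\<^sup>2) / 4 - 2 * d * (a - b) + 3 * d\<^sup>2"
    using True by (simp add: excess_def potential_def field_simps power2_eq_square)
  \<comment> \<open>The gap is smallest at the midpoint of the range. What remains is a quadratic in
    \<open>a - b\<close> with roots \<open>2 * d\<close> and \<open>6 * d\<close>; a quarter of this
    product equals it.\<close>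
  moreover have "0 \<le> (2 * d - (a - b)) * (6 * d - (a - b))"
    using True assms by (intro mult_nonneg_nonneg) auto
  then have "0 \<le> (a - b)\<^sup>2 / 4 - 2 * d * (a - b) + 3 * d\<^sup>2"
    by (simp add: field_simps power2_eq_square)
  ultimately show ?thesis using zero_le_power2[of "2*x - a - b"] by argo
next
  case False
  then show ?thesis by (simp add: excess_def potential_def)
qed

text \<open>A bound independent of the path: it serves as the majorant for dominated convergence,
  and as the estimate for paths that do not end balanced.\<close>

lemma excess_le:
  assumes "0 < d" "b \<le> x" "x \<le> a"
  shows "excess d x a b \<le> 3 * d\<^sup>2"
proof (cases "a - b \<le> 2 * d")
  case True
  have "excess d x a b = ((2*x - a - b)\<^sup>2 + (a - b)\<^sup>2) / 4 - 2 * d * (a - b) + 3 * d\<^sup>2"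
    using True by (simp add: excess_def potential_def field_simps power2_eq_square)
  moreover have "(2*x - a - b)\<^sup>2 \<le> (a - b)\<^sup>2" using assms by (intro abs_le_square_iff[THEN iffD1]) auto
  moreover have "0 \<le> (a - b) * (4 * d - (a - b))"
    using True assms by (intro mult_nonneg_nonneg) auto
  ultimately show ?thesis by (simp add: field_simps power2_eq_square)
next
  case False
  have "(max 0 (x - a + d))\<^sup>2 \<le> d\<^sup>2" "(max 0 (b + d - x))\<^sup>2 \<le> d\<^sup>2"
    using assms by (auto intro!: power_mono)
  moreover have "excess d x a b = (max 0 (x - a + d))\<^sup>2 + (max 0 (b + d - x))\<^sup>2"
    using False by (simp add: excess_def potential_def)
  ultimately show ?thesis using zero_le_power2[of d] by linarith
qed

text \<open>A quantitative form of the fact that potential and payoff agree at balanced points,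
  needed because the extrema over a grid reach balance only in the limit. The number
  \<open>e\<close> measures how much is missing on the two sides together.\<close>

lemma excess_le_deficit:
  fixes d x a b :: real
  assumes "0 < d"
  defines "e \<equiv> max 0 (d - (a - x)) + max 0 (d - (x - b))"
  shows "excess d x a b \<le> d * e + e\<^sup>2"
proof -
  define p q where "p = d - (a - x)" and "q = d - (x - b)"
  have e: "e = max 0 p + max 0 q" by (simp add: e_def p_def q_def)
  have e0: "p + q \<le> e" "0 \<le> e" unfolding e by auto
  show ?thesis
  proof (cases "a - b \<le> 2 * d")
    case True
    then have pq: "0 \<le> p + q" by (simp add: p_def q_def)
    have eq: "excess d x a b = d * (p + q) + (p\<^sup>2 + q\<^sup>2) / 2"
      using True by (simp add: excess_def potential_def p_def q_def field_simps power2_eq_square)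
    \<comment> \<open>If one of \<open>p\<close> and \<open>q\<close> is negative, the other is at
      least as large in absolute value, since \<open>0 \<le> p + q\<close>.\<close>
    have "p\<^sup>2 \<le> e\<^sup>2" "q\<^sup>2 \<le> e\<^sup>2" using pq unfolding e by (auto intro!: abs_le_square_iff[THEN iffD1])
    moreover have "d * (p + q) \<le> d * e" using e0 \<open>0 < d\<close> by (intro mult_left_mono) auto
    ultimately show ?thesis unfolding eq by argo
  next
    case False
    have "excess d x a b = (max 0 p)\<^sup>2 + (max 0 q)\<^sup>2"
      using False by (simp add: excess_def potential_def p_def q_def algebra_simps)
    also have "\<dots> \<le> e\<^sup>2" unfolding e by (simp add: power2_sum)
    also have "\<dots> \<le> d * e + e\<^sup>2" using \<open>0 < d\<close> e0 by simp
    finally show ?thesis .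
  qed
qed

section \<open>Pathwise inequalities for finite sequences\<close>

primrec smax :: "(nat \<Rightarrow> real) \<Rightarrow> nat \<Rightarrow> real" where
  "smax x 0 = x 0"
| "smax x (Suc n) = max (smax x n) (x (Suc n))"

primrec smin :: "(nat \<Rightarrow> real) \<Rightarrow> nat \<Rightarrow> real" where
  "smin x 0 = x 0"
| "smin x (Suc n) = min (smin x n) (x (Suc n))"

lemma smin_eq: "smin x n = - smax (\<lambda>k. - x k) n"
  by (induction n) (auto simp: max_def min_def)

lemma smax_ge: "k \<le> n \<Longrightarrow> x k \<le> smax x n"
  by (induction n) (auto simp: le_Suc_eq)

lemma smin_le: "k \<le> n \<Longrightarrow> smin x n \<le> x k"
  by (induction n) (auto simp: le_Suc_eq)

lemma smax_attained: "\<exists>k\<le>n. smax x n = x k"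
  by (induction n) (auto simp: max_def le_Suc_eq)

lemma smin_attained: "\<exists>k\<le>n. smin x n = x k"
  by (induction n) (auto simp: min_def le_Suc_eq)

definition srange :: "(nat \<Rightarrow> real) \<Rightarrow> nat \<Rightarrow> real" where
  "srange x n = smax x n - smin x n"

text \<open>The step inequality is summed from the start, where position, maximum and minimum
  coincide. Each weight depends on the past only, so for a martingale the sum is a transform of mean
  zero.\<close>

lemma potential_pathwise_le:
  assumes "0 < d"
  shows "2 * d * srange x n - (x n)\<^sup>2 \<le> 3 * d\<^sup>2 - (x 0)\<^sup>2 +
    (\<Sum>k<n. potential_slope d (x k) (smax x k) (smin x k) * (x (Suc k) - x k))"
proof -
  have "potential d (x n) (smax x n) (smin x n) \<le> 3 * d\<^sup>2 - (x 0)\<^sup>2 +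
    (\<Sum>k<n. potential_slope d (x k) (smax x k) (smin x k) * (x (Suc k) - x k))"
  proof (induction n)
    case 0
    then show ?case using assms by (simp add: potential_def power2_eq_square)
  next
    case (Suc n)
    then show ?case
      using potential_step_le[of d "smin x n" "x n" "smax x n" "x (Suc n)"] smax_ge[of n n x] smin_le[of n n x] assms by simp
  qed
  then show ?thesis
    using excess_nonneg[of d "smin x n" "x n" "smax x n"] smax_ge[of n n x] smin_le[of n n x] assms
    by (simp add: excess_def srange_def)
qed

definition overshoot :: "(nat \<Rightarrow> real) \<Rightarrow> nat \<Rightarrow> real" where
  "overshoot x n = (\<Sum>k<n. (smax x (Suc k) - smax x k)\<^sup>2 + (smin x k - smin x (Suc k))\<^sup>2)"

text \<open>If every step stays in one wing, the summed tangent inequalities lose nothing but the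
  squared jumps of the extrema; the excess appears because the potential is replaced by the payoff
  at the end.\<close>

lemma potential_pathwise_ge:
  assumes "0 < d" and wing: "\<And>k. k < n \<Longrightarrow> same_wing d (smax x k) (smin x k) (x k) (x (Suc k))"
  shows "3 * d\<^sup>2 - (x 0)\<^sup>2 +
    (\<Sum>k<n. potential_slope d (x k) (smax x k) (smin x k) * (x (Suc k) - x k))
    \<le> 2 * d * srange x n - (x n)\<^sup>2 + excess d (x n) (smax x n) (smin x n) + overshoot x n"
proof -
  have "3 * d\<^sup>2 - (x 0)\<^sup>2 +
    (\<Sum>k<n. potential_slope d (x k) (smax x k) (smin x k) * (x (Suc k) - x k))
    \<le> potential d (x n) (smax x n) (smin x n) + overshoot x n" using wing
  proof (induction n)
    case 0
    then show ?case using assms by (simp add: potential_def power2_eq_square overshoot_def)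
  next
    case (Suc n)
    then show ?case
      using potential_step_ge[of d "smin x n" "x n" "smax x n" "x (Suc n)"] smax_ge[of n n x] smin_le[of n n x] assms(1)
      by (simp add: overshoot_def)
  qed
  then show ?thesis by (simp add: excess_def srange_def)
qed

lemma overshoot_nonneg: "0 \<le> overshoot x n"
  by (simp add: overshoot_def sum_nonneg)

text \<open>Each squared jump of an extremum is at most \<open>\<delta>\<close> times the jump
  itself, and the jumps telescope to the range.\<close>

lemma overshoot_le:
  assumes "\<And>k. k < n \<Longrightarrow> \<bar>x (Suc k) - x k\<bar> \<le> \<delta>"
  shows "overshoot x n \<le> \<delta> * srange x n"
  using assms
proof (induction n)
  case 0
  then show ?case by (simp add: overshoot_def srange_def)
next
  case (Suc n)
  have s: "0 \<le> smax x (Suc n) - smax x n" "smax x (Suc n) - smax x n \<le> \<delta>"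
    "0 \<le> smin x n - smin x (Suc n)" "smin x n - smin x (Suc n) \<le> \<delta>"
    using Suc.prems[of n] smax_ge[of n n x] smin_le[of n n x] by auto
  have "overshoot x (Suc n) = overshoot x n + ((smax x (Suc n) - smax x n)\<^sup>2 + (smin x n - smin x (Suc n))\<^sup>2)"
    by (simp add: overshoot_def)
  also have "\<dots> \<le> \<delta> * srange x n + (\<delta> * (smax x (Suc n) - smax x n) + \<delta> * (smin x n - smin x (Suc n)))"
    using s Suc unfolding power2_eq_square by (intro add_mono mult_right_mono) auto
  finally show ?case by (simp add: srange_def algebra_simps)
qed

text \<open>Pathwise form of Doob's maximal inequality in the square mean. With \<open>m\<close> the
  maximum and \<open>y\<close> the last value, both relative to \<open>x 0\<close>, the induction
  bounds the transform by \<open>m * y - m\<^sup>2 / 2\<close>, and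
  \<open>0 \<le> (2 * y - m)\<^sup>2\<close> does the rest.\<close>

lemma doob_pathwise:
  shows "(smax x n - x 0)\<^sup>2 \<le> 4 * (x n - x 0)\<^sup>2 - 4 * (\<Sum>k<n. (smax x k - x 0) * (x (Suc k) - x k))"
proof -
  define S where "S = (\<Sum>k<n. (smax x k - x 0) * (x (Suc k) - x k))"
  have "S \<le> (smax x n - x 0) * (x n - x 0) - (smax x n - x 0)\<^sup>2 / 2"
    unfolding S_def
  proof (induction n)
    case (Suc n)
    show ?case
    proof (cases "x (Suc n) \<le> smax x n")
      case True
      then have "smax x (Suc n) = smax x n" by simp
      then show ?thesis using Suc by (simp add: algebra_simps)
    next
      case False
      then have *: "smax x (Suc n) = x (Suc n)" by simp
      show ?thesis unfolding * using Suc zero_le_power2[of "x (Suc n) - smax x n"]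
        by (simp add: field_simps power2_eq_square)
    qed
  qed simp
  moreover have "0 \<le> (2 * (x n - x 0) - (smax x n - x 0))\<^sup>2" by simp
  ultimately show ?thesis unfolding S_def[symmetric] by (simp add: power2_eq_square field_simps)
qed

section \<open>Discrete-time martingales\<close>

definition square_integrable :: "'a measure \<Rightarrow> ('a \<Rightarrow> real) \<Rightarrow> bool" where
  "square_integrable M f \<longleftrightarrow> f \<in> borel_measurable M \<and> integrable M (\<lambda>\<omega>. (f \<omega>)\<^sup>2)"

lemma square_integrable_measurable: "square_integrable M f \<Longrightarrow> f \<in> borel_measurable M"
  by (simp add: square_integrable_def)

text \<open>Domination by a sum is the common pattern behind sums, differences, maxima, minima and
  the slope of the potential.\<close>

lemma square_integrable_add_bound:
  assumes "square_integrable M f" "square_integrable M g" "h \<in> borel_measurable M"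
    "\<And>\<omega>. \<omega> \<in> space M \<Longrightarrow> \<bar>h \<omega>\<bar> \<le> \<bar>f \<omega>\<bar> + \<bar>g \<omega>\<bar>"
  shows "square_integrable M h"
  unfolding square_integrable_def
proof
  show "integrable M (\<lambda>\<omega>. (h \<omega>)\<^sup>2)"
  proof (rule Bochner_Integration.integrable_bound)
    show "integrable M (\<lambda>\<omega>. 2 * (f \<omega>)\<^sup>2 + 2 * (g \<omega>)\<^sup>2)"
      using assms by (simp add: square_integrable_def)
    show "AE \<omega> in M. norm ((h \<omega>)\<^sup>2) \<le> norm (2 * (f \<omega>)\<^sup>2 + 2 * (g \<omega>)\<^sup>2)"
    proof (rule AE_I2)
      fix \<omega> assume "\<omega> \<in> space M"
      then have "(h \<omega>)\<^sup>2 \<le> (\<bar>f \<omega>\<bar> + \<bar>g \<omega>\<bar>)\<^sup>2"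
        using assms(4) by (metis abs_ge_zero power2_abs power_mono)
      also have "\<dots> \<le> 2 * (f \<omega>)\<^sup>2 + 2 * (g \<omega>)\<^sup>2"
        using zero_le_power2[of "\<bar>f \<omega>\<bar> - \<bar>g \<omega>\<bar>"] by (simp add: power2_sum power2_diff)
      finally show "norm ((h \<omega>)\<^sup>2) \<le> norm (2 * (f \<omega>)\<^sup>2 + 2 * (g \<omega>)\<^sup>2)" by simp
    qed
  qed (use assms in measurable)
qed (use assms in simp)

lemma square_integrable_add:
  "square_integrable M f \<Longrightarrow> square_integrable M g \<Longrightarrow> square_integrable M (\<lambda>\<omega>. f \<omega> + g \<omega>)"
  by (rule square_integrable_add_bound[of M f g]) (auto simp: square_integrable_def)

lemma square_integrable_diff:
  "square_integrable M f \<Longrightarrow> square_integrable M g \<Longrightarrow> square_integrable M (\<lambda>\<omega>. f \<omega> - g \<omega>)"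
  by (rule square_integrable_add_bound[of M f g]) (auto simp: square_integrable_def)

lemma square_integrable_cmult:
  "square_integrable M f \<Longrightarrow> square_integrable M (\<lambda>\<omega>. c * f \<omega>)"
  by (auto simp: square_integrable_def power_mult_distrib)

lemma square_integrable_abs:
  "square_integrable M f \<Longrightarrow> square_integrable M (\<lambda>\<omega>. \<bar>f \<omega>\<bar>)"
  by (auto simp: square_integrable_def)

lemma square_integrable_max:
  "square_integrable M f \<Longrightarrow> square_integrable M g \<Longrightarrow> square_integrable M (\<lambda>\<omega>. max (f \<omega>) (g \<omega>))"
  by (rule square_integrable_add_bound[of M f g]) (auto simp: square_integrable_def)

lemma square_integrable_min:
  "square_integrable M f \<Longrightarrow> square_integrable M g \<Longrightarrow> square_integrable M (\<lambda>\<omega>. min (f \<omega>) (g \<omega>))"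
  by (rule square_integrable_add_bound[of M f g]) (auto simp: square_integrable_def)

lemma (in finite_measure) square_integrable_const: "square_integrable M (\<lambda>_. c)"
  by (simp add: square_integrable_def)

lemma square_integrable_mult_integrable:
  assumes "square_integrable M f" "square_integrable M g"
  shows "integrable M (\<lambda>\<omega>. f \<omega> * g \<omega>)"
proof (rule Bochner_Integration.integrable_bound)
  show "integrable M (\<lambda>\<omega>. (f \<omega>)\<^sup>2 + (g \<omega>)\<^sup>2)" using assms by (simp add: square_integrable_def)
  show "AE \<omega> in M. norm (f \<omega> * g \<omega>) \<le> norm ((f \<omega>)\<^sup>2 + (g \<omega>)\<^sup>2)"
  proof (rule AE_I2)
    fix \<omega>
    have "2 * (\<bar>f \<omega>\<bar> * \<bar>g \<omega>\<bar>) \<le> (f \<omega>)\<^sup>2 + (g \<omega>)\<^sup>2"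
      using sum_squares_bound[of "\<bar>f \<omega>\<bar>" "\<bar>g \<omega>\<bar>"] by simp
    moreover have "0 \<le> \<bar>f \<omega>\<bar> * \<bar>g \<omega>\<bar>" by simp
    moreover have "norm (f \<omega> * g \<omega>) = \<bar>f \<omega>\<bar> * \<bar>g \<omega>\<bar>" "norm ((f \<omega>)\<^sup>2 + (g \<omega>)\<^sup>2) = (f \<omega>)\<^sup>2 + (g \<omega>)\<^sup>2"
      by (auto simp: abs_mult)
    ultimately show "norm (f \<omega> * g \<omega>) \<le> norm ((f \<omega>)\<^sup>2 + (g \<omega>)\<^sup>2)" by linarith
  qed
qed (use assms in \<open>auto simp: square_integrable_def\<close>)

lemma (in finite_measure) square_integrable_integrable:
  "square_integrable M f \<Longrightarrow> integrable M f"
  using square_integrable_mult_integrable[OF _ square_integrable_const[of 1]] by simp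

lemma square_integrable_smax:
  assumes "\<And>k. k \<le> n \<Longrightarrow> square_integrable M (x k)"
  shows "square_integrable M (\<lambda>\<omega>. smax (\<lambda>k. x k \<omega>) n)"
  using assms by (induction n) (auto intro!: square_integrable_max)

lemma square_integrable_smin:
  assumes "\<And>k. k \<le> n \<Longrightarrow> square_integrable M (x k)"
  shows "square_integrable M (\<lambda>\<omega>. smin (\<lambda>k. x k \<omega>) n)"
  using assms by (induction n) (auto intro!: square_integrable_min)

lemma borel_measurable_smax:
  assumes "\<And>k. k \<le> n \<Longrightarrow> x k \<in> borel_measurable M"
  shows "(\<lambda>\<omega>. smax (\<lambda>k. x k \<omega>) n) \<in> borel_measurable M"
  using assms by (induction n) auto

lemma borel_measurable_smin:
  assumes "\<And>k. k \<le> n \<Longrightarrow> x k \<in> borel_measurable M"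
  shows "(\<lambda>\<omega>. smin (\<lambda>k. x k \<omega>) n) \<in> borel_measurable M"
  using assms by (induction n) auto

lemma borel_measurable_potential_slope:
  assumes [measurable]: "f \<in> borel_measurable M" "g \<in> borel_measurable M" "h \<in> borel_measurable M"
  shows "(\<lambda>\<omega>. potential_slope d (f \<omega>) (g \<omega>) (h \<omega>)) \<in> borel_measurable M"
  unfolding potential_slope_def by measurable

lemma (in finite_measure) square_integrable_potential_slope:
  assumes "square_integrable M f" "square_integrable M g" "square_integrable M h"
  shows "square_integrable M (\<lambda>\<omega>. potential_slope d (f \<omega>) (g \<omega>) (h \<omega>))"
proof (rule square_integrable_add_bound)
  \<comment> \<open>The slope is piecewise affine in its arguments; the coefficients are generous
    ones that cover every piece.\<close>
  show "square_integrable M (\<lambda>\<omega>. \<bar>4 * f \<omega>\<bar> + \<bar>6 * g \<omega>\<bar> + \<bar>6 * h \<omega>\<bar>)" 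
    by (intro square_integrable_add square_integrable_abs square_integrable_cmult assms)
  show "square_integrable M (\<lambda>_. 4 * d)" by (rule square_integrable_const)
  show "(\<lambda>\<omega>. potential_slope d (f \<omega>) (g \<omega>) (h \<omega>)) \<in> borel_measurable M"
    by (intro borel_measurable_potential_slope square_integrable_measurable assms)
  show "\<bar>potential_slope d (f \<omega>) (g \<omega>) (h \<omega>)\<bar> \<le> \<bar>\<bar>4 * f \<omega>\<bar> + \<bar>6 * g \<omega>\<bar> + \<bar>6 * h \<omega>\<bar>\<bar> + \<bar>4 * d\<bar>" for \<omega>
    unfolding potential_slope_def by (auto simp: abs_if max_def split: if_splits)
qed

section \<open>Orthogonality of martingale increments\<close>

lemma martingaleD:
  assumes "martingale M F X" "0 \<le> t"
  shows "subalgebra M (F t)" "X t \<in> borel_measurable (F t)" "X t \<in> borel_measurable M" "integrable M (X t)"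
  using assms by (auto simp: martingale_def)

lemma martingale_sets_mono:
  assumes "martingale M F X" "0 \<le> s" "s \<le> t"
  shows "subalgebra (F t) (F s)"
  using assms filtration.sets_F_mono[of "space M" F s t] filtration.space_F[of "space M" F]
  unfolding martingale_def subalgebra_def by auto

lemma martingale_adapted:
  assumes "martingale M F X" "0 \<le> s" "s \<le> t"
  shows "X s \<in> borel_measurable (F t)"
  using measurable_from_subalg[OF martingale_sets_mono[OF assms]] martingaleD(2)[OF assms(1,2)] by blast

text \<open>Only integrability of the product is asked of the factor \<open>h\<close>, so that
  constants, indicators of past events and square-integrable weights are all covered.\<close>

lemma (in prob_space) martingale_increment:
  assumes mart: "martingale M F X" "0 \<le> s" "s \<le> t" and h: "h \<in> borel_measurable (F s)"
    and int: "integrable M (\<lambda>\<omega>. h \<omega> * X t \<omega>)"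
  shows "integrable M (\<lambda>\<omega>. h \<omega> * X s \<omega>)"
    and "expectation (\<lambda>\<omega>. h \<omega> * X t \<omega>) = expectation (\<lambda>\<omega>. h \<omega> * X s \<omega>)"
proof -
  have sub: "subalgebra M (F s)" by (rule martingaleD[OF mart(1,2)])
  interpret F: sigma_finite_subalgebra M "F s"
    by (rule finite_measure_subalgebra_is_sigma_finite[OF finite_measure_subalgebra.intro])
       (auto simp: finite_measure_axioms finite_measure_subalgebra_axioms_def sub)
  have Xt: "X t \<in> borel_measurable M" using martingaleD(3)[OF mart(1)] mart by simp
  have [measurable]: "h \<in> borel_measurable M" "X s \<in> borel_measurable M" "X t \<in> borel_measurable M"
    using measurable_from_subalg[OF sub h] martingaleD(3)[OF mart(1)] mart by auto
  have ae: "AE \<omega> in M. h \<omega> * real_cond_exp M (F s) (X t) \<omega> = h \<omega> * X s \<omega>"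
  proof -
    have "AE \<omega> in M. real_cond_exp M (F s) (X t) \<omega> = X s \<omega>" using mart unfolding martingale_def by blast
    then show ?thesis by eventually_elim simp
  qed
  note * = F.real_cond_exp_intg[OF int h Xt]
  have m: "(\<lambda>\<omega>. h \<omega> * real_cond_exp M (F s) (X t) \<omega>) \<in> borel_measurable M" by measurable
  show "integrable M (\<lambda>\<omega>. h \<omega> * X s \<omega>)"
    using integrable_cong_AE[THEN iffD1, OF _ _ ae *(1)] m by simp
  have "expectation (\<lambda>\<omega>. h \<omega> * real_cond_exp M (F s) (X t) \<omega>) = expectation (\<lambda>\<omega>. h \<omega> * X s \<omega>)"
    by (rule integral_cong_AE[OF _ _ ae]) measurable
  with *(2) show "expectation (\<lambda>\<omega>. h \<omega> * X t \<omega>) = expectation (\<lambda>\<omega>. h \<omega> * X s \<omega>)" by simp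
qed

lemma (in prob_space) martingale_orthogonal:
  assumes mart: "martingale M F X" "0 \<le> s" "s \<le> t" and h: "h \<in> borel_measurable (F s)"
    and L2: "square_integrable M h" "square_integrable M (X t)" "square_integrable M (X s)"
  shows "integrable M (\<lambda>\<omega>. h \<omega> * (X t \<omega> - X s \<omega>))"
    and "expectation (\<lambda>\<omega>. h \<omega> * (X t \<omega> - X s \<omega>)) = 0"
proof -
  have i: "integrable M (\<lambda>\<omega>. h \<omega> * X t \<omega>)" "integrable M (\<lambda>\<omega>. h \<omega> * X s \<omega>)"
    using L2 by (auto intro: square_integrable_mult_integrable)
  then show "integrable M (\<lambda>\<omega>. h \<omega> * (X t \<omega> - X s \<omega>))" by (simp add: algebra_simps)
  show "expectation (\<lambda>\<omega>. h \<omega> * (X t \<omega> - X s \<omega>)) = 0"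
    using i martingale_increment(2)[OF mart h i(1)] by (simp add: algebra_simps)
qed

lemma (in prob_space) martingale_expectation:
  assumes "martingale M F X" "0 \<le> s" "s \<le> t"
  shows "expectation (X t) = expectation (X s)"
  using martingale_increment(2)[OF assms, of "\<lambda>_. 1"] martingaleD(4)[OF assms(1), of t] assms by simp

lemma (in prob_space) martingale_increment_square:
  assumes mart: "martingale M F X" "0 \<le> s" "s \<le> t"
    and L2: "square_integrable M (X t)" "square_integrable M (X s)"
  shows "expectation (\<lambda>\<omega>. (X t \<omega> - X s \<omega>)\<^sup>2) = expectation (\<lambda>\<omega>. (X t \<omega>)\<^sup>2) - expectation (\<lambda>\<omega>. (X s \<omega>)\<^sup>2)"
proof -
  have o: "expectation (\<lambda>\<omega>. X s \<omega> * (X t \<omega> - X s \<omega>)) = 0" "integrable M (\<lambda>\<omega>. X s \<omega> * (X t \<omega> - X s \<omega>))"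
    using martingale_orthogonal[OF mart _ L2(2) L2] martingaleD(2)[OF mart(1,2)] by auto
  have sq: "integrable M (\<lambda>\<omega>. (X t \<omega>)\<^sup>2)" "integrable M (\<lambda>\<omega>. (X s \<omega>)\<^sup>2)"
    using L2 by (auto simp: square_integrable_def)
  have "(\<lambda>\<omega>. (X t \<omega> - X s \<omega>)\<^sup>2) = (\<lambda>\<omega>. (X t \<omega>)\<^sup>2 - (X s \<omega>)\<^sup>2 - 2 * (X s \<omega> * (X t \<omega> - X s \<omega>)))"
    by (auto simp: power2_eq_square algebra_simps)
  then show ?thesis using o sq by simp
qed

section \<open>Martingales sampled along a sequence of times\<close>

locale sampled_martingale = prob_space M for M :: "'a measure" +
  fixes F X and t :: "nat \<Rightarrow> real"
  assumes mart: "martingale M F X" and t0: "0 \<le> t 0" and t_mono: "mono t"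
    and L2: "\<And>s. 0 \<le> s \<Longrightarrow> square_integrable M (X s)"
begin

abbreviation x where "x \<omega> k \<equiv> X (t k) \<omega>"

lemma t_nonneg: "0 \<le> t k"
  using t0 t_mono by (meson le0 monoD order_trans)

lemma L2_sample: "square_integrable M (\<lambda>\<omega>. x \<omega> k)"
  using L2[OF t_nonneg] .

lemma adapted_sample: "k \<le> n \<Longrightarrow> (\<lambda>\<omega>. x \<omega> k) \<in> borel_measurable (F (t n))"
  using martingale_adapted[OF mart t_nonneg monoD[OF t_mono]] .

lemma L2_smax: "square_integrable M (\<lambda>\<omega>. smax (x \<omega>) n)"
  by (intro square_integrable_smax L2_sample)

lemma L2_smin: "square_integrable M (\<lambda>\<omega>. smin (x \<omega>) n)"
  by (intro square_integrable_smin L2_sample)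

lemma L2_srange: "square_integrable M (\<lambda>\<omega>. srange (x \<omega>) n)"
  unfolding srange_def by (intro square_integrable_diff L2_smax L2_smin)

lemma transform_zero_mean:
  assumes "\<And>k. k < n \<Longrightarrow> h k \<in> borel_measurable (F (t k))" "\<And>k. k < n \<Longrightarrow> square_integrable M (h k)"
  shows "integrable M (\<lambda>\<omega>. \<Sum>k<n. h k \<omega> * (x \<omega> (Suc k) - x \<omega> k))"
    and "expectation (\<lambda>\<omega>. \<Sum>k<n. h k \<omega> * (x \<omega> (Suc k) - x \<omega> k)) = 0"
proof -
  have *: "integrable M (\<lambda>\<omega>. h k \<omega> * (x \<omega> (Suc k) - x \<omega> k))"
    "expectation (\<lambda>\<omega>. h k \<omega> * (x \<omega> (Suc k) - x \<omega> k)) = 0" if "k < n" for k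
    using martingale_orthogonal[OF mart t_nonneg monoD[OF t_mono, of k "Suc k"] assms(1) assms(2)] that L2_sample
    by auto
  then show "integrable M (\<lambda>\<omega>. \<Sum>k<n. h k \<omega> * (x \<omega> (Suc k) - x \<omega> k))" by auto
  show "expectation (\<lambda>\<omega>. \<Sum>k<n. h k \<omega> * (x \<omega> (Suc k) - x \<omega> k)) = 0"
    using * by (subst Bochner_Integration.integral_sum) auto
qed

lemma potential_transform_zero_mean:
  fixes d :: real and n :: nat
  defines "Z \<equiv> \<lambda>\<omega>. \<Sum>k<n. potential_slope d (x \<omega> k) (smax (x \<omega>) k) (smin (x \<omega>) k) * (x \<omega> (Suc k) - x \<omega> k)"
  shows "integrable M Z" "expectation Z = 0"
  unfolding Z_def
  by (rule transform_zero_mean[of n "\<lambda>k \<omega>. potential_slope d (x \<omega> k) (smax (x \<omega>) k) (smin (x \<omega>) k)"];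
    intro borel_measurable_potential_slope borel_measurable_smax borel_measurable_smin adapted_sample
      square_integrable_potential_slope L2_sample L2_smax L2_smin; simp)+

lemma integrable_square: "integrable M (\<lambda>\<omega>. (x \<omega> k)\<^sup>2)"
  using L2_sample[of k] by (simp add: square_integrable_def)

lemma expected_range_le_potential:
  assumes "0 < d"
  shows "2 * d * expectation (\<lambda>\<omega>. srange (x \<omega>) n) \<le> 
    expectation (\<lambda>\<omega>. (x \<omega> n)\<^sup>2) - expectation (\<lambda>\<omega>. (x \<omega> 0)\<^sup>2) + 3 * d\<^sup>2"
proof -
  define Z where "Z = (\<lambda>\<omega>. \<Sum>k<n. potential_slope d (x \<omega> k) (smax (x \<omega>) k) (smin (x \<omega>) k) * (x \<omega> (Suc k) - x \<omega> k))"
  note Z = potential_transform_zero_mean[of d n, folded Z_def]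
  note i = square_integrable_integrable[OF L2_srange[of n]] integrable_square Z(1)
  have "expectation (\<lambda>\<omega>. 2 * d * srange (x \<omega>) n - (x \<omega> n)\<^sup>2) \<le> expectation (\<lambda>\<omega>. 3 * d\<^sup>2 - (x \<omega> 0)\<^sup>2 + Z \<omega>)"
    using potential_pathwise_le[OF assms] i unfolding Z_def by (intro integral_mono) auto
  then show ?thesis using i Z(2) by (simp add: prob_space)
qed

theorem expected_range_le:
  "expectation (\<lambda>\<omega>. srange (x \<omega>) n) \<le> sqrt 3 * sqrt (expectation (\<lambda>\<omega>. (x \<omega> n)\<^sup>2) - expectation (\<lambda>\<omega>. (x \<omega> 0)\<^sup>2))"
proof -
  define v where "v = expectation (\<lambda>\<omega>. (x \<omega> n)\<^sup>2) - expectation (\<lambda>\<omega>. (x \<omega> 0)\<^sup>2)"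
  define r where "r = expectation (\<lambda>\<omega>. srange (x \<omega>) n)"
  have "0 \<le> expectation (\<lambda>\<omega>. (x \<omega> n - x \<omega> 0)\<^sup>2)" by simp
  then have v0: "0 \<le> v" using martingale_increment_square[OF mart t_nonneg monoD[OF t_mono, of 0 n] L2_sample L2_sample]
    by (simp add: v_def)
  have b: "2 * d * r \<le> v + 3 * d\<^sup>2" if "0 < d" for d
    using expected_range_le_potential[OF that, of n] by (simp add: v_def r_def)
  have "r \<le> sqrt 3 * sqrt v"
  proof (cases "v = 0")
    case True
    \<comment> \<open>For \<open>v = 0\<close> the optimal parameter degenerates to 0, so a small
      one is used: \<open>d = e / 3\<close> makes the bound for \<open>r\<close> equal to
      \<open>e / 2\<close>.\<close>
    have "r \<le> e" if "0 < e" for e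
    proof -
      have "2 * (e / 3) * r \<le> 2 * (e / 3) * (e / 2)" using b[of "e/3"] that True by (simp add: power2_eq_square)
      then have "r \<le> e / 2" using that by (subst (asm) mult_le_cancel_left_pos) auto
      then show ?thesis using that by simp
    qed
    then have "r \<le> 0" by (rule field_le_epsilon[of r 0, simplified])
    then show ?thesis using True by simp
  next
    case False
    \<comment> \<open>The minimiser of \<open>(v + 3 * d\<^sup>2) / (2 * d)\<close>, with minimum
      \<open>3 * d\<close>.\<close>
    define d where "d = sqrt v / sqrt 3"
    have d: "0 < d" "3 * d\<^sup>2 = v" using False v0 by (auto simp: d_def power_divide)
    have e: "sqrt 3 * sqrt v = 3 * d" by (simp add: d_def field_simps real_div_sqrt)
    have "2 * d * r \<le> 2 * d * (3 * d)" using b[OF d(1)] d(2) by (simp add: power2_eq_square)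
    then have "r \<le> 3 * d" using d(1) by (subst (asm) mult_le_cancel_left_pos) auto
    then show ?thesis by (simp add: e)
  qed
  then show ?thesis by (simp add: r_def v_def)
qed

lemma expected_range_ge_potential:
  assumes "0 < d" and wing: "AE \<omega> in M. \<forall>k<n. same_wing d (smax (x \<omega>) k) (smin (x \<omega>) k) (x \<omega> k) (x \<omega> (Suc k))"
  defines "w \<equiv> \<lambda>\<omega>. excess d (x \<omega> n) (smax (x \<omega>) n) (smin (x \<omega>) n)"
  shows "expectation (\<lambda>\<omega>. (x \<omega> n)\<^sup>2) - expectation (\<lambda>\<omega>. (x \<omega> 0)\<^sup>2) + 3 * d\<^sup>2
    \<le> 2 * d * expectation (\<lambda>\<omega>. srange (x \<omega>) n) + expectation w + expectation (\<lambda>\<omega>. overshoot (x \<omega>) n)"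
    and "integrable M w" "integrable M (\<lambda>\<omega>. overshoot (x \<omega>) n)"
proof -
  define Z where "Z = (\<lambda>\<omega>. \<Sum>k<n. potential_slope d (x \<omega> k) (smax (x \<omega>) k) (smin (x \<omega>) k) * (x \<omega> (Suc k) - x \<omega> k))"
  note Z = potential_transform_zero_mean[of d n, folded Z_def]
  have m[measurable]: "(\<lambda>\<omega>. smax (x \<omega>) k) \<in> borel_measurable M" "(\<lambda>\<omega>. smin (x \<omega>) k) \<in> borel_measurable M"
    "(\<lambda>\<omega>. x \<omega> k) \<in> borel_measurable M" for k
    by (intro square_integrable_measurable L2_smax L2_smin L2_sample)+
  have wm: "w \<in> borel_measurable M" unfolding w_def excess_def potential_def by measurable
  show w: "integrable M w"
  proof (rule integrable_const_bound[of _ "3 * d\<^sup>2"])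
    show "AE \<omega> in M. norm (w \<omega>) \<le> 3 * d\<^sup>2"
    proof (rule AE_I2)
      fix \<omega>
      show "norm (w \<omega>) \<le> 3 * d\<^sup>2"
        using excess_le[OF assms(1), of "smin (x \<omega>) n" "x \<omega> n" "smax (x \<omega>) n"] smax_ge[of n n "x \<omega>"]
          excess_nonneg[OF assms(1), of "smin (x \<omega>) n" "x \<omega> n" "smax (x \<omega>) n"] smin_le[of n n "x \<omega>"]
        by (simp add: w_def)
    qed
  qed (fact wm)
  show o: "integrable M (\<lambda>\<omega>. overshoot (x \<omega>) n)"
    unfolding overshoot_def
    using square_integrable_diff[OF L2_smax L2_smax] square_integrable_diff[OF L2_smin L2_smin]
    unfolding square_integrable_def by (intro Bochner_Integration.integrable_sum Bochner_Integration.integrable_add) (auto simp del: smax.simps smin.simps)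
  note i = square_integrable_integrable[OF L2_srange[of n]] integrable_square Z(1) w o
  have "expectation (\<lambda>\<omega>. 3 * d\<^sup>2 - (x \<omega> 0)\<^sup>2 + Z \<omega>) \<le> expectation (\<lambda>\<omega>. 2 * d * srange (x \<omega>) n - (x \<omega> n)\<^sup>2 + w \<omega> + overshoot (x \<omega>) n)"
  proof (rule integral_mono_AE)
    show "AE \<omega> in M. 3 * d\<^sup>2 - (x \<omega> 0)\<^sup>2 + Z \<omega> \<le> 2 * d * srange (x \<omega>) n - (x \<omega> n)\<^sup>2 + w \<omega> + overshoot (x \<omega>) n"
      using wing
    proof eventually_elim
      case (elim \<omega>)
      then show ?case unfolding Z_def w_def by (intro potential_pathwise_ge assms(1)) auto
    qed
  qed (use i in auto)
  then show "expectation (\<lambda>\<omega>. (x \<omega> n)\<^sup>2) - expectation (\<lambda>\<omega>. (x \<omega> 0)\<^sup>2) + 3 * d\<^sup>2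
    \<le> 2 * d * expectation (\<lambda>\<omega>. srange (x \<omega>) n) + expectation w + expectation (\<lambda>\<omega>. overshoot (x \<omega>) n)"
    using i Z(2) by (simp add: prob_space)
qed

lemma doob_smax:
  "expectation (\<lambda>\<omega>. (smax (x \<omega>) n - x \<omega> 0)\<^sup>2) \<le> 4 * expectation (\<lambda>\<omega>. (x \<omega> n - x \<omega> 0)\<^sup>2)"
proof -
  define Z where "Z = (\<lambda>\<omega>. \<Sum>k<n. (smax (x \<omega>) k - x \<omega> 0) * (x \<omega> (Suc k) - x \<omega> k))"
  have Z: "integrable M Z" "expectation Z = 0" unfolding Z_def
    by (rule transform_zero_mean[of n "\<lambda>k \<omega>. smax (x \<omega>) k - x \<omega> 0"];
        intro borel_measurable_diff borel_measurable_smax adapted_sample square_integrable_diff L2_smax L2_sample; simp)+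
  have i: "integrable M (\<lambda>\<omega>. (smax (x \<omega>) n - x \<omega> 0)\<^sup>2)" "integrable M (\<lambda>\<omega>. (x \<omega> n - x \<omega> 0)\<^sup>2)"
    using square_integrable_diff[OF L2_smax L2_sample, of n 0] square_integrable_diff[OF L2_sample L2_sample, of n 0]
    by (auto simp: square_integrable_def)
  have "expectation (\<lambda>\<omega>. (smax (x \<omega>) n - x \<omega> 0)\<^sup>2) \<le> expectation (\<lambda>\<omega>. 4 * (x \<omega> n - x \<omega> 0)\<^sup>2 - 4 * Z \<omega>)"
    using doob_pathwise i Z unfolding Z_def by (intro integral_mono) auto
  then show ?thesis using i Z by simp
qed

end

text \<open>Turns minima into maxima, so that the maximal inequality also controls the downward part
  of the range.\<close>

lemma martingale_uminus:
  assumes "prob_space M" "martingale M F X"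
  shows "martingale M F (\<lambda>t \<omega>. - X t \<omega>)"
proof -
  have "AE \<omega> in M. real_cond_exp M (F s) (\<lambda>\<omega>. - X t \<omega>) \<omega> = - X s \<omega>" if "0 \<le> s" "s \<le> t" for s t
  proof -
    interpret prob_space M by fact
    have sub: "subalgebra M (F s)" by (rule martingaleD[OF assms(2) that(1)])
    interpret F: sigma_finite_subalgebra M "F s"
      by (rule finite_measure_subalgebra_is_sigma_finite[OF finite_measure_subalgebra.intro])
         (auto simp: finite_measure_axioms finite_measure_subalgebra_axioms_def sub)
    have "AE \<omega> in M. real_cond_exp M (F s) (\<lambda>\<omega>. - 1 * X t \<omega>) \<omega> = - 1 * real_cond_exp M (F s) (X t) \<omega>"
      using martingaleD(4)[OF assms(2)] that by (intro F.real_cond_exp_cmult) auto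
    moreover have "AE \<omega> in M. real_cond_exp M (F s) (X t) \<omega> = X s \<omega>"
      using assms(2) that by (auto simp: martingale_def)
    ultimately show ?thesis by auto
  qed
  then show ?thesis using assms(2) unfolding martingale_def by auto
qed

text \<open>The range is split at the starting value. Both parts obey Doob's inequality with factor
  4, and squaring a sum of two terms costs a factor 2 on each:
  \<open>2 * 4 + 2 * 4 = 16\<close>.\<close>

lemma (in sampled_martingale) doob_srange:
  "expectation (\<lambda>\<omega>. (srange (x \<omega>) n)\<^sup>2) \<le> 16 * expectation (\<lambda>\<omega>. (x \<omega> n - x \<omega> 0)\<^sup>2)"
proof -
  interpret neg: sampled_martingale M F "\<lambda>t \<omega>. - X t \<omega>" t
    by unfold_locales
       (use martingale_uminus[OF prob_space_axioms mart] t0 t_mono square_integrable_cmult[OF L2, of _ "-1"] in auto)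
  have i: "integrable M (\<lambda>\<omega>. (smax (x \<omega>) n - x \<omega> 0)\<^sup>2)" "integrable M (\<lambda>\<omega>. (x \<omega> 0 - smin (x \<omega>) n)\<^sup>2)"
    "integrable M (\<lambda>\<omega>. (srange (x \<omega>) n)\<^sup>2)"
    using square_integrable_diff[OF L2_smax L2_sample, of n 0] square_integrable_diff[OF L2_sample L2_smin, of 0 n] L2_srange[of n]
    by (auto simp: square_integrable_def)
  have *: "(\<lambda>\<omega>. (x \<omega> 0 - smin (x \<omega>) n)\<^sup>2) = (\<lambda>\<omega>. (smax (\<lambda>k. - x \<omega> k) n - - x \<omega> 0)\<^sup>2)"
    by (simp add: smin_eq add.commute)
  have **: "(\<lambda>\<omega>. (- x \<omega> n - - x \<omega> 0)\<^sup>2) = (\<lambda>\<omega>. (x \<omega> n - x \<omega> 0)\<^sup>2)" by (simp add: power2_commute)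
  have "expectation (\<lambda>\<omega>. (srange (x \<omega>) n)\<^sup>2) \<le> expectation (\<lambda>\<omega>. 2 * (smax (x \<omega>) n - x \<omega> 0)\<^sup>2 + 2 * (x \<omega> 0 - smin (x \<omega>) n)\<^sup>2)"
  proof (rule integral_mono)
    fix \<omega>
    have "(p - q)\<^sup>2 \<le> 2 * (p - r)\<^sup>2 + 2 * (r - q)\<^sup>2" for p q r :: real
      using zero_le_power2[of "p + q - 2 * r"] by (simp add: power2_eq_square algebra_simps)
    then show "(srange (x \<omega>) n)\<^sup>2 \<le> 2 * (smax (x \<omega>) n - x \<omega> 0)\<^sup>2 + 2 * (x \<omega> 0 - smin (x \<omega>) n)\<^sup>2"
      by (simp add: srange_def)
  qed (use i in auto)
  also have "\<dots> \<le> 16 * expectation (\<lambda>\<omega>. (x \<omega> n - x \<omega> 0)\<^sup>2)"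
    using doob_smax[of n] neg.doob_smax[of n] i unfolding ** unfolding *[symmetric] by simp
  finally show ?thesis .
qed

section \<open>Passage to continuous time\<close>

lemma path_diameter_ge:
  assumes "0 \<le> s" "0 \<le> t"
  shows "ennreal (X s \<omega> - X t \<omega>) \<le> path_diameter X \<omega>"
proof -
  have "ereal (X s \<omega>) - ereal (X t \<omega>) \<le> (SUP t\<in>{0..}. ereal (X t \<omega>)) - (INF t\<in>{0..}. ereal (X t \<omega>))"
    using assms by (intro ereal_minus_mono SUP_upper INF_lower) auto
  then have "e2ennreal (ereal (X s \<omega> - X t \<omega>)) \<le> path_diameter X \<omega>"
    unfolding path_diameter_def by (intro e2ennreal_mono) simp
  then show ?thesis by simp
qed

text \<open>For finite \<open>c\<close> the bound, compared with the value at time 0, forces the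
  supremum and the infimum to be finite, so their extended real difference is an ordinary
  one.\<close>

lemma path_diameter_le:
  assumes "\<And>s t. 0 \<le> s \<Longrightarrow> 0 \<le> t \<Longrightarrow> ennreal (X s \<omega> - X t \<omega>) \<le> c"
  shows "path_diameter X \<omega> \<le> c"
proof (cases c)
  case (real r)
  have le: "X s \<omega> - X t \<omega> \<le> r" if "0 \<le> s" "0 \<le> t" for s t
    using assms[OF that] real by (simp add: ennreal_le_iff)
  define S where "S = (SUP t\<in>{0..}. ereal (X t \<omega>))"
  define I where "I = (INF t\<in>{0..}. ereal (X t \<omega>))"
  have S: "S \<le> ereal (r + X t \<omega>)" if "0 \<le> t" for t
    unfolding S_def using le[OF _ that] by (intro SUP_least) (auto simp: algebra_simps)
  have "ereal (X 0 \<omega>) \<le> S" unfolding S_def by (intro SUP_upper) auto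
  then obtain \<sigma> where \<sigma>: "S = ereal \<sigma>" using S[of 0] by (cases S) auto
  have "ereal (\<sigma> - r) \<le> I" unfolding I_def using S \<sigma> by (intro INF_greatest) (auto simp: algebra_simps)
  moreover have "I \<le> ereal (X 0 \<omega>)" unfolding I_def by (intro INF_lower) auto
  ultimately have "S - I \<le> ereal r" using \<sigma> by (cases I) auto
  then have "e2ennreal (S - I) \<le> e2ennreal (ereal r)" by (rule e2ennreal_mono)
  then show ?thesis using real by (simp add: path_diameter_def S_def I_def)
qed simp

section \<open>Dyadic grids\<close>

definition dyadic :: "nat \<Rightarrow> nat \<Rightarrow> real" where
  "dyadic n k = real k / 2 ^ n"

lemma dyadic_nonneg [simp]: "0 \<le> dyadic n k"
  by (simp add: dyadic_def)

lemma dyadic_0 [simp]: "dyadic n 0 = 0"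
  by (simp add: dyadic_def)

lemma dyadic_last [simp]: "dyadic n (n * 2 ^ n) = real n"
  by (simp add: dyadic_def)

lemma mono_dyadic: "mono (dyadic n)"
  by (auto simp: dyadic_def mono_def divide_right_mono)

lemma dyadic_Suc: "dyadic n (Suc k) - dyadic n k = 1 / 2 ^ n"
  by (simp add: dyadic_def diff_divide_distrib[symmetric])

definition dyadic_range :: "(real \<Rightarrow> 'a \<Rightarrow> real) \<Rightarrow> nat \<Rightarrow> 'a \<Rightarrow> real" where
  "dyadic_range X n \<omega> = srange (\<lambda>k. X (dyadic n k) \<omega>) (n * 2 ^ n)"

lemma srange_nonneg: "0 \<le> srange x n"
  using smax_ge[of n n x] smin_le[of n n x] by (simp add: srange_def)

lemma dyadic_range_nonneg [simp]: "0 \<le> dyadic_range X n \<omega>"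
  by (simp add: dyadic_range_def srange_nonneg)

lemma dyadic_range_le: "ennreal (dyadic_range X n \<omega>) \<le> path_diameter X \<omega>"
proof -
  define x where "x = (\<lambda>k. X (dyadic n k) \<omega>)"
  obtain i j where "smax x (n * 2 ^ n) = x i" "smin x (n * 2 ^ n) = x j"
    using smax_attained smin_attained by blast
  then show ?thesis using path_diameter_ge[of "dyadic n i" "dyadic n j" X \<omega>]
    by (simp add: dyadic_range_def srange_def x_def)
qed

text \<open>Rounding \<open>s\<close> up to the grid keeps the approximating times on the side where
  \<open>f\<close> is continuous. The grid of order \<open>n\<close> ends at \<open>n\<close>, so it
  contains the rounded time as soon as \<open>s + 1 \<le> n\<close>.\<close>

lemma dyadic_approx_right:
  fixes f :: "real \<Rightarrow> real"
  assumes "0 \<le> s" "continuous (at_right s) f"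
  obtains k where "\<forall>\<^sub>F n in sequentially. k n \<le> n * 2 ^ n" "(\<lambda>n. f (dyadic n (k n))) \<longlonglongrightarrow> f s"
    "(\<lambda>n. dyadic n (k n)) \<longlonglongrightarrow> s" "\<And>n. s \<le> dyadic n (k n)"
proof -
  define k where "k = (\<lambda>n. nat \<lceil>s * 2 ^ n\<rceil>)"
  have k: "real (k n) = of_int \<lceil>s * 2 ^ n\<rceil>" for n
    using assms(1) by (simp add: k_def)
  have lo: "s \<le> dyadic n (k n)" and hi: "dyadic n (k n) \<le> s + 1 / 2 ^ n" for n
    using ceiling_correct[of "s * 2 ^ n"] by (simp_all add: dyadic_def k field_simps)
  have "(\<lambda>n. s + 1 / 2 ^ n) \<longlonglongrightarrow> s + 0"
    by (intro tendsto_intros LIMSEQ_divide_realpow_zero) auto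
  then have lim: "(\<lambda>n. dyadic n (k n)) \<longlonglongrightarrow> s"
    using lo hi by (intro tendsto_sandwich[of "\<lambda>_. s" "\<lambda>n. dyadic n (k n)" sequentially "\<lambda>n. s + 1/2^n"]) auto
  have "continuous (at s within {s..}) f"
    using assms(2) by (simp add: at_within_Ici_at_right)
  then have "(\<lambda>n. f (dyadic n (k n))) \<longlonglongrightarrow> f s"
    unfolding continuous_within_sequentially using lo lim by (auto simp: o_def)
  moreover have "\<forall>\<^sub>F n in sequentially. k n \<le> n * 2 ^ n"
    using eventually_ge_at_top[of "nat \<lceil>s + 1\<rceil>"]
  proof eventually_elim
    case (elim n)
    have "(1::real) \<le> 2 ^ n" by simp
    then have "1 / 2 ^ n \<le> (1::real)" by (subst divide_le_eq_1) auto
    then have "dyadic n (k n) \<le> s + 1" using hi[of n] by linarith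
    also have "\<dots> \<le> real n" using elim by linarith
    finally have "real (k n) \<le> real (n * 2 ^ n)" by (simp add: dyadic_def divide_le_eq)
    then show ?case by (simp only: of_nat_le_iff)
  qed
  ultimately show thesis using lim lo that by blast
qed

text \<open>The lower limit is the form in which Fatou's lemma takes the approximation.\<close>

lemma path_diameter_le_liminf:
  assumes rc: "\<forall>t\<ge>0. continuous (at_right t) (\<lambda>s. X s \<omega>)"
  shows "path_diameter X \<omega> \<le> liminf (\<lambda>n. ennreal (dyadic_range X n \<omega>))"
proof (rule path_diameter_le)
  fix s t :: real assume st: "0 \<le> s" "0 \<le> t"
  obtain k where k: "\<forall>\<^sub>F n in sequentially. k n \<le> n * 2 ^ n" "(\<lambda>n. X (dyadic n (k n)) \<omega>) \<longlonglongrightarrow> X s \<omega>"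
    by (rule dyadic_approx_right[OF st(1) rc[rule_format, OF st(1)]])
  obtain j where j: "\<forall>\<^sub>F n in sequentially. j n \<le> n * 2 ^ n" "(\<lambda>n. X (dyadic n (j n)) \<omega>) \<longlonglongrightarrow> X t \<omega>"
    by (rule dyadic_approx_right[OF st(2) rc[rule_format, OF st(2)]])
  have "(\<lambda>n. ennreal (X (dyadic n (k n)) \<omega> - X (dyadic n (j n)) \<omega>)) \<longlonglongrightarrow> ennreal (X s \<omega> - X t \<omega>)"
    by (intro tendsto_ennrealI tendsto_diff k j)
  then have "ennreal (X s \<omega> - X t \<omega>) = liminf (\<lambda>n. ennreal (X (dyadic n (k n)) \<omega> - X (dyadic n (j n)) \<omega>))"
    by (simp add: lim_imp_Liminf)
  also have "\<dots> \<le> liminf (\<lambda>n. ennreal (dyadic_range X n \<omega>))"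
  proof (rule Liminf_mono)
    show "\<forall>\<^sub>F n in sequentially. ennreal (X (dyadic n (k n)) \<omega> - X (dyadic n (j n)) \<omega>) \<le> ennreal (dyadic_range X n \<omega>)"
      using k(1) j(1)
    proof eventually_elim
      case (elim n)
      then show ?case
        unfolding dyadic_range_def srange_def
        using smax_ge[of "k n" "n * 2 ^ n" "\<lambda>k. X (dyadic n k) \<omega>"] smin_le[of "j n" "n * 2 ^ n" "\<lambda>k. X (dyadic n k) \<omega>"]
        by (intro ennreal_leI) linarith
    qed
  qed
  finally show "ennreal (X s \<omega> - X t \<omega>) \<le> liminf (\<lambda>n. ennreal (dyadic_range X n \<omega>))" .
qed

text \<open>This expresses suprema over a continuum of times through countably many of them, which
  is where measurability of the diameter comes from.\<close>

lemma path_diameter_eq_liminf: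
  assumes "\<forall>t\<ge>0. continuous (at_right t) (\<lambda>s. X s \<omega>)"
  shows "path_diameter X \<omega> = liminf (\<lambda>n. ennreal (dyadic_range X n \<omega>))"
proof (rule antisym[OF path_diameter_le_liminf[where X = X and \<omega> = \<omega>, OF assms]])
  have "liminf (\<lambda>n. ennreal (dyadic_range X n \<omega>)) \<le> liminf (\<lambda>n::nat. path_diameter X \<omega>)"
    by (intro Liminf_mono always_eventually allI dyadic_range_le)
  then show "liminf (\<lambda>n. ennreal (dyadic_range X n \<omega>)) \<le> path_diameter X \<omega>" by (simp add: Liminf_const)
qed

lemma dyadic_range_tendsto:
  assumes "\<forall>t\<ge>0. continuous (at_right t) (\<lambda>s. X s \<omega>)" "path_diameter X \<omega> < \<infinity>"
  shows "(\<lambda>n. dyadic_range X n \<omega>) \<longlonglongrightarrow> enn2real (path_diameter X \<omega>)"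
proof -
  have "limsup (\<lambda>n. ennreal (dyadic_range X n \<omega>)) \<le> limsup (\<lambda>n::nat. path_diameter X \<omega>)"
    by (intro Limsup_mono always_eventually allI dyadic_range_le)
  then have "limsup (\<lambda>n. ennreal (dyadic_range X n \<omega>)) \<le> path_diameter X \<omega>" by (simp add: Limsup_const)
  then have "(\<lambda>n. ennreal (dyadic_range X n \<omega>)) \<longlonglongrightarrow> path_diameter X \<omega>"
    using path_diameter_eq_liminf[where X = X and \<omega> = \<omega>, OF assms(1)] Liminf_le_Limsup[of sequentially "\<lambda>n. ennreal (dyadic_range X n \<omega>)"]
    by (intro Liminf_eq_Limsup) (auto intro: antisym)
  moreover have "path_diameter X \<omega> = ennreal (enn2real (path_diameter X \<omega>))"
    using assms(2) by simp
  ultimately have "(\<lambda>n. ennreal (dyadic_range X n \<omega>)) \<longlonglongrightarrow> ennreal (enn2real (path_diameter X \<omega>))"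
    by metis
  then have "(\<lambda>n. enn2real (ennreal (dyadic_range X n \<omega>))) \<longlonglongrightarrow> enn2real (path_diameter X \<omega>)"
    by (rule tendsto_enn2real) simp
  then show ?thesis by simp
qed

section \<open>Moments of square-bounded martingales and the upper bound\<close>

definition moment2_bound :: "'a measure \<Rightarrow> (real \<Rightarrow> 'a \<Rightarrow> real) \<Rightarrow> real \<Rightarrow> bool" where
  "moment2_bound M X C \<longleftrightarrow> (\<forall>t\<ge>0. square_integrable M (X t) \<and> (\<integral>\<omega>. (X t \<omega>)\<^sup>2 \<partial>M) \<le> C)"

text \<open>The Bochner integral of a non-integrable function is 0, so a bound on it says nothing by
  itself; square integrability has to be extracted from the extended integral first.\<close>

lemma L2_bounded_iff_moment2_bound:
  assumes "\<And>t. 0 \<le> t \<Longrightarrow> X t \<in> borel_measurable M"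
  shows "L2_bounded M X \<longleftrightarrow> (\<exists>C. moment2_bound M X C)"
proof
  assume L: "L2_bounded M X"
  define c where "c = (SUP t\<in>{0..}. \<integral>\<^sup>+ \<omega>. ennreal ((X t \<omega>)\<^sup>2) \<partial>M)"
  have c: "c < \<infinity>" using L by (simp add: L2_bounded_def c_def)
  have *: "(\<integral>\<^sup>+ \<omega>. ennreal ((X t \<omega>)\<^sup>2) \<partial>M) \<le> c" if "0 \<le> t" for t
    unfolding c_def using that by (intro SUP_upper) auto
  have "moment2_bound M X (enn2real c)"
    unfolding moment2_bound_def
  proof (intro allI impI conjI)
    fix t :: real assume t: "0 \<le> t"
    have [measurable]: "X t \<in> borel_measurable M" using assms t .
    show si: "square_integrable M (X t)"
      unfolding square_integrable_def
    proof
      show "integrable M (\<lambda>\<omega>. (X t \<omega>)\<^sup>2)"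
        using *[OF t] c by (intro integrableI_nonneg) auto
    qed measurable
    have "(\<integral>\<^sup>+ \<omega>. ennreal ((X t \<omega>)\<^sup>2) \<partial>M) = ennreal (\<integral>\<omega>. (X t \<omega>)\<^sup>2 \<partial>M)"
      using si by (intro nn_integral_eq_integral) (auto simp: square_integrable_def)
    then have "ennreal (\<integral>\<omega>. (X t \<omega>)\<^sup>2 \<partial>M) \<le> c" using *[OF t] by simp
    then have "enn2real (ennreal (\<integral>\<omega>. (X t \<omega>)\<^sup>2 \<partial>M)) \<le> enn2real c"
      using c by (intro enn2real_mono) auto
    then show "(\<integral>\<omega>. (X t \<omega>)\<^sup>2 \<partial>M) \<le> enn2real c" by simp
  qed
  then show "\<exists>C. moment2_bound M X C" ..
next
  assume "\<exists>C. moment2_bound M X C"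
  then obtain C where C: "moment2_bound M X C" ..
  have "(SUP t\<in>{0..}. \<integral>\<^sup>+ \<omega>. ennreal ((X t \<omega>)\<^sup>2) \<partial>M) \<le> ennreal C"
  proof (rule SUP_least)
    fix t :: real assume "t \<in> {0..}"
    then have "integrable M (\<lambda>\<omega>. (X t \<omega>)\<^sup>2)" "(\<integral>\<omega>. (X t \<omega>)\<^sup>2 \<partial>M) \<le> C"
      using C by (auto simp: moment2_bound_def square_integrable_def)
    then show "(\<integral>\<^sup>+ \<omega>. ennreal ((X t \<omega>)\<^sup>2) \<partial>M) \<le> ennreal C"
      by (subst nn_integral_eq_integral) (auto intro: ennreal_leI)
  qed
  then show "L2_bounded M X" unfolding L2_bounded_def by (metis ennreal_less_top infinity_ennreal_def le_less_trans)
qed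

lemma (in prob_space) sampled_martingale_dyadic:
  assumes "martingale M F X" "moment2_bound M X C"
  shows "sampled_martingale M F X (dyadic n)"
  using assms by unfold_locales (auto simp: moment2_bound_def mono_dyadic)

lemma (in prob_space) square_expectation_le:
  assumes "square_integrable M f"
  shows "(expectation f)\<^sup>2 \<le> expectation (\<lambda>\<omega>. (f \<omega>)\<^sup>2)"
proof -
  have "variance f = expectation (\<lambda>\<omega>. (f \<omega>)\<^sup>2) - (expectation f)\<^sup>2"
    using assms square_integrable_integrable[OF assms] by (intro variance_eq) (auto simp: square_integrable_def)
  moreover have "0 \<le> variance f" by simp
  ultimately show ?thesis by linarith
qed

lemma (in prob_space) martingale_moment2_mono:
  assumes "martingale M F X" "moment2_bound M X C" "0 \<le> s" "s \<le> t"
  shows "expectation (\<lambda>\<omega>. (X s \<omega>)\<^sup>2) \<le> expectation (\<lambda>\<omega>. (X t \<omega>)\<^sup>2)"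
proof -
  have "0 \<le> expectation (\<lambda>\<omega>. (X t \<omega> - X s \<omega>)\<^sup>2)" by simp
  then show ?thesis
    using assms by (subst (asm) martingale_increment_square[OF assms(1,3,4)]) (auto simp: moment2_bound_def)
qed

text \<open>Pathwise convergence is given; convergence in the square mean comes from orthogonality.
  The second moments \<open>a n\<close> increase to some \<open>A\<close>, the increment from
  \<open>n\<close> to \<open>m\<close> has second moment \<open>a m - a n \<le> A - a n\<close>, and
  Fatou's lemma in \<open>m\<close> carries this bound over to \<open>Y - X n\<close>.\<close>

lemma (in prob_space) last_term_moments:
  assumes mart: "martingale M F X" and C: "moment2_bound M X C" and Y: "last_term M X Y"
  shows "square_integrable M Y" "expectation Y = expectation (X 0)"
    "(\<lambda>n. expectation (\<lambda>\<omega>. (X (real n) \<omega>)\<^sup>2)) \<longlonglongrightarrow> expectation (\<lambda>\<omega>. (Y \<omega>)\<^sup>2)"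
proof -
  define a where "a = (\<lambda>n. expectation (\<lambda>\<omega>. (X (real n) \<omega>)\<^sup>2))"
  have Ym[measurable]: "Y \<in> borel_measurable M" using Y by (simp add: last_term_def)
  have si: "square_integrable M (X (real n))" for n using C by (simp add: moment2_bound_def)
  have Xm[measurable]: "X (real n) \<in> borel_measurable M" for n using si square_integrable_measurable by blast
  have aC: "a n \<le> C" for n using C by (simp add: a_def moment2_bound_def)
  have "incseq a" unfolding a_def by (intro incseq_SucI martingale_moment2_mono[OF mart C]) auto
  then obtain A where A: "a \<longlonglongrightarrow> A" "\<And>n. a n \<le> A"
    using incseq_convergent[of a C] aC by blast
  have lim: "AE \<omega> in M. (\<lambda>n. X (real n) \<omega>) \<longlonglongrightarrow> Y \<omega>"
    using Y unfolding last_term_def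
    by (auto elim!: eventually_mono intro: filterlim_compose[OF _ filterlim_real_sequentially])
  \<comment> \<open>Used twice: \<open>g = 0\<close> gives the second moment of \<open>Y\<close>,
    \<open>g = X n\<close> gives its distance to the martingale.\<close>
  have fatou: "square_integrable M (\<lambda>\<omega>. Y \<omega> - g \<omega>) \<and> expectation (\<lambda>\<omega>. (Y \<omega> - g \<omega>)\<^sup>2) \<le> K"
    if g: "square_integrable M g" and K: "\<forall>\<^sub>F m in sequentially. expectation (\<lambda>\<omega>. (X (real m) \<omega> - g \<omega>)\<^sup>2) \<le> K" for g K
  proof -
    have [measurable]: "g \<in> borel_measurable M" using g square_integrable_measurable by blast
    have K0: "0 \<le> K"
    proof -
      obtain m where "expectation (\<lambda>\<omega>. (X (real m) \<omega> - g \<omega>)\<^sup>2) \<le> K" using K eventually_sequentially by auto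
      moreover have "0 \<le> expectation (\<lambda>\<omega>. (X (real m) \<omega> - g \<omega>)\<^sup>2)" by simp
      ultimately show ?thesis by linarith
    qed
    have "(\<integral>\<^sup>+ \<omega>. ennreal ((Y \<omega> - g \<omega>)\<^sup>2) \<partial>M) = (\<integral>\<^sup>+ \<omega>. liminf (\<lambda>m. ennreal ((X (real m) \<omega> - g \<omega>)\<^sup>2)) \<partial>M)"
    proof (rule nn_integral_cong_AE, use lim in eventually_elim)
      case (elim \<omega>)
      have "(\<lambda>m. ennreal ((X (real m) \<omega> - g \<omega>)\<^sup>2)) \<longlonglongrightarrow> ennreal ((Y \<omega> - g \<omega>)\<^sup>2)"
        by (intro tendsto_ennrealI tendsto_intros elim)
      then show ?case by (rule lim_imp_Liminf[OF trivial_limit_sequentially, symmetric])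
    qed
    also have "\<dots> \<le> liminf (\<lambda>m. \<integral>\<^sup>+ \<omega>. ennreal ((X (real m) \<omega> - g \<omega>)\<^sup>2) \<partial>M)"
      by (intro nn_integral_liminf) measurable
    also have "\<dots> \<le> liminf (\<lambda>m::nat. ennreal K)"
    proof (rule Liminf_mono, use K in eventually_elim)
      case (elim m)
      have "integrable M (\<lambda>\<omega>. (X (real m) \<omega> - g \<omega>)\<^sup>2)"
        using square_integrable_diff[OF si g] by (simp add: square_integrable_def)
      then show ?case using elim by (subst nn_integral_eq_integral) (auto intro: ennreal_leI)
    qed
    finally have *: "(\<integral>\<^sup>+ \<omega>. ennreal ((Y \<omega> - g \<omega>)\<^sup>2) \<partial>M) \<le> ennreal K" by (simp add: Liminf_const)
    have i: "integrable M (\<lambda>\<omega>. (Y \<omega> - g \<omega>)\<^sup>2)"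
      using * by (intro integrableI_nonneg) (auto intro: le_less_trans)
    moreover have "ennreal (expectation (\<lambda>\<omega>. (Y \<omega> - g \<omega>)\<^sup>2)) \<le> ennreal K"
      using * i by (subst (asm) nn_integral_eq_integral) auto
    ultimately show ?thesis using K0 by (simp add: square_integrable_def ennreal_le_iff)
  qed
  have Y2: "square_integrable M Y" "expectation (\<lambda>\<omega>. (Y \<omega>)\<^sup>2) \<le> A"
    using fatou[OF square_integrable_const[of 0], of A] A(2) by (auto simp: a_def)
  then show "square_integrable M Y" by simp
  have diff: "expectation (\<lambda>\<omega>. (Y \<omega> - X (real n) \<omega>)\<^sup>2) \<le> A - a n" for n
  proof -
    have "\<forall>\<^sub>F m in sequentially. expectation (\<lambda>\<omega>. (X (real m) \<omega> - X (real n) \<omega>)\<^sup>2) \<le> A - a n"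
      using eventually_ge_at_top[of n]
    proof eventually_elim
      case (elim m)
      then show ?case using martingale_increment_square[OF mart, of "real n" "real m"] si A(2)[of m] by (simp add: a_def)
    qed
    then show ?thesis using fatou[OF si] by blast
  qed
  have lim0: "(\<lambda>n. A - a n) \<longlonglongrightarrow> 0" using tendsto_diff[OF tendsto_const A(1), of A] by simp
  have "(expectation Y - expectation (X 0))\<^sup>2 \<le> A - a n" for n
  proof -
    have "expectation Y - expectation (X 0) = expectation (\<lambda>\<omega>. Y \<omega> - X (real n) \<omega>)"
      using martingale_expectation[OF mart, of 0 "real n"] square_integrable_integrable[OF si] square_integrable_integrable[OF Y2(1)] by simp
    then show ?thesis using order_trans[OF square_expectation_le[OF square_integrable_diff[OF Y2(1) si[of n]]] diff[of n]] by simp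
  qed
  then have "(expectation Y - expectation (X 0))\<^sup>2 \<le> 0" by (intro LIMSEQ_le_const[OF lim0]) auto
  then show "expectation Y = expectation (X 0)" by simp
  have "A \<le> expectation (\<lambda>\<omega>. (Y \<omega>)\<^sup>2)"
  proof -
    define v where "v = expectation (\<lambda>\<omega>. (Y \<omega>)\<^sup>2)"
    \<comment> \<open>A weighted Young inequality in place of the triangle inequality for the norm:
      the error term vanishes as \<open>n\<close> grows with \<open>e\<close> fixed, and then
      \<open>e\<close> tends to 0.\<close>
    have b: "A \<le> (1 + e) * v" if e: "0 < e" for e
    proof -
      have "a n \<le> (1 + e) * v + (1 + 1 / e) * (A - a n)" for n
      proof -
        have pt: "p\<^sup>2 \<le> (1 + e) * q\<^sup>2 + (1 + 1 / e) * (q - p)\<^sup>2" for p q :: real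
        proof -
          have "0 \<le> (e * q + (q - p))\<^sup>2 / e" using e by simp
          also have "\<dots> = (1 + e) * q\<^sup>2 + (1 + 1 / e) * (q - p)\<^sup>2 - p\<^sup>2"
            using e by (simp add: field_simps power2_eq_square)
          finally show ?thesis by simp
        qed
        have i: "integrable M (\<lambda>\<omega>. (Y \<omega>)\<^sup>2)" "integrable M (\<lambda>\<omega>. (Y \<omega> - X (real n) \<omega>)\<^sup>2)" "integrable M (\<lambda>\<omega>. (X (real n) \<omega>)\<^sup>2)"
          using Y2(1) si square_integrable_diff[OF Y2(1) si] by (auto simp: square_integrable_def)
        have "a n \<le> expectation (\<lambda>\<omega>. (1 + e) * (Y \<omega>)\<^sup>2 + (1 + 1 / e) * (Y \<omega> - X (real n) \<omega>)\<^sup>2)"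
          unfolding a_def by (intro integral_mono pt Bochner_Integration.integrable_add integrable_mult_right i)
        also have "\<dots> = (1 + e) * v + (1 + 1 / e) * expectation (\<lambda>\<omega>. (Y \<omega> - X (real n) \<omega>)\<^sup>2)"
          using i by (simp add: v_def)
        also have "\<dots> \<le> (1 + e) * v + (1 + 1 / e) * (A - a n)"
          using e diff[of n] by (intro add_left_mono mult_left_mono) auto
        finally show ?thesis .
      qed
      moreover have "(\<lambda>n. (1 + e) * v + (1 + 1 / e) * (A - a n)) \<longlonglongrightarrow> (1 + e) * v + (1 + 1 / e) * 0"
        by (intro tendsto_intros lim0)
      ultimately show ?thesis using A(1) by (intro LIMSEQ_le[OF A(1)]) auto
    qed
    have "((\<lambda>e. (1 + e) * v) \<longlongrightarrow> (1 + 0) * v) (at_right 0)" by (intro tendsto_intros)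
    then have "A \<le> (1 + 0) * v"
      using b by (intro tendsto_lowerbound) (auto simp: eventually_at_filter)
    then show ?thesis by (simp add: v_def)
  qed
  with Y2(2) A(1) show "(\<lambda>n. expectation (\<lambda>\<omega>. (X (real n) \<omega>)\<^sup>2)) \<longlonglongrightarrow> expectation (\<lambda>\<omega>. (Y \<omega>)\<^sup>2)"
    by (simp add: a_def)
qed

lemma (in prob_space) expected_dyadic_range_le:
  assumes mart: "martingale M F X" and C: "moment2_bound M X C"
  shows "integrable M (dyadic_range X n)"
    and "expectation (dyadic_range X n) \<le> sqrt 3 * sqrt (expectation (\<lambda>\<omega>. (X (real n) \<omega>)\<^sup>2) - expectation (\<lambda>\<omega>. (X 0 \<omega>)\<^sup>2))"
proof -
  interpret s: sampled_martingale M F X "dyadic n" using sampled_martingale_dyadic[OF assms] .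
  show "integrable M (dyadic_range X n)"
    using square_integrable_integrable[OF s.L2_srange] by (simp add: dyadic_range_def[abs_def])
  show "expectation (dyadic_range X n) \<le> sqrt 3 * sqrt (expectation (\<lambda>\<omega>. (X (real n) \<omega>)\<^sup>2) - expectation (\<lambda>\<omega>. (X 0 \<omega>)\<^sup>2))"
    using s.expected_range_le[of "n * 2 ^ n"] by (simp add: dyadic_range_def[abs_def])
qed

theorem (in prob_space) expected_path_diameter_le:
  assumes mart: "martingale M F X" and L2: "L2_bounded M X" and rc: "right_continuous_paths M X" and Y: "last_term M X Y"
  shows "(\<integral>\<^sup>+ \<omega>. path_diameter X \<omega> \<partial>M) \<le> ennreal (sqrt 3 * sqrt (variance Y))"
proof -
  obtain C where C: "moment2_bound M X C"
    using L2 L2_bounded_iff_moment2_bound[of X M] martingaleD(3)[OF mart] by auto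
  note Y' = last_term_moments[OF mart C Y]
  have inc: "incseq (\<lambda>n. expectation (\<lambda>\<omega>. (X (real n) \<omega>)\<^sup>2))"
    by (intro incseq_SucI martingale_moment2_mono[OF mart C]) auto
  have var: "variance Y = expectation (\<lambda>\<omega>. (Y \<omega>)\<^sup>2) - (expectation Y)\<^sup>2"
    using Y'(1) square_integrable_integrable[OF Y'(1)] by (intro variance_eq) (auto simp: square_integrable_def)
  have m: "dyadic_range X n \<in> borel_measurable M" for n
    using expected_dyadic_range_le(1)[OF mart C] by auto
  have bound: "expectation (dyadic_range X n) \<le> sqrt 3 * sqrt (variance Y)" for n
  proof -
    have "expectation (\<lambda>\<omega>. (X (real n) \<omega>)\<^sup>2) \<le> expectation (\<lambda>\<omega>. (Y \<omega>)\<^sup>2)"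
      using incseq_le[OF inc Y'(3)] .
    \<comment> \<open>The initial value may be random; its own variance only makes the bound from
      the increments smaller than the one from \<open>Y\<close>.\<close>
    moreover have "(expectation Y)\<^sup>2 \<le> expectation (\<lambda>\<omega>. (X 0 \<omega>)\<^sup>2)"
      unfolding Y'(2) using C by (intro square_expectation_le) (simp add: moment2_bound_def)
    ultimately have "sqrt 3 * sqrt (expectation (\<lambda>\<omega>. (X (real n) \<omega>)\<^sup>2) - expectation (\<lambda>\<omega>. (X 0 \<omega>)\<^sup>2)) \<le> sqrt 3 * sqrt (variance Y)"
      unfolding var by (intro mult_left_mono real_sqrt_le_mono) auto
    then show ?thesis using expected_dyadic_range_le(2)[OF mart C, of n] by linarith
  qed
  have "(\<integral>\<^sup>+ \<omega>. path_diameter X \<omega> \<partial>M) \<le> (\<integral>\<^sup>+ \<omega>. liminf (\<lambda>n. ennreal (dyadic_range X n \<omega>)) \<partial>M)"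
    using rc unfolding right_continuous_paths_def
    by (intro nn_integral_mono_AE) (auto elim!: eventually_mono intro: path_diameter_le_liminf)
  also have "\<dots> \<le> liminf (\<lambda>n. \<integral>\<^sup>+ \<omega>. ennreal (dyadic_range X n \<omega>) \<partial>M)"
    using m by (intro nn_integral_liminf) measurable
  also have "\<dots> \<le> liminf (\<lambda>n::nat. ennreal (sqrt 3 * sqrt (variance Y)))"
    using expected_dyadic_range_le(1)[OF mart C] bound
    by (intro Liminf_mono always_eventually allI, subst nn_integral_eq_integral) (auto intro: ennreal_leI)
  finally show ?thesis by (simp add: Liminf_const)
qed

text \<open>Supplies the majorant for dominated convergence: Doob's inequality bounds the dyadic
  ranges uniformly in the square mean, and Fatou's lemma passes to the limit. Continuity is asked on
  all of \<open>space M\<close> because measurability must hold exactly and \<open>M\<close> may be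
  incomplete.\<close>

lemma (in prob_space) square_integrable_path_diameter:
  assumes mart: "martingale M F X" and C: "moment2_bound M X C" 
    and rc: "\<And>\<omega> t. \<omega> \<in> space M \<Longrightarrow> 0 \<le> t \<Longrightarrow> continuous (at_right t) (\<lambda>s. X s \<omega>)"
    and fin: "AE \<omega> in M. path_diameter X \<omega> < \<infinity>"
  shows "square_integrable M (\<lambda>\<omega>. enn2real (path_diameter X \<omega>))"
proof -
  have m[measurable]: "dyadic_range X n \<in> borel_measurable M" for n
    using expected_dyadic_range_le(1)[OF mart C] by auto
  have "path_diameter X \<in> borel_measurable M"
  proof -
    have "path_diameter X \<omega> = liminf (\<lambda>n. ennreal (dyadic_range X n \<omega>))" if "\<omega> \<in> space M" for \<omega>
      using rc[OF that] path_diameter_eq_liminf[of X \<omega>] by blast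
    moreover have "(\<lambda>\<omega>. liminf (\<lambda>n. ennreal (dyadic_range X n \<omega>))) \<in> borel_measurable M" by measurable
    ultimately show ?thesis by (simp cong: measurable_cong)
  qed
  then have [measurable]: "(\<lambda>\<omega>. enn2real (path_diameter X \<omega>)) \<in> borel_measurable M" by measurable
  have b: "integrable M (\<lambda>\<omega>. (dyadic_range X n \<omega>)\<^sup>2)" "expectation (\<lambda>\<omega>. (dyadic_range X n \<omega>)\<^sup>2) \<le> 16 * C" for n
  proof -
    interpret s: sampled_martingale M F X "dyadic n" using sampled_martingale_dyadic[OF mart C] .
    show "integrable M (\<lambda>\<omega>. (dyadic_range X n \<omega>)\<^sup>2)"
      using s.L2_srange by (simp add: dyadic_range_def[abs_def] square_integrable_def)
    have "expectation (\<lambda>\<omega>. (dyadic_range X n \<omega>)\<^sup>2) \<le> 16 * expectation (\<lambda>\<omega>. (X (real n) \<omega> - X 0 \<omega>)\<^sup>2)"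
      using s.doob_srange[of "n * 2 ^ n"] by (simp add: dyadic_range_def[abs_def])
    also have "expectation (\<lambda>\<omega>. (X (real n) \<omega> - X 0 \<omega>)\<^sup>2) = expectation (\<lambda>\<omega>. (X (real n) \<omega>)\<^sup>2) - expectation (\<lambda>\<omega>. (X 0 \<omega>)\<^sup>2)"
      using C by (intro martingale_increment_square[OF mart]) (auto simp: moment2_bound_def)
    also have "\<dots> \<le> C"
    proof -
      have "0 \<le> expectation (\<lambda>\<omega>. (X 0 \<omega>)\<^sup>2)" by simp
      moreover have "expectation (\<lambda>\<omega>. (X (real n) \<omega>)\<^sup>2) \<le> C" using C by (simp add: moment2_bound_def)
      ultimately show ?thesis by linarith
    qed
    finally show "expectation (\<lambda>\<omega>. (dyadic_range X n \<omega>)\<^sup>2) \<le> 16 * C" by simp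
  qed
  have "(\<integral>\<^sup>+ \<omega>. ennreal ((enn2real (path_diameter X \<omega>))\<^sup>2) \<partial>M) = (\<integral>\<^sup>+ \<omega>. liminf (\<lambda>n. ennreal ((dyadic_range X n \<omega>)\<^sup>2)) \<partial>M)"
  proof (rule nn_integral_cong_AE, use fin AE_space in eventually_elim)
    case (elim \<omega>)
    have "(\<lambda>n. ennreal ((dyadic_range X n \<omega>)\<^sup>2)) \<longlonglongrightarrow> ennreal ((enn2real (path_diameter X \<omega>))\<^sup>2)"
      using rc elim by (intro tendsto_ennrealI tendsto_power dyadic_range_tendsto) auto
    then show ?case by (rule lim_imp_Liminf[OF trivial_limit_sequentially, symmetric])
  qed
  also have "\<dots> \<le> liminf (\<lambda>n. \<integral>\<^sup>+ \<omega>. ennreal ((dyadic_range X n \<omega>)\<^sup>2) \<partial>M)"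
    by (intro nn_integral_liminf) measurable
  also have "\<dots> \<le> liminf (\<lambda>n::nat. ennreal (16 * C))"
    using b by (intro Liminf_mono always_eventually allI, subst nn_integral_eq_integral) (auto intro: ennreal_leI)
  also have "\<dots> < \<infinity>" by (simp add: Liminf_const)
  finally have "integrable M (\<lambda>\<omega>. (enn2real (path_diameter X \<omega>))\<^sup>2)"
    by (intro integrableI_nonneg) auto
  then show ?thesis by (simp add: square_integrable_def)
qed

section \<open>Martingales whose paths end balanced\<close>

definition eventually_constant :: "(real \<Rightarrow> real) \<Rightarrow> bool" where
  "eventually_constant f \<longleftrightarrow> (\<exists>T\<ge>0. \<forall>s\<ge>T. f s = f T)"

text \<open>Arbitrary earlier values \<open>f i\<close> and \<open>f j\<close> take the place of the
  running maximum and minimum, so that the property applies to the extrema over any grid, which are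
  values at grid times.\<close>

definition centred_path :: "real \<Rightarrow> (real \<Rightarrow> real) \<Rightarrow> bool" where
  "centred_path d f \<longleftrightarrow> (\<forall>s u i j. i \<in> {0..s} \<longrightarrow> j \<in> {0..s} \<longrightarrow> s \<le> u \<longrightarrow>
     f j \<le> f s \<longrightarrow> f s \<le> f i \<longrightarrow> same_wing d (f i) (f j) (f s) (f u))"

definition balanced_end :: "real \<Rightarrow> (real \<Rightarrow> real) \<Rightarrow> bool" where
  "balanced_end d f \<longleftrightarrow> (\<exists>T\<ge>0. (\<forall>s\<ge>T. f s = f T) \<and> (\<exists>i\<ge>0. d \<le> f i - f T) \<and> (\<exists>j\<ge>0. d \<le> f T - f j))"

lemma eventually_constant_min:
  fixes f :: "real \<Rightarrow> real"
  assumes "\<forall>s\<ge>T. f s = f T"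
  shows "f s = f (min s T)"
  using assms by (metis min.absorb1 min.absorb2 linear)

text \<open>The time horizon of the dyadic grids grows with their order, so small steps are needed
  on the whole half-line and not just on a fixed interval.\<close>

lemma eventually_constant_uniformly_continuous:
  assumes "continuous_on {0..} f" "eventually_constant f"
  shows "uniformly_continuous_on {0..} f"
proof -
  obtain T where T: "0 \<le> T" "\<forall>s\<ge>T. f s = f T" using assms(2) by (auto simp: eventually_constant_def)
  have uc: "uniformly_continuous_on {0..T} f"
    using assms(1) by (intro compact_uniformly_continuous) (auto intro: continuous_on_subset)
  show ?thesis
    unfolding uniformly_continuous_on_def
  proof (intro allI impI)
    fix e :: real assume "0 < e"
    then obtain \<delta> where \<delta>: "0 < \<delta>" "\<And>s s'. s \<in> {0..T} \<Longrightarrow> s' \<in> {0..T} \<Longrightarrow> dist s' s < \<delta> \<Longrightarrow> dist (f s') (f s) < e"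
      using uc unfolding uniformly_continuous_on_def by metis
    show "\<exists>\<delta>>0. \<forall>s\<in>{0..}. \<forall>s'\<in>{0..}. dist s' s < \<delta> \<longrightarrow> dist (f s') (f s) < e"
    proof (intro exI[of _ \<delta>] conjI \<delta>(1) ballI impI)
      fix s s' :: real assume *: "s \<in> {0..}" "s' \<in> {0..}" "dist s' s < \<delta>"
      \<comment> \<open>Truncation at \<open>T\<close> does not increase distances and brings both
        times into the compact interval.\<close>
      then have "dist (min s' T) (min s T) < \<delta>" by (auto simp: dist_real_def min_def)
      then have "dist (f (min s' T)) (f (min s T)) < e" using * T(1) by (intro \<delta>(2)) auto
      then show "dist (f s') (f s) < e" using eventually_constant_min[OF T(2)] by metis
    qed
  qed
qed

lemma path_diameter_eventually_constant:
  assumes "continuous_on {0..} (\<lambda>t. X t \<omega>)" "eventually_constant (\<lambda>t. X t \<omega>)"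
  shows "path_diameter X \<omega> < \<infinity>"
proof -
  obtain T where T: "0 \<le> T" "\<forall>s\<ge>T. X s \<omega> = X T \<omega>" using assms(2) by (auto simp: eventually_constant_def)
  have "compact ((\<lambda>t. X t \<omega>) ` {0..T})"
    using assms(1) by (intro compact_continuous_image) (auto intro: continuous_on_subset)
  then obtain K where K: "\<forall>t\<in>{0..T}. \<bar>X t \<omega>\<bar> \<le> K"
    using compact_imp_bounded bounded_iff by (metis (mono_tags, lifting) image_eqI real_norm_def)
  have "\<bar>X t \<omega>\<bar> \<le> K" if "0 \<le> t" for t
    using K T that eventually_constant_min[OF T(2), of t] by (metis atLeastAtMost_iff min.bounded_iff min.cobounded2)
  then have "path_diameter X \<omega> \<le> ennreal (2 * K)"
    by (intro path_diameter_le ennreal_leI) (smt (verit))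
  then show ?thesis by (auto intro: le_less_trans)
qed

lemma continuous_on_imp_right_continuous:
  fixes f :: "real \<Rightarrow> real"
  assumes "continuous_on {0..} f" "0 \<le> t"
  shows "continuous (at_right t) f"
proof -
  have "continuous (at t within {0..}) f" using assms by (simp add: continuous_on_eq_continuous_within)
  then show ?thesis by (rule continuous_within_subset) (use assms in auto)
qed

lemma dyadic_range_le_diameter:
  assumes "path_diameter X \<omega> < \<infinity>"
  shows "dyadic_range X n \<omega> \<le> enn2real (path_diameter X \<omega>)"
  using enn2real_mono[OF dyadic_range_le[of X n \<omega>]] assms by simp

lemma abs_step_le_srange: "k < n \<Longrightarrow> \<bar>x (Suc k) - x k\<bar> \<le> srange x n"
  using smax_ge[of k n x] smax_ge[of "Suc k" n x] smin_le[of k n x] smin_le[of "Suc k" n x]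
  by (auto simp: srange_def)

section \<open>Overshoot and excess along dyadic grids\<close>

definition dyadic_overshoot :: "(real \<Rightarrow> 'a \<Rightarrow> real) \<Rightarrow> nat \<Rightarrow> 'a \<Rightarrow> real" where
  "dyadic_overshoot X n \<omega> = overshoot (\<lambda>k. X (dyadic n k) \<omega>) (n * 2 ^ n)"

definition dyadic_excess :: "real \<Rightarrow> (real \<Rightarrow> 'a \<Rightarrow> real) \<Rightarrow> nat \<Rightarrow> 'a \<Rightarrow> real" where
  "dyadic_excess d X n \<omega> = excess d (X (real n) \<omega>) (smax (\<lambda>k. X (dyadic n k) \<omega>) (n * 2 ^ n))
      (smin (\<lambda>k. X (dyadic n k) \<omega>) (n * 2 ^ n))"

text \<open>The range itself is a bound for every step; this crude estimate provides an integrable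
  majorant.\<close>

lemma dyadic_overshoot_le: "dyadic_overshoot X n \<omega> \<le> (dyadic_range X n \<omega>)\<^sup>2"
  unfolding dyadic_overshoot_def dyadic_range_def power2_eq_square
  by (intro overshoot_le abs_step_le_srange)

lemma dyadic_overshoot_tendsto:
  assumes "continuous_on {0..} (\<lambda>t. X t \<omega>)" "eventually_constant (\<lambda>t. X t \<omega>)"
  shows "(\<lambda>n. dyadic_overshoot X n \<omega>) \<longlonglongrightarrow> 0"
proof (rule LIMSEQ_I)
  fix e :: real assume e: "0 < e"
  define R where "R = enn2real (path_diameter X \<omega>)"
  have R: "0 \<le> R" "dyadic_range X n \<omega> \<le> R" for n
    using dyadic_range_le_diameter[OF path_diameter_eventually_constant[where X = X and \<omega> = \<omega>, OF assms]] by (auto simp: R_def)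
  \<comment> \<open>Adding 1 covers \<open>R = 0\<close> and keeps \<open>\<epsilon> * R\<close>
    strictly below \<open>e\<close>.\<close>
  define \<epsilon> where "\<epsilon> = e / (R + 1)"
  have \<epsilon>: "0 < \<epsilon>" "\<epsilon> * R < e" using e R by (auto simp: \<epsilon>_def field_simps)
  obtain \<delta> where \<delta>: "0 < \<delta>" "\<And>s s'. s \<in> {0..} \<Longrightarrow> s' \<in> {0..} \<Longrightarrow> dist s' s < \<delta> \<Longrightarrow> dist (X s' \<omega>) (X s \<omega>) < \<epsilon>"
    using eventually_constant_uniformly_continuous[OF assms] \<epsilon>(1) unfolding uniformly_continuous_on_def by metis
  have "(\<lambda>n. 1 / 2 ^ n :: real) \<longlonglongrightarrow> 0" by (rule LIMSEQ_divide_realpow_zero) simp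
  then have "\<forall>\<^sub>F n in sequentially. 1 / 2 ^ n < \<delta>" using \<delta>(1) by (rule order_tendstoD)
  then obtain N where N: "\<And>n. N \<le> n \<Longrightarrow> 1 / 2 ^ n < \<delta>" by (auto simp: eventually_sequentially)
  show "\<exists>N. \<forall>n\<ge>N. norm (dyadic_overshoot X n \<omega> - 0) < e"
  proof (intro exI allI impI)
    fix n assume n: "N \<le> n"
    have "dyadic_overshoot X n \<omega> \<le> \<epsilon> * dyadic_range X n \<omega>"
      unfolding dyadic_overshoot_def dyadic_range_def
    proof (rule overshoot_le)
      fix k
      have "dist (X (dyadic n (Suc k)) \<omega>) (X (dyadic n k) \<omega>) < \<epsilon>"
        using N[OF n] dyadic_Suc[of n k] by (intro \<delta>(2)) (auto simp: dist_real_def)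
      then show "\<bar>X (dyadic n (Suc k)) \<omega> - X (dyadic n k) \<omega>\<bar> \<le> \<epsilon>" by (simp add: dist_real_def)
    qed
    also have "\<dots> \<le> \<epsilon> * R" using R \<epsilon> by (intro mult_left_mono) auto
    finally show "norm (dyadic_overshoot X n \<omega> - 0) < e"
      using \<epsilon>(2) overshoot_nonneg by (simp add: dyadic_overshoot_def)
  qed
qed

lemma dyadic_excess_bounds:
  assumes "0 < d"
  shows "0 \<le> dyadic_excess d X n \<omega>" "dyadic_excess d X n \<omega> \<le> 3 * d\<^sup>2"
proof -
  have "smin (\<lambda>k. X (dyadic n k) \<omega>) (n * 2 ^ n) \<le> X (real n) \<omega>" "X (real n) \<omega> \<le> smax (\<lambda>k. X (dyadic n k) \<omega>) (n * 2 ^ n)"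
    using smax_ge[of "n * 2 ^ n" "n * 2 ^ n" "\<lambda>k. X (dyadic n k) \<omega>"] smin_le[of "n * 2 ^ n" "n * 2 ^ n" "\<lambda>k. X (dyadic n k) \<omega>"]
    by simp_all
  then show "0 \<le> dyadic_excess d X n \<omega>" "dyadic_excess d X n \<omega> \<le> 3 * d\<^sup>2"
    unfolding dyadic_excess_def using assms by (intro excess_nonneg excess_le; simp)+
qed

lemma dyadic_excess_tendsto:
  assumes "0 < d" and cont: "continuous_on {0..} (\<lambda>t. X t \<omega>)" and bal: "balanced_end d (\<lambda>t. X t \<omega>)"
  shows "(\<lambda>n. dyadic_excess d X n \<omega>) \<longlonglongrightarrow> 0"
proof -
  obtain T i j where T: "0 \<le> T" "\<forall>s\<ge>T. X s \<omega> = X T \<omega>" and i: "0 \<le> i" "d \<le> X i \<omega> - X T \<omega>" and j: "0 \<le> j" "d \<le> X T \<omega> - X j \<omega>"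
    using bal unfolding balanced_end_def by blast
  obtain k where k: "\<forall>\<^sub>F n in sequentially. k n \<le> n * 2 ^ n" "(\<lambda>n. X (dyadic n (k n)) \<omega>) \<longlonglongrightarrow> X i \<omega>"
    by (rule dyadic_approx_right[OF i(1) continuous_on_imp_right_continuous[OF cont i(1)]])
  obtain l where l: "\<forall>\<^sub>F n in sequentially. l n \<le> n * 2 ^ n" "(\<lambda>n. X (dyadic n (l n)) \<omega>) \<longlonglongrightarrow> X j \<omega>"
    by (rule dyadic_approx_right[OF j(1) continuous_on_imp_right_continuous[OF cont j(1)]])
  \<comment> \<open>The deficit computed at grid times near \<open>i\<close> and \<open>j\<close>
    instead of at the grid extrema. It dominates the true deficit and tends to 0 by
    continuity.\<close>
  define e where "e = (\<lambda>n. max 0 (d - (X (dyadic n (k n)) \<omega> - X T \<omega>)) + max 0 (d - (X T \<omega> - X (dyadic n (l n)) \<omega>)))"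
  have "e \<longlonglongrightarrow> max 0 (d - (X i \<omega> - X T \<omega>)) + max 0 (d - (X T \<omega> - X j \<omega>))"
    unfolding e_def by (intro tendsto_intros k l)
  then have e0: "e \<longlonglongrightarrow> 0" using i j by simp
  have "\<forall>\<^sub>F n in sequentially. dyadic_excess d X n \<omega> \<le> d * e n + (e n)\<^sup>2"
    using k(1) l(1) eventually_ge_at_top[of "nat \<lceil>T\<rceil>"]
  proof eventually_elim
    case (elim n)
    define a b where "a = smax (\<lambda>k. X (dyadic n k) \<omega>) (n * 2 ^ n)" and "b = smin (\<lambda>k. X (dyadic n k) \<omega>) (n * 2 ^ n)"
    define \<eta> where "\<eta> = max 0 (d - (a - X T \<omega>)) + max 0 (d - (X T \<omega> - b))"
    have "T \<le> real n" using elim by linarith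
    then have "X (real n) \<omega> = X T \<omega>" using T(2) by blast
    then have "dyadic_excess d X n \<omega> = excess d (X T \<omega>) a b" by (simp add: dyadic_excess_def a_def b_def)
    also have "\<dots> \<le> d * \<eta> + \<eta>\<^sup>2" unfolding \<eta>_def by (rule excess_le_deficit[OF assms(1)])
    also have "\<dots> \<le> d * e n + (e n)\<^sup>2"
    proof -
      have "X (dyadic n (k n)) \<omega> \<le> a" "b \<le> X (dyadic n (l n)) \<omega>"
        using smax_ge[OF elim(1)] smin_le[OF elim(2)] by (auto simp: a_def b_def)
      then have "\<eta> \<le> e n" unfolding \<eta>_def e_def by (intro add_mono max.mono) auto
      moreover have "0 \<le> \<eta>" by (simp add: \<eta>_def)
      ultimately show ?thesis using assms(1) by (intro add_mono mult_left_mono power_mono) auto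
    qed
    finally show ?case .
  qed
  moreover have "(\<lambda>n. d * e n + (e n)\<^sup>2) \<longlonglongrightarrow> d * 0 + 0\<^sup>2" by (intro tendsto_intros e0)
  ultimately show ?thesis
    using dyadic_excess_bounds(1)[OF assms(1), of X] by (intro tendsto_sandwich[of "\<lambda>_. 0" "\<lambda>n. dyadic_excess d X n \<omega>" sequentially "\<lambda>n. d * e n + (e n)\<^sup>2"]) auto
qed

text \<open>\<open>C\<close> only has to be finite: it gives an integrable majorant and convergence
  of the second moments, but the estimates derived here do not depend on its size. A balanced end is
  not part of the locale, so that a process frozen at a fixed time fits in.\<close>

locale centred_martingale = prob_space M for M :: "'a measure" +
  fixes F X and C d :: real
  assumes mart: "martingale M F X" and C: "moment2_bound M X C" and d: "0 < d"
    and cont: "\<And>\<omega>. \<omega> \<in> space M \<Longrightarrow> continuous_on {0..} (\<lambda>t. X t \<omega>)"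
    and ec: "AE \<omega> in M. eventually_constant (\<lambda>t. X t \<omega>)"
    and centred: "\<And>\<omega>. \<omega> \<in> space M \<Longrightarrow> centred_path d (\<lambda>t. X t \<omega>)"
begin

lemma AE_finite_diameter: "AE \<omega> in M. path_diameter X \<omega> < \<infinity>"
  using ec AE_space by eventually_elim (rule path_diameter_eventually_constant[OF cont])

lemma diameter_L2: "square_integrable M (\<lambda>\<omega>. enn2real (path_diameter X \<omega>))"
  by (rule square_integrable_path_diameter[OF mart C continuous_on_imp_right_continuous[OF cont] AE_finite_diameter])

lemma range_ge:
  "expectation (\<lambda>\<omega>. (X (real n) \<omega>)\<^sup>2) - expectation (\<lambda>\<omega>. (X 0 \<omega>)\<^sup>2) + 3 * d\<^sup>2
    \<le> 2 * d * expectation (dyadic_range X n) + expectation (dyadic_excess d X n) + expectation (dyadic_overshoot X n)"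
  "integrable M (dyadic_excess d X n)" "integrable M (dyadic_overshoot X n)"
proof -
  interpret s: sampled_martingale M F X "dyadic n" using sampled_martingale_dyadic[OF mart C] .
  have wing: "AE \<omega> in M. \<forall>k<n * 2 ^ n. same_wing d (smax (s.x \<omega>) k) (smin (s.x \<omega>) k) (s.x \<omega> k) (s.x \<omega> (Suc k))"
  proof (rule AE_I2, intro allI impI)
    fix \<omega> k assume \<omega>: "\<omega> \<in> space M"
    obtain i j where ij: "i \<le> k" "smax (s.x \<omega>) k = s.x \<omega> i" "j \<le> k" "smin (s.x \<omega>) k = s.x \<omega> j"
      using smax_attained smin_attained by metis
    have "s.x \<omega> k \<le> s.x \<omega> i" "s.x \<omega> j \<le> s.x \<omega> k"
      using smax_ge[of k k "s.x \<omega>"] smin_le[of k k "s.x \<omega>"] ij by auto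
    then show "same_wing d (smax (s.x \<omega>) k) (smin (s.x \<omega>) k) (s.x \<omega> k) (s.x \<omega> (Suc k))"
      unfolding ij using centred[OF \<omega>] ij monoD[OF mono_dyadic, of _ _ n]
      unfolding centred_path_def by auto
  qed
  note * = s.expected_range_ge_potential[OF d wing]
  show "expectation (\<lambda>\<omega>. (X (real n) \<omega>)\<^sup>2) - expectation (\<lambda>\<omega>. (X 0 \<omega>)\<^sup>2) + 3 * d\<^sup>2
    \<le> 2 * d * expectation (dyadic_range X n) + expectation (dyadic_excess d X n) + expectation (dyadic_overshoot X n)"
  "integrable M (dyadic_excess d X n)" "integrable M (dyadic_overshoot X n)"
    using * by (simp_all add: dyadic_range_def[abs_def] dyadic_excess_def[abs_def] dyadic_overshoot_def[abs_def])
qed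

lemma overshoot_tendsto: "(\<lambda>n. expectation (dyadic_overshoot X n)) \<longlonglongrightarrow> 0"
proof -
  have "(\<lambda>n. expectation (dyadic_overshoot X n)) \<longlonglongrightarrow> expectation (\<lambda>_. 0)"
  proof (rule integral_dominated_convergence[where w = "\<lambda>\<omega>. (enn2real (path_diameter X \<omega>))\<^sup>2"])
    show "integrable M (\<lambda>\<omega>. (enn2real (path_diameter X \<omega>))\<^sup>2)" using diameter_L2 by (simp add: square_integrable_def)
    show "AE \<omega> in M. (\<lambda>n. dyadic_overshoot X n \<omega>) \<longlonglongrightarrow> 0"
      using ec AE_space by eventually_elim (rule dyadic_overshoot_tendsto[OF cont])
    show "AE \<omega> in M. norm (dyadic_overshoot X n \<omega>) \<le> (enn2real (path_diameter X \<omega>))\<^sup>2" for n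
      using AE_finite_diameter
    proof eventually_elim
      case (elim \<omega>)
      have "(dyadic_range X n \<omega>)\<^sup>2 \<le> (enn2real (path_diameter X \<omega>))\<^sup>2"
        by (intro power_mono dyadic_range_le_diameter elim) auto
      then have "dyadic_overshoot X n \<omega> \<le> (enn2real (path_diameter X \<omega>))\<^sup>2"
        using dyadic_overshoot_le[of X n \<omega>] by linarith
      then show ?case using overshoot_nonneg by (simp add: dyadic_overshoot_def)
    qed
  qed (use range_ge(3) in auto)
  then show ?thesis by simp
qed

text \<open>The lower estimate for the range contains \<open>3 * d\<^sup>2\<close> on one side and
  an excess of at most \<open>3 * d\<^sup>2\<close> on the other. They cancel, and inserting the
  upper estimate for the range leaves \<open>V \<le> 2 * d * sqrt 3 * sqrt V\<close> in the
  limit.\<close>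

lemma moment2_le:
  assumes "0 \<le> s"
  shows "expectation (\<lambda>\<omega>. (X s \<omega>)\<^sup>2) - expectation (\<lambda>\<omega>. (X 0 \<omega>)\<^sup>2) \<le> 12 * d\<^sup>2"
proof -
  define v where "v = (\<lambda>n. expectation (\<lambda>\<omega>. (X (real n) \<omega>)\<^sup>2) - expectation (\<lambda>\<omega>. (X 0 \<omega>)\<^sup>2))"
  have inc: "incseq v"
  proof (rule incseq_SucI)
    show "v n \<le> v (Suc n)" for n
      unfolding v_def by (rule diff_right_mono, rule martingale_moment2_mono[OF mart C]) auto
  qed
  have "v n \<le> C - expectation (\<lambda>\<omega>. (X 0 \<omega>)\<^sup>2)" for n
    using C by (auto simp: v_def moment2_bound_def)
  then obtain V where V: "v \<longlonglongrightarrow> V" "\<And>n. v n \<le> V" using incseq_convergent[OF inc] by blast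
  have v0: "0 \<le> v n" for n
    unfolding v_def using martingale_moment2_mono[OF mart C, of 0 "real n"] by simp
  have V0: "0 \<le> V" using v0[of 0] V(2)[of 0] by linarith
  have step: "v n \<le> 2 * d * (sqrt 3 * sqrt (v n)) + expectation (dyadic_overshoot X n)" for n
  proof -
    have "expectation (dyadic_excess d X n) \<le> 3 * d\<^sup>2"
      using integral_mono[OF range_ge(2)[of n], of "\<lambda>_. 3 * d\<^sup>2"] dyadic_excess_bounds(2)[OF d, of X n]
      by (simp add: prob_space)
    moreover have "2 * d * expectation (dyadic_range X n) \<le> 2 * d * (sqrt 3 * sqrt (v n))"
      using expected_dyadic_range_le(2)[OF mart C, of n] d by (intro mult_left_mono) (auto simp: v_def)
    ultimately show ?thesis using range_ge(1)[of n] by (simp add: v_def)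
  qed
  have "(\<lambda>n. 2 * d * (sqrt 3 * sqrt (v n)) + expectation (dyadic_overshoot X n)) \<longlonglongrightarrow> 2 * d * (sqrt 3 * sqrt V) + 0"
    by (intro tendsto_intros V overshoot_tendsto)
  then have "V \<le> 2 * d * (sqrt 3 * sqrt V)" using LIMSEQ_le[OF V(1)] step by auto
  then have "sqrt V * sqrt V \<le> (2 * d * sqrt 3) * sqrt V" using V0 by (simp add: mult.assoc)
  then have "sqrt V \<le> 2 * d * sqrt 3"
    using V0 d by (cases "V = 0") (auto intro: mult_right_le_imp_le[of _ "sqrt V"])
  then have "(sqrt V)\<^sup>2 \<le> (2 * d * sqrt 3)\<^sup>2" using V0 by (intro power_mono) auto
  then have "V \<le> 12 * d\<^sup>2" using V0 by (simp add: power_mult_distrib)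
  moreover have "expectation (\<lambda>\<omega>. (X s \<omega>)\<^sup>2) \<le> expectation (\<lambda>\<omega>. (X (real (nat \<lceil>s\<rceil>)) \<omega>)\<^sup>2)"
    using assms by (intro martingale_moment2_mono[OF mart C]) auto
  ultimately show ?thesis using V(2)[of "nat \<lceil>s\<rceil>"] by (simp add: v_def)
qed

lemma excess_tendsto:
  assumes "AE \<omega> in M. balanced_end d (\<lambda>t. X t \<omega>)"
  shows "(\<lambda>n. expectation (dyadic_excess d X n)) \<longlonglongrightarrow> 0"
proof -
  have "(\<lambda>n. expectation (dyadic_excess d X n)) \<longlonglongrightarrow> expectation (\<lambda>_. 0)"
  proof (rule integral_dominated_convergence[where w = "\<lambda>_. 3 * d\<^sup>2"])
    show "AE \<omega> in M. (\<lambda>n. dyadic_excess d X n \<omega>) \<longlonglongrightarrow> 0"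
      using assms AE_space by eventually_elim (rule dyadic_excess_tendsto[OF d cont])
    show "AE \<omega> in M. norm (dyadic_excess d X n \<omega>) \<le> 3 * d\<^sup>2" for n
      using dyadic_excess_bounds[OF d, of X n] by (intro AE_I2) auto
  qed (use range_ge(2) in auto)
  then show ?thesis by simp
qed

lemma expected_diameter_ge:
  assumes bal: "AE \<omega> in M. balanced_end d (\<lambda>t. X t \<omega>)" and Y: "last_term M X Y" and zero: "\<And>\<omega>. \<omega> \<in> space M \<Longrightarrow> X 0 \<omega> = 0"
  shows "variance Y + 3 * d\<^sup>2 \<le> 2 * d * expectation (\<lambda>\<omega>. enn2real (path_diameter X \<omega>))"
proof -
  have z: "expectation (\<lambda>\<omega>. (X 0 \<omega>)\<^sup>2) = 0" "expectation (X 0) = 0"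
    using zero by (simp_all cong: Bochner_Integration.integral_cong)
  note Y' = last_term_moments[OF mart C Y]
  have var: "variance Y = expectation (\<lambda>\<omega>. (Y \<omega>)\<^sup>2)"
    using Y'(1) square_integrable_integrable[OF Y'(1)] by (subst variance_eq) (auto simp: square_integrable_def Y'(2) z)
  define E where "E = expectation (\<lambda>\<omega>. enn2real (path_diameter X \<omega>))"
  have "expectation (\<lambda>\<omega>. (X (real n) \<omega>)\<^sup>2) + 3 * d\<^sup>2 \<le> 2 * d * E + (expectation (dyadic_excess d X n) + expectation (dyadic_overshoot X n))" for n
  proof -
    have "expectation (dyadic_range X n) \<le> E" unfolding E_def
    proof (rule integral_mono_AE)
      show "integrable M (dyadic_range X n)" using expected_dyadic_range_le(1)[OF mart C] .
      show "integrable M (\<lambda>\<omega>. enn2real (path_diameter X \<omega>))" using square_integrable_integrable[OF diameter_L2] .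
      show "AE \<omega> in M. dyadic_range X n \<omega> \<le> enn2real (path_diameter X \<omega>)"
        using AE_finite_diameter by eventually_elim (rule dyadic_range_le_diameter)
    qed
    then have "2 * d * expectation (dyadic_range X n) \<le> 2 * d * E" using d by simp
    then show ?thesis using range_ge(1)[of n] z by simp
  qed
  moreover have "(\<lambda>n. expectation (\<lambda>\<omega>. (X (real n) \<omega>)\<^sup>2) + 3 * d\<^sup>2) \<longlonglongrightarrow> expectation (\<lambda>\<omega>. (Y \<omega>)\<^sup>2) + 3 * d\<^sup>2"
    by (intro tendsto_intros Y')
  moreover have "(\<lambda>n. 2 * d * E + (expectation (dyadic_excess d X n) + expectation (dyadic_overshoot X n))) \<longlonglongrightarrow> 2 * d * E + (0 + 0)"
    by (intro tendsto_intros excess_tendsto[OF bal] overshoot_tendsto)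
  ultimately show ?thesis unfolding var E_def using LIMSEQ_le by fastforce
qed

theorem expected_diameter_eq:
  assumes bal: "AE \<omega> in M. balanced_end d (\<lambda>t. X t \<omega>)" and Y: "last_term M X Y" and zero: "\<And>\<omega>. \<omega> \<in> space M \<Longrightarrow> X 0 \<omega> = 0"
  shows "expectation (\<lambda>\<omega>. enn2real (path_diameter X \<omega>)) = sqrt 3 * sqrt (variance Y)"
proof (rule antisym)
  have "right_continuous_paths M X"
    unfolding right_continuous_paths_def by (intro AE_I2 allI impI continuous_on_imp_right_continuous cont)
  moreover have "L2_bounded M X"
    by (rule L2_bounded_iff_moment2_bound[THEN iffD2, OF martingaleD(3)[OF mart] exI, OF _ C])
  ultimately have "(\<integral>\<^sup>+ \<omega>. path_diameter X \<omega> \<partial>M) \<le> ennreal (sqrt 3 * sqrt (variance Y))"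
    by (intro expected_path_diameter_le[OF mart _ _ Y])
  moreover have "(\<integral>\<^sup>+ \<omega>. path_diameter X \<omega> \<partial>M) = (\<integral>\<^sup>+ \<omega>. ennreal (enn2real (path_diameter X \<omega>)) \<partial>M)"
    using AE_finite_diameter by (intro nn_integral_cong_AE) auto
  moreover have "\<dots> = ennreal (expectation (\<lambda>\<omega>. enn2real (path_diameter X \<omega>)))"
    using square_integrable_integrable[OF diameter_L2] by (intro nn_integral_eq_integral) auto
  ultimately show "expectation (\<lambda>\<omega>. enn2real (path_diameter X \<omega>)) \<le> sqrt 3 * sqrt (variance Y)"
    by (simp add: ennreal_le_iff)
  define s where "s = sqrt (variance Y)"
  have V: "variance Y = s\<^sup>2" by (simp add: s_def)
  have "2 * d * (sqrt 3 * s) \<le> s\<^sup>2 + 3 * d\<^sup>2"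
    using zero_le_power2[of "s - sqrt 3 * d"] by (simp add: power2_diff power_mult_distrib algebra_simps)
  also have "\<dots> \<le> 2 * d * expectation (\<lambda>\<omega>. enn2real (path_diameter X \<omega>))"
    using expected_diameter_ge[OF assms] V by simp
  finally show "sqrt 3 * sqrt (variance Y) \<le> expectation (\<lambda>\<omega>. enn2real (path_diameter X \<omega>))"
    using d by (simp add: s_def)
qed

end

section \<open>Brownian motion\<close>

text \<open>Orthogonality of increments to indicators of past events is what can be checked
  directly: for Brownian motion on a generating family, for the stopped process by a limit.\<close>

lemma (in prob_space) martingaleI:
  assumes F: "filtration (space M) F" and sub: "\<And>t. 0 \<le> t \<Longrightarrow> subalgebra M (F t)"
    and ad: "\<And>t. 0 \<le> t \<Longrightarrow> X t \<in> borel_measurable (F t)" and int: "\<And>t. 0 \<le> t \<Longrightarrow> integrable M (X t)"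
    and orth: "\<And>s t A. 0 \<le> s \<Longrightarrow> s \<le> t \<Longrightarrow> A \<in> sets (F s) \<Longrightarrow> expectation (\<lambda>\<omega>. indicator A \<omega> * (X t \<omega> - X s \<omega>)) = 0"
  shows "martingale M F X"
  unfolding martingale_def
proof (intro conjI allI impI F sub ad int)
  fix s t :: real assume st: "0 \<le> s" "s \<le> t"
  interpret F: sigma_finite_subalgebra M "F s"
    by (rule finite_measure_subalgebra_is_sigma_finite[OF finite_measure_subalgebra.intro])
       (auto simp: finite_measure_axioms finite_measure_subalgebra_axioms_def sub st)
  show "AE \<omega> in M. real_cond_exp M (F s) (X t) \<omega> = X s \<omega>"
  proof (rule F.real_cond_exp_charact)
    fix A assume A: "A \<in> sets (F s)"
    then have AM: "A \<in> sets M" using sub[OF st(1)] by (auto simp: subalgebra_def)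
    have i: "integrable M (\<lambda>\<omega>. indicator A \<omega> * X u \<omega>)" if "0 \<le> u" for u
      using integrable_mult_indicator[OF AM int[OF that]] by simp
    have "expectation (\<lambda>\<omega>. indicator A \<omega> * X t \<omega>) - expectation (\<lambda>\<omega>. indicator A \<omega> * X s \<omega>) = expectation (\<lambda>\<omega>. indicator A \<omega> * (X t \<omega> - X s \<omega>))"
      using i[of t] i[of s] st by (simp add: right_diff_distrib)
    then show "(LINT \<omega>:A|M. X t \<omega>) = (LINT \<omega>:A|M. X s \<omega>)"
      using orth[OF st A] by (simp add: set_lebesgue_integral_def)
  qed (use st ad int in auto)
qed

lemma space_natural_filtration [simp]: "space (natural_filtration M X t) = space M"
  by (simp add: natural_filtration_def space_measure_of_conv)

lemma sets_natural_filtration: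
  "sets (natural_filtration M X t) = sigma_sets (space M) (\<Union>s\<in>{0..t}. {X s -` A \<inter> space M | A. A \<in> sets borel})"
  unfolding natural_filtration_def by (rule sets_measure_of) auto

lemma filtration_natural: "filtration (space M) (natural_filtration M X)"
proof
  fix s t :: real assume "s \<le> t"
  then have "(\<Union>u\<in>{0..s}. {X u -` A \<inter> space M | A. A \<in> sets borel}) \<subseteq> (\<Union>u\<in>{0..t}. {X u -` A \<inter> space M | A. A \<in> sets borel})"
    by (intro UN_mono) auto
  then show "sets (natural_filtration M X s) \<subseteq> sets (natural_filtration M X t)"
    unfolding sets_natural_filtration by (rule sigma_sets_mono')
qed simp

lemma subalgebra_natural:
  assumes "\<And>s. 0 \<le> s \<Longrightarrow> X s \<in> borel_measurable M"
  shows "subalgebra M (natural_filtration M X t)"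
proof -
  have "(\<Union>s\<in>{0..t}. {X s -` A \<inter> space M | A. A \<in> sets borel}) \<subseteq> sets M"
  proof safe
    fix s and A :: "real set" assume "s \<in> {0..t}" "A \<in> sets borel"
    then show "X s -` A \<inter> space M \<in> sets M" by (intro measurable_sets[OF assms]) auto
  qed
  then show ?thesis unfolding subalgebra_def sets_natural_filtration by (auto dest!: sets.sigma_sets_subset)
qed

lemma adapted_natural:
  assumes "0 \<le> s" "s \<le> t"
  shows "X s \<in> borel_measurable (natural_filtration M X t)"
proof (rule measurableI)
  fix A :: "real set" assume A: "A \<in> sets borel"
  have "X s -` A \<inter> space M \<in> (\<Union>s\<in>{0..t}. {X s -` A \<inter> space M | A. A \<in> sets borel})"
    using assms A by (intro UN_I[of s]) auto
  then show "X s -` A \<inter> space (natural_filtration M X t) \<in> sets (natural_filtration M X t)"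
    by (simp only: sets_natural_filtration space_natural_filtration sigma_sets.Basic)
qed simp

section \<open>The martingale property of Brownian motion\<close>

locale brownian_motion = prob_space N for N :: "'a measure" +
  fixes B :: "real \<Rightarrow> 'a \<Rightarrow> real"
  assumes BM: "standard_Brownian_motion N B"
begin

abbreviation \<F> where "\<F> \<equiv> natural_filtration N B"

lemma B_measurable: "0 \<le> t \<Longrightarrow> B t \<in> borel_measurable N"
  and B_0: "\<omega> \<in> space N \<Longrightarrow> B 0 \<omega> = 0"
  and B_cont: "\<omega> \<in> space N \<Longrightarrow> continuous_on {0..} (\<lambda>t. B t \<omega>)"
  and B_distributed: "0 \<le> s \<Longrightarrow> s < t \<Longrightarrow> distributed N lborel (\<lambda>\<omega>. B t \<omega> - B s \<omega>) (\<lambda>x. ennreal (normal_density 0 (sqrt (t - s)) x))"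
  and B_indep: "0 \<le> \<tau> 0 \<Longrightarrow> (\<And>i. i < n \<Longrightarrow> \<tau> i \<le> \<tau> (Suc i)) \<Longrightarrow> indep_vars (\<lambda>_. borel) (\<lambda>i \<omega>. B (\<tau> (Suc i)) \<omega> - B (\<tau> i) \<omega>) {..<n}"
proof -
  note * = BM[unfolded standard_Brownian_motion_def]
  from * show "0 \<le> t \<Longrightarrow> B t \<in> borel_measurable N" by (elim conjE) simp
  from * show "\<omega> \<in> space N \<Longrightarrow> B 0 \<omega> = 0" by (elim conjE) simp
  from * show "\<omega> \<in> space N \<Longrightarrow> continuous_on {0..} (\<lambda>t. B t \<omega>)" by (elim conjE) simp
  from * show "0 \<le> s \<Longrightarrow> s < t \<Longrightarrow> distributed N lborel (\<lambda>\<omega>. B t \<omega> - B s \<omega>) (\<lambda>x. ennreal (normal_density 0 (sqrt (t - s)) x))" by (elim conjE) simp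
  from * show "0 \<le> \<tau> 0 \<Longrightarrow> (\<And>i. i < n \<Longrightarrow> \<tau> i \<le> \<tau> (Suc i)) \<Longrightarrow> indep_vars (\<lambda>_. borel) (\<lambda>i \<omega>. B (\<tau> (Suc i)) \<omega> - B (\<tau> i) \<omega>) {..<n}" by (elim conjE) simp
qed

lemma increment_L2:
  assumes "0 \<le> s" "s \<le> t"
  shows "square_integrable N (\<lambda>\<omega>. B t \<omega> - B s \<omega>)" "expectation (\<lambda>\<omega>. B t \<omega> - B s \<omega>) = 0"
proof -
  have "square_integrable N (\<lambda>\<omega>. B t \<omega> - B s \<omega>) \<and> expectation (\<lambda>\<omega>. B t \<omega> - B s \<omega>) = 0"
  \<comment> \<open>A degenerate increment has no density.\<close>
  proof (cases "s = t")
    case True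
    then show ?thesis by (simp add: square_integrable_def)
  next
    case False
    then have st: "s < t" using assms by simp
    note D = B_distributed[OF assms(1) st]
    have \<sigma>: "0 < sqrt (t - s)" using st by simp
    have "integrable N (\<lambda>\<omega>. (B t \<omega> - B s \<omega>)\<^sup>2)"
      using integrable_normal_moment[OF \<sigma>, of 0 2] distributed_integrable[OF D, of "\<lambda>x. x\<^sup>2"] by simp
    then show ?thesis
      using B_measurable assms normal_distributed_expectation[OF \<sigma> D] by (simp add: square_integrable_def)
  qed
  then show "square_integrable N (\<lambda>\<omega>. B t \<omega> - B s \<omega>)" "expectation (\<lambda>\<omega>. B t \<omega> - B s \<omega>) = 0" by auto
qed

lemma B_L2:
  assumes "0 \<le> t"
  shows "square_integrable N (B t)"
proof -
  have "integrable N (\<lambda>\<omega>. (B t \<omega>)\<^sup>2) \<longleftrightarrow> integrable N (\<lambda>\<omega>. (B t \<omega> - B 0 \<omega>)\<^sup>2)"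
    by (rule Bochner_Integration.integrable_cong) (auto simp: B_0)
  then show ?thesis using increment_L2(1)[of 0 t] B_measurable[OF assms] assms by (simp add: square_integrable_def)
qed

text \<open>The finite-dimensional events up to time \<open>s\<close>: unlike the preimages that
  generate the natural filtration, they are closed under intersection.\<close>

definition past_cylinders :: "real \<Rightarrow> 'a set set" where
  "past_cylinders s = {{\<omega>\<in>space N. \<forall>u\<in>J. B u \<omega> \<in> A u} | J A. finite J \<and> J \<subseteq> {0..s} \<and> (\<forall>u. A u \<in> sets borel)}"

text \<open>On one grid through all times involved, \<open>E\<close> is a condition on the
  increments before \<open>s\<close>, while \<open>B t - B s\<close> is the last increment.
  Independence of the two blocks factorises the expectation, and the second factor is 0.\<close>

lemma past_cylinder_orthogonal:
  assumes st: "0 \<le> s" "s \<le> t" and E: "E \<in> past_cylinders s"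
  shows "expectation (\<lambda>\<omega>. indicator E \<omega> * (B t \<omega> - B s \<omega>)) = 0"
proof -
  obtain J A where E_eq: "E = {\<omega>\<in>space N. \<forall>u\<in>J. B u \<omega> \<in> A u}" and J: "finite J" "J \<subseteq> {0..s}" and A: "\<And>u. A u \<in> sets borel"
    using E unfolding past_cylinders_def by blast
  \<comment> \<open>0 is inserted so that each \<open>B u\<close> is a telescoping sum from
    \<open>B 0 = 0\<close>, and \<open>s\<close> so that the increment up to the appended time
    \<open>t\<close> is exactly \<open>B t - B s\<close>.\<close>
  define L where "L = sorted_list_of_set (insert 0 (insert s J))"
  define m where "m = length L - 1"
  define \<tau> where "\<tau> i = (L @ [t]) ! i" for i
  have set_L: "set L = insert 0 (insert s J)" using J unfolding L_def by (subst set_sorted_list_of_set) auto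
  have sorted: "sorted L" unfolding L_def by simp
  have bounds: "\<forall>u\<in>set L. 0 \<le> u \<and> u \<le> s" using set_L J st by auto
  have len: "length L = Suc m" using set_L by (cases L) (auto simp: m_def)
  have \<tau>_L: "\<tau> i = L ! i" if "i \<le> m" for i using that len by (simp add: \<tau>_def nth_append)
  have \<tau>_t: "\<tau> (Suc m) = t" using len by (metis \<tau>_def nth_append_length)
  have pos: "\<exists>i\<le>m. \<tau> i = u" if "u \<in> set L" for u
    using that len \<tau>_L unfolding in_set_conv_nth by (metis less_Suc_eq_le)
  have mono_L: "\<tau> i \<le> \<tau> j" if "i \<le> j" "j \<le> m" for i j
    using that sorted_nth_mono[OF sorted, of i j] len \<tau>_L by auto
  have in_L: "\<tau> i \<in> set L" if "i \<le> m" for i using that len \<tau>_L by auto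
  have \<tau>_0: "\<tau> 0 = 0" using pos[of 0] mono_L[of 0] in_L[of 0] bounds set_L by fastforce
  have \<tau>_m: "\<tau> m = s" using pos[of s] mono_L[of _ m] in_L[of m] bounds set_L by fastforce
  have \<tau>_mono: "\<tau> i \<le> \<tau> (Suc i)" if "i < Suc m" for i
    using that mono_L[of i "Suc i"] \<tau>_m \<tau>_t st by (cases "i = m") auto
  define incr where "incr i \<omega> = B (\<tau> (Suc i)) \<omega> - B (\<tau> i) \<omega>" for i \<omega>
  have ind: "indep_vars (\<lambda>_. borel) incr {..<Suc m}"
    unfolding incr_def[abs_def] using \<tau>_0 \<tau>_mono by (intro B_indep) auto
  obtain idx where idx: "\<And>u. u \<in> J \<Longrightarrow> idx u \<le> m \<and> \<tau> (idx u) = u"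
    using pos set_L by (metis insert_iff)
  have B_sum: "B u \<omega> = (\<Sum>j<idx u. incr j \<omega>)" if "u \<in> J" "\<omega> \<in> space N" for u \<omega>
    using idx[OF that(1)] B_0[OF that(2)] \<tau>_0 unfolding incr_def
    by (simp add: sum_lessThan_telescope[of "\<lambda>i. B (\<tau> i) \<omega>"])
  \<comment> \<open>The event \<open>E\<close>, as a measurable set of vectors of the first
    \<open>m\<close> increments.\<close>
  define S where "S = {v \<in> space (PiM {..<m} (\<lambda>_. borel)). \<forall>u\<in>J. (\<Sum>j<idx u. v j) \<in> A u}"
  have S: "S \<in> sets (PiM {..<m} (\<lambda>_. borel :: real measure))"
  proof -
    have "(\<lambda>v. \<Sum>j<idx u. v j) \<in> borel_measurable (PiM {..<m} (\<lambda>_. borel :: real measure))" if "u \<in> J" for u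
      using idx[OF that] by (intro borel_measurable_sum measurable_component_singleton) auto
    then have "{v \<in> space (PiM {..<m} (\<lambda>_. borel)). (\<Sum>j<idx u. v j) \<in> A u} \<in> sets (PiM {..<m} (\<lambda>_. borel :: real measure))" if "u \<in> J" for u
      using measurable_sets[OF _ A, of "\<lambda>v. \<Sum>j<idx u. v j" "PiM {..<m} (\<lambda>_. borel)"] that
      by (simp add: vimage_def Int_def conj_commute)
    then show ?thesis unfolding S_def using J(1) by (intro sets.sets_Collect_finite_All)
  qed
  have iv: "indep_var (PiM {..<m} (\<lambda>_. borel)) (\<lambda>\<omega>. restrict (\<lambda>i. incr i \<omega>) {..<m}) (PiM {m} (\<lambda>_. borel)) (\<lambda>\<omega>. restrict (\<lambda>i. incr i \<omega>) {m})"
    by (rule indep_var_restrict[OF ind]) auto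
  have ic: "indep_var borel ((indicator S :: _ \<Rightarrow> real) \<circ> (\<lambda>\<omega>. restrict (\<lambda>i. incr i \<omega>) {..<m})) borel ((\<lambda>v. v m) \<circ> (\<lambda>\<omega>. restrict (\<lambda>i. incr i \<omega>) {m}))"
    using S by (intro indep_var_compose[OF iv] borel_measurable_indicator measurable_component_singleton) auto
  have ind_eq: "((indicator S :: _ \<Rightarrow> real) \<circ> (\<lambda>\<omega>. restrict (\<lambda>i. incr i \<omega>) {..<m})) \<omega> = indicator E \<omega>" if "\<omega> \<in> space N" for \<omega>
  proof -
    have "(\<Sum>j<idx u. restrict (\<lambda>i. incr i \<omega>) {..<m} j) = B u \<omega>" if "u \<in> J" for u
      unfolding B_sum[OF that \<open>\<omega> \<in> space N\<close>] using idx[OF that] by (intro sum.cong) auto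
    then show ?thesis using that by (auto simp: S_def E_eq indicator_def space_PiM)
  qed
  have inc_eq: "((\<lambda>v. v m) \<circ> (\<lambda>\<omega>. restrict (\<lambda>i. incr i \<omega>) {m})) = (\<lambda>\<omega>. B t \<omega> - B s \<omega>)"
    by (auto simp: incr_def \<tau>_m \<tau>_t)
  have "expectation (\<lambda>\<omega>. ((indicator S :: _ \<Rightarrow> real) \<circ> (\<lambda>\<omega>. restrict (\<lambda>i. incr i \<omega>) {..<m})) \<omega> * (B t \<omega> - B s \<omega>)) 
     = expectation ((indicator S :: _ \<Rightarrow> real) \<circ> (\<lambda>\<omega>. restrict (\<lambda>i. incr i \<omega>) {..<m})) * expectation (\<lambda>\<omega>. B t \<omega> - B s \<omega>)"
  proof (rule indep_var_lebesgue_integral[OF ic[unfolded inc_eq]])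
    show "integrable N ((indicator S :: _ \<Rightarrow> real) \<circ> (\<lambda>\<omega>. restrict (\<lambda>i. incr i \<omega>) {..<m}))"
      using indep_var_rv1[OF ic] by (intro integrable_const_bound[of _ 1]) (auto simp: indicator_def)
    show "integrable N (\<lambda>\<omega>. B t \<omega> - B s \<omega>)"
      using square_integrable_integrable[OF increment_L2(1)[OF st]] .
  qed
  also have "\<dots> = 0" using increment_L2(2)[OF st] by simp
  also have "expectation (\<lambda>\<omega>. ((indicator S :: _ \<Rightarrow> real) \<circ> (\<lambda>\<omega>. restrict (\<lambda>i. incr i \<omega>) {..<m})) \<omega> * (B t \<omega> - B s \<omega>))
    = expectation (\<lambda>\<omega>. indicator E \<omega> * (B t \<omega> - B s \<omega>))"
    by (rule Bochner_Integration.integral_cong[OF refl]) (simp only: ind_eq)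
  finally show ?thesis .
qed

lemma Int_stable_past_cylinders: "Int_stable (past_cylinders s)"
proof (rule Int_stableI)
  fix a b assume "a \<in> past_cylinders s" "b \<in> past_cylinders s"
  then obtain J A J' A' where a: "a = {\<omega>\<in>space N. \<forall>u\<in>J. B u \<omega> \<in> A u}" "finite J" "J \<subseteq> {0..s}" "\<And>u. A u \<in> sets borel"
    and b: "b = {\<omega>\<in>space N. \<forall>u\<in>J'. B u \<omega> \<in> A' u}" "finite J'" "J' \<subseteq> {0..s}" "\<And>u. A' u \<in> sets borel"
    unfolding past_cylinders_def by blast
  define A'' where "A'' u = (if u \<in> J then A u else UNIV) \<inter> (if u \<in> J' then A' u else UNIV)" for u
  have "a \<inter> b = {\<omega>\<in>space N. \<forall>u\<in>J \<union> J'. B u \<omega> \<in> A'' u}" unfolding a b A''_def by auto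
  moreover have "A'' u \<in> sets borel" for u using a b by (auto simp: A''_def)
  ultimately show "a \<inter> b \<in> past_cylinders s" using a b unfolding past_cylinders_def
    by (intro CollectI exI[of _ "J \<union> J'"] exI[of _ A'']) auto
qed

text \<open>Dynkin's argument starting from the cylinders: complements use that the increment has
  mean zero, disjoint unions that it is integrable.\<close>

lemma past_orthogonal:
  assumes st: "0 \<le> s" "s \<le> t" and E: "E \<in> sets (\<F> s)"
  shows "expectation (\<lambda>\<omega>. indicator E \<omega> * (B t \<omega> - B s \<omega>)) = 0"
proof -
  let ?D = "\<lambda>\<omega>. B t \<omega> - B s \<omega>"
  have iD: "integrable N ?D" using square_integrable_integrable[OF increment_L2(1)[OF st]] .
  have "(\<Union>u\<in>{0..s}. {B u -` A \<inter> space N | A. A \<in> sets borel}) \<subseteq> past_cylinders s"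
  proof safe
    fix u and A :: "real set" assume "u \<in> {0..s}" "A \<in> sets borel"
    then show "B u -` A \<inter> space N \<in> past_cylinders s"
      unfolding past_cylinders_def by (intro CollectI exI[of _ "{u}"] exI[of _ "\<lambda>_. A"]) auto
  qed
  then have E': "E \<in> sigma_sets (space N) (past_cylinders s)"
    using E sigma_sets_mono' unfolding sets_natural_filtration by blast
  have closed: "past_cylinders s \<subseteq> Pow (space N)" unfolding past_cylinders_def by auto
  have "past_cylinders s \<subseteq> sets N"
  proof
    fix C assume "C \<in> past_cylinders s"
    then obtain J A where C: "C = {\<omega>\<in>space N. \<forall>u\<in>J. B u \<omega> \<in> A u}" "finite J" "J \<subseteq> {0..s}" "\<And>u. A u \<in> sets borel"
      unfolding past_cylinders_def by blast
    have "B u -` A u \<inter> space N \<in> sets N" if "u \<in> J" for u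
      using that C by (intro measurable_sets[OF B_measurable]) auto
    then have "{\<omega>\<in>space N. B u \<omega> \<in> A u} \<in> sets N" if "u \<in> J" for u
      using that by (simp add: vimage_def Int_def conj_commute)
    then show "C \<in> sets N" unfolding C(1) using C(2) by (intro sets.sets_Collect_finite_All)
  qed
  then have sub: "sigma_sets (space N) (past_cylinders s) \<subseteq> sets N" by (rule sets.sigma_sets_subset)
  have int: "integrable N (\<lambda>\<omega>. indicator A \<omega> * ?D \<omega>)" if "A \<in> sigma_sets (space N) (past_cylinders s)" for A
    using integrable_mult_indicator[OF _ iD, of A] that sub by auto
  show ?thesis using Int_stable_past_cylinders closed E'
  proof (induction rule: sigma_sets_induct_disjoint)
    case (basic A)
    then show ?case by (rule past_cylinder_orthogonal[OF st])
  next
    case (compl A)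
    have "expectation (\<lambda>\<omega>. indicator (space N - A) \<omega> * ?D \<omega>) = expectation (\<lambda>\<omega>. ?D \<omega> - indicator A \<omega> * ?D \<omega>)"
      by (rule Bochner_Integration.integral_cong) (auto simp: indicator_def)
    then show ?case using compl int[OF compl(1)] iD increment_L2(2)[OF st] by simp
  next
    case (union A)
    have A: "A i \<in> sigma_sets (space N) (past_cylinders s)" for i using union by auto
    have "(LINT \<omega>:(\<Union>i. A i)|N. ?D \<omega>) = (\<Sum>i. (LINT \<omega>:(A i)|N. ?D \<omega>))"
    proof (rule lebesgue_integral_countable_add)
      show "set_integrable N (\<Union>i. A i) ?D"
        using int[OF sigma_sets.Union[of A], OF A] by (simp add: set_integrable_def)
    qed (use A sub union(1) in \<open>auto simp: disjoint_family_on_def\<close>)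
    then show ?case using union(3) by (simp add: set_lebesgue_integral_def)
  qed simp
qed

lemma martingale_B: "martingale N \<F> B"
  by (rule martingaleI)
     (auto intro: filtration_natural subalgebra_natural B_measurable adapted_natural past_orthogonal
       square_integrable_integrable[OF B_L2])

section \<open>Rises and falls over unit time intervals\<close>

lemma increment_interval_prob:
  assumes "0 \<le> s" "a < b"
  shows "prob ((\<lambda>\<omega>. B (s + 1) \<omega> - B s \<omega>) -` {a..b} \<inter> space N) = measure (density lborel (normal_density 0 1)) {a..b}"
proof -
  have D: "distributed N lborel (\<lambda>\<omega>. B (s + 1) \<omega> - B s \<omega>) (normal_density 0 1)"
    using B_distributed[of s "s + 1"] assms by simp
  show ?thesis
    unfolding measure_def using distributed_emeasure[OF D, of "{a..b}"] by (simp add: emeasure_density)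
qed

lemma normal_interval_pos:
  fixes a b :: real
  assumes "a < b"
  shows "0 < measure (density lborel (normal_density 0 1)) {a..b}"
proof -
  interpret n: prob_space "density lborel (normal_density 0 1)" by (rule prob_space_normal_density) simp
  have "{a..b} \<notin> null_sets (density lborel (normal_density 0 1))"
  proof
    assume "{a..b} \<in> null_sets (density lborel (normal_density 0 1))"
    then have "AE x in lborel. x \<in> {a..b} \<longrightarrow> ennreal (normal_density 0 1 x) = 0"
      by (subst (asm) null_sets_density_iff) auto
    then have "AE x in lborel. x \<notin> {a..b}"
    proof eventually_elim
      case (elim x)
      have "0 < normal_density 0 1 x" by (rule normal_density_pos) simp
      then show ?case using elim by (auto simp: ennreal_eq_0_iff)
    qed
    then have "emeasure lborel {a..b} = 0"
      by (subst (asm) AE_iff_measurable[of "{a..b}"]) auto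
    then show False using assms by (simp add: ennreal_eq_0_iff)
  qed
  then have "n.prob {a..b} \<noteq> 0"
    by (auto simp: null_sets_def n.emeasure_eq_measure)
  then show ?thesis by (simp add: zero_less_measure_iff)
qed

text \<open>A rise of at least \<open>3 * d\<close> followed by a fall between \<open>d\<close> and
  \<open>2 * d\<close> leaves the path at least \<open>d\<close> below its peak and at least
  \<open>d\<close> above the start of the rise, so it forces the centring time to be finite.
  Disjoint pairs of unit intervals are independent and succeed with the same positive
  probability.\<close>

lemma AE_up_down:
  assumes d: "0 < d"
  shows "AE \<omega> in N. \<exists>n::nat. 3 * d \<le> B (2 * n + 1) \<omega> - B (2 * n) \<omega> \<and>
    B (2 * n + 2) \<omega> - B (2 * n + 1) \<omega> \<in> {- 2 * d .. - d}"
proof -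
  define incr where "incr i \<omega> = B (real (Suc i)) \<omega> - B (real i) \<omega>" for i \<omega>
  have incr_m [measurable]: "incr i \<in> borel_measurable N" for i
    unfolding incr_def[abs_def] using B_measurable by auto
  have ind: "indep_vars (\<lambda>_. borel) incr {..<n}" for n
    unfolding incr_def[abs_def] by (rule B_indep) auto
  \<comment> \<open>The end \<open>3 * d + 1\<close> only makes the first interval bounded and of
    positive length.\<close>
  define I where "I i = (if even i then {3 * d .. 3 * d + 1} else {- 2 * d .. - d})" for i :: nat
  have I_m: "I i \<in> sets borel" for i by (simp add: I_def)
  define G where "G i = incr i -` I i \<inter> space N" for i
  define p where "p = measure (density lborel (normal_density 0 1)) {3 * d .. 3 * d + 1} * measure (density lborel (normal_density 0 1)) {- 2 * d .. - d}"
  have p: "0 < p" unfolding p_def using d by (intro mult_pos_pos normal_interval_pos) auto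
  have G_m: "G i \<in> sets N" for i unfolding G_def using I_m by measurable
  have prob_pair: "prob (G (2 * j) \<inter> G (2 * j + 1)) = p" for j
  proof -
    have "prob (\<Inter>i\<in>{2 * j, 2 * j + 1}. incr i -` I i \<inter> space N) = (\<Prod>i\<in>{2 * j, 2 * j + 1}. prob (incr i -` I i \<inter> space N))"
      by (rule indep_varsD[OF ind[of "2 * j + 2"]]) (auto simp: I_m)
    moreover have "prob (incr (2 * j) -` I (2 * j) \<inter> space N) = measure (density lborel (normal_density 0 1)) {3 * d .. 3 * d + 1}"
      using increment_interval_prob[of "real (2 * j)" "3 * d" "3 * d + 1"] by (simp add: incr_def[abs_def] I_def add.commute)
    moreover have "prob (incr (2 * j + 1) -` I (2 * j + 1) \<inter> space N) = measure (density lborel (normal_density 0 1)) {- 2 * d .. - d}"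
      using increment_interval_prob[of "real (2 * j + 1)" "- 2 * d" "- d"] d by (simp add: incr_def[abs_def] I_def add.commute)
    ultimately show ?thesis by (simp add: G_def p_def)
  qed
  have p1: "p \<le> 1" using prob_pair[of 0] by (metis prob_le_1)
  define Q where "Q j = space N - (G (2 * j) \<inter> G (2 * j + 1))" for j
  have Q_m: "Q j \<in> sets N" for j unfolding Q_def using G_m by auto
  have prob_Q: "prob (Q j) = 1 - p" for j
    unfolding Q_def using prob_pair[of j] G_m by (subst prob_compl) auto
  \<comment> \<open>The index set is kept nonempty: an empty intersection would be the whole type
    and not \<open>space N\<close>.\<close>
  have prob_Q_Int: "prob (\<Inter>j<Suc n. Q j) = (1 - p) ^ Suc n" for n
  proof -
    let ?K = "\<lambda>j. {2 * j, 2 * j + 1 :: nat}"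
    let ?V = "\<lambda>j \<omega>. restrict (\<lambda>i. incr i \<omega>) (?K j)"
    let ?S = "\<lambda>j. space (PiM (?K j) (\<lambda>_. borel)) - {v \<in> space (PiM (?K j) (\<lambda>_. borel)). v (2 * j) \<in> I (2 * j) \<and> v (2 * j + 1) \<in> I (2 * j + 1)}"
    have iv: "indep_vars (\<lambda>j. PiM (?K j) (\<lambda>_. borel)) ?V {..<Suc n}"
    proof (rule indep_vars_restrict[OF ind[of "2 * n + 2"]])
      show "?K j \<subseteq> {..<2 * n + 2}" if "j \<in> {..<Suc n}" for j using that by auto
      show "disjoint_family_on ?K {..<Suc n}"
      proof -
        have "2 * a \<noteq> 2 * b + 1" for a b :: nat by presburger
        then have "?K a \<inter> ?K b = {}" if "a \<noteq> b" for a b using that by force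
        then show ?thesis unfolding disjoint_family_on_def by blast
      qed
    qed
    have S: "?S j \<in> sets (PiM (?K j) (\<lambda>_. borel))" for j
      using I_m by measurable
    have V: "?V j -` ?S j \<inter> space N = Q j" for j
      by (auto simp: Q_def G_def space_PiM)
    have "prob (\<Inter>j\<in>{..<Suc n}. ?V j -` ?S j \<inter> space N) = (\<Prod>j\<in>{..<Suc n}. prob (?V j -` ?S j \<inter> space N))"
      by (rule indep_varsD_finite[OF iv]) (use S in auto)
    then show ?thesis by (simp only: V prob_Q prod_constant card_lessThan)
  qed
  have "prob (\<Inter>j. Q j) \<le> (1 - p) ^ Suc n" for n
    unfolding prob_Q_Int[symmetric] using Q_m by (intro finite_measure_mono) auto
  moreover have "(\<lambda>n. (1 - p) ^ Suc n) \<longlonglongrightarrow> 0"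
    using p p1 by (intro LIMSEQ_Suc LIMSEQ_realpow_zero) auto
  ultimately have "prob (\<Inter>j. Q j) \<le> 0" by (intro LIMSEQ_le_const[of _ 0]) auto
  then have "prob (\<Inter>j. Q j) = 0" using measure_nonneg[of N "\<Inter>j. Q j"] by linarith
  then have "AE \<omega> in N. \<omega> \<notin> (\<Inter>j. Q j)"
    using Q_m by (intro AE_not_in) (auto simp: null_sets_def emeasure_eq_measure)
  with AE_space show ?thesis
  proof eventually_elim
    case (elim \<omega>)
    then obtain j where "\<omega> \<in> G (2 * j)" "\<omega> \<in> G (2 * j + 1)" by (auto simp: Q_def)
    then show ?case
      by (intro exI[of _ j]) (auto simp: G_def I_def incr_def add.commute)
  qed
qed

end

section \<open>Balanced points of a continuous path\<close>

text \<open>Stated with witnesses in place of running extrema. For continuous paths both agree,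
  since extrema are attained, and witnesses can be reused at later times and treated by
  compactness.\<close>

definition balanced_at :: "real \<Rightarrow> (real \<Rightarrow> real) \<Rightarrow> real \<Rightarrow> bool" where
  "balanced_at d f t \<longleftrightarrow> 0 \<le> t \<and> (\<exists>a\<in>{0..t}. d \<le> f a - f t) \<and> (\<exists>b\<in>{0..t}. d \<le> f t - f b)"

lemma running_max_attained:
  assumes "continuous_on {0..} (\<lambda>t. B t \<omega>)" "0 \<le> t"
  obtains a where "a \<in> {0..t}" "running_max B t \<omega> = B a \<omega>" "\<And>s. s \<in> {0..t} \<Longrightarrow> B s \<omega> \<le> B a \<omega>"
proof -
  have "continuous_on {0..t} (\<lambda>t. B t \<omega>)" using assms(1) by (rule continuous_on_subset) auto
  then obtain a where a: "a \<in> {0..t}" "\<forall>s\<in>{0..t}. B s \<omega> \<le> B a \<omega>"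
    using continuous_attains_sup[of "{0..t}" "\<lambda>t. B t \<omega>"] assms(2) by auto
  have "running_max B t \<omega> = B a \<omega>" unfolding running_max_def using a by (intro cSup_eq_maximum) auto
  then show thesis using a by (intro that) auto
qed

lemma running_min_attained:
  assumes "continuous_on {0..} (\<lambda>t. B t \<omega>)" "0 \<le> t"
  obtains a where "a \<in> {0..t}" "running_min B t \<omega> = B a \<omega>" "\<And>s. s \<in> {0..t} \<Longrightarrow> B a \<omega> \<le> B s \<omega>"
proof -
  have "continuous_on {0..t} (\<lambda>t. B t \<omega>)" using assms(1) by (rule continuous_on_subset) auto
  then obtain a where a: "a \<in> {0..t}" "\<forall>s\<in>{0..t}. B a \<omega> \<le> B s \<omega>"
    using continuous_attains_inf[of "{0..t}" "\<lambda>t. B t \<omega>"] assms(2) by auto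
  have "running_min B t \<omega> = B a \<omega>" unfolding running_min_def using a by (intro cInf_eq_minimum) auto
  then show thesis using a by (intro that) auto
qed

lemma balanced_at_iff:
  assumes "continuous_on {0..} (\<lambda>t. B t \<omega>)"
  shows "0 \<le> t \<and> d \<le> min (running_max B t \<omega> - B t \<omega>) (B t \<omega> - running_min B t \<omega>) \<longleftrightarrow> balanced_at d (\<lambda>t. B t \<omega>) t"
proof (cases "0 \<le> t")
  case True
  obtain a where a: "a \<in> {0..t}" "running_max B t \<omega> = B a \<omega>" "\<And>s. s \<in> {0..t} \<Longrightarrow> B s \<omega> \<le> B a \<omega>"
    using running_max_attained[where B = B and \<omega> = \<omega>, OF assms True] by metis
  obtain b where b: "b \<in> {0..t}" "running_min B t \<omega> = B b \<omega>" "\<And>s. s \<in> {0..t} \<Longrightarrow> B b \<omega> \<le> B s \<omega>"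
    using running_min_attained[where B = B and \<omega> = \<omega>, OF assms True] by metis
  show ?thesis
  proof
    assume "0 \<le> t \<and> d \<le> min (running_max B t \<omega> - B t \<omega>) (B t \<omega> - running_min B t \<omega>)"
    then show "balanced_at d (\<lambda>t. B t \<omega>) t" unfolding balanced_at_def using a(1,2) b(1,2) by auto
  next
    assume "balanced_at d (\<lambda>t. B t \<omega>) t"
    then obtain a' b' where "a' \<in> {0..t}" "d \<le> B a' \<omega> - B t \<omega>" "b' \<in> {0..t}" "d \<le> B t \<omega> - B b' \<omega>"
      unfolding balanced_at_def by blast
    then have "d \<le> B a \<omega> - B t \<omega>" "d \<le> B t \<omega> - B b \<omega>" using a(3)[of a'] b(3)[of b'] by linarith+
    then show "0 \<le> t \<and> d \<le> min (running_max B t \<omega> - B t \<omega>) (B t \<omega> - running_min B t \<omega>)"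
      using True a(2) b(2) by simp
  qed
qed (simp add: balanced_at_def)

lemma continuous_on_comp_nonneg:
  fixes f :: "real \<Rightarrow> real"
  assumes "continuous_on {0..} f" "continuous_on S g" "\<And>x. x \<in> S \<Longrightarrow> 0 \<le> g x"
  shows "continuous_on S (\<lambda>x. f (g x))"
  using continuous_on_compose2[OF assms(1,2)] assms(3) by auto

text \<open>The triples \<open>(t, a, b)\<close> witnessing that \<open>f\<close> is balanced at some \<open>t \<le> u\<close> form a compact set.\<close>

lemma first_balanced:
  fixes f :: "real \<Rightarrow> real"
  assumes f: "continuous_on {0..} f" and ex: "balanced_at d f u"
  obtains \<tau> where "balanced_at d f \<tau>" "\<And>s. balanced_at d f s \<Longrightarrow> \<tau> \<le> s"
proof -
  define C where "C = {x \<in> {0..u} \<times> {0..u} \<times> {0..u}. fst (snd x) \<le> fst x \<and> snd (snd x) \<le> fst x \<and>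
     d \<le> f (fst (snd x)) - f (fst x) \<and> d \<le> f (fst x) - f (snd (snd x))}"
  have c: "continuous_on ({0..u} \<times> {0..u} \<times> {0..u}) (\<lambda>x. f (fst x))"
    "continuous_on ({0..u} \<times> {0..u} \<times> {0..u}) (\<lambda>x. f (fst (snd x)))"
    "continuous_on ({0..u} \<times> {0..u} \<times> {0..u}) (\<lambda>x. f (snd (snd x)))"
    by (rule continuous_on_comp_nonneg[OF f]; (intro continuous_intros)?; auto)+
  have "closed C"
  proof -
    have K: "closed ({0..u} \<times> {0..u} \<times> {0..u})" by (intro closed_Times closed_atLeastAtMost)
    have "C = {x \<in> {0..u} \<times> {0..u} \<times> {0..u}. fst (snd x) \<le> fst x} \<inter> {x \<in> {0..u} \<times> {0..u} \<times> {0..u}. snd (snd x) \<le> fst x} \<inter>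
      {x \<in> {0..u} \<times> {0..u} \<times> {0..u}. d \<le> f (fst (snd x)) - f (fst x)} \<inter> {x \<in> {0..u} \<times> {0..u} \<times> {0..u}. d \<le> f (fst x) - f (snd (snd x))}"
      by (auto simp: C_def)
    also have "closed \<dots>"
      by (intro closed_Int continuous_on_closed_Collect_le K continuous_intros c)
    finally show ?thesis .
  qed
  moreover have "bounded C"
    by (rule bounded_subset[of "{0..u} \<times> {0..u} \<times> {0..u}"]) (auto simp: C_def intro!: bounded_Times)
  ultimately have "compact C" by (simp add: compact_eq_bounded_closed)
  moreover have "C \<noteq> {}"
  proof -
    obtain a b where "a \<in> {0..u}" "d \<le> f a - f u" "b \<in> {0..u}" "d \<le> f u - f b" "0 \<le> u"
      using ex unfolding balanced_at_def by blast
    then have "(u, a, b) \<in> C" by (simp add: C_def)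
    then show ?thesis by blast
  qed
  ultimately obtain x where x: "x \<in> C" "\<And>y. y \<in> C \<Longrightarrow> fst x \<le> fst y"
    using continuous_attains_inf[of C fst] continuous_on_fst[OF continuous_on_id] by blast
  have "balanced_at d f (fst x)"
    using x(1) unfolding balanced_at_def C_def by auto
  moreover have "fst x \<le> s" if s: "balanced_at d f s" for s
  proof (cases "s \<le> u")
    case True
    obtain a b where "a \<in> {0..s}" "d \<le> f a - f s" "b \<in> {0..s}" "d \<le> f s - f b" "0 \<le> s"
      using s unfolding balanced_at_def by blast
    then have "(s, a, b) \<in> C" using True by (simp add: C_def)
    then show ?thesis using x(2) by fastforce
  next
    case False
    then show ?thesis using x(1) by (auto simp: C_def)
  qed
  ultimately show thesis by (rule that)
qed

lemma centring_time_cases: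
  assumes "continuous_on {0..} (\<lambda>t. B t \<omega>)"
  obtains (infinite) "centring_time B d \<omega> = \<infinity>" "\<And>s. \<not> balanced_at d (\<lambda>t. B t \<omega>) s"
  | (finite) \<tau> where "centring_time B d \<omega> = ereal \<tau>" "balanced_at d (\<lambda>t. B t \<omega>) \<tau>"
      "\<And>s. s < \<tau> \<Longrightarrow> \<not> balanced_at d (\<lambda>t. B t \<omega>) s"
proof (cases "\<exists>u. balanced_at d (\<lambda>t. B t \<omega>) u")
  case True
  then obtain u where "balanced_at d (\<lambda>t. B t \<omega>) u" ..
  then obtain \<tau> where \<tau>: "balanced_at d (\<lambda>t. B t \<omega>) \<tau>" "\<And>s. balanced_at d (\<lambda>t. B t \<omega>) s \<Longrightarrow> \<tau> \<le> s"
    using first_balanced[OF assms] by metis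
  have "centring_time B d \<omega> = ereal \<tau>"
    unfolding centring_time_def balanced_at_iff[where B = B and \<omega> = \<omega>, OF assms]
    using \<tau> by (intro antisym Inf_lower Inf_greatest) auto
  then show thesis using \<tau> finite by force
next
  case False
  then show thesis using infinite unfolding centring_time_def balanced_at_iff[where B = B and \<omega> = \<omega>, OF assms] by (simp add: top_ereal_def)
qed

text \<open>With range at least \<open>2 * d\<close>, an unbalanced path is inside one wing. To
  leave it, the path must by the intermediate value theorem hit the level \<open>f i - d\<close> or
  \<open>f j + d\<close>, and there \<open>i\<close> and \<open>j\<close> themselves witness
  balance.\<close>

lemma unbalanced_same_wing:
  fixes f :: "real \<Rightarrow> real"
  assumes f: "continuous_on {0..} f" and no: "\<And>r. r < u \<Longrightarrow> \<not> balanced_at d f r"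
    and i: "i \<in> {0..s}" and j: "j \<in> {0..s}" and su: "s \<le> u" and le: "f j \<le> f s" "f s \<le> f i"
  shows "same_wing d (f i) (f j) (f s) (f u)"
proof (rule ccontr)
  assume nw: "\<not> ?thesis"
  then have su': "s < u" and r2: "2 * d \<le> f i - f j" using su by (auto simp: same_wing_def less_le)
  have cont: "continuous_on {s..u} f" using f i by (intro continuous_on_subset[OF f]) auto
  have "\<not> balanced_at d f s" using no su' by blast
  then have "\<not> (d \<le> f i - f s \<and> d \<le> f s - f j)" using i j unfolding balanced_at_def by auto
  then consider "f i - d < f s" | "f s < f j + d" by linarith
  then show False
  proof cases
    case 1
    then have u: "f u < f i - d" using nw by (auto simp: same_wing_def)
    then obtain r where r: "s \<le> r" "r \<le> u" "f r = f i - d"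
      using IVT2'[of f u "f i - d" s] 1 su cont by auto
    \<comment> \<open>At \<open>u\<close> the path is strictly past the level, so the crossing
      happens earlier, where balance is excluded.\<close>
    then have "r < u" using u by (cases "r = u") auto
    moreover have "balanced_at d f r"
      unfolding balanced_at_def using i j r r2 by (intro conjI bexI[of _ i] bexI[of _ j]) auto
    ultimately show False using no by blast
  next
    case 2
    then have u: "f j + d < f u" using nw by (auto simp: same_wing_def)
    then obtain r where r: "s \<le> r" "r \<le> u" "f r = f j + d"
      using IVT'[of f s "f j + d" u] 2 su cont by auto
    then have "r < u" using u by (cases "r = u") auto
    moreover have "balanced_at d f r"
      unfolding balanced_at_def using i j r r2 by (intro conjI bexI[of _ i] bexI[of _ j]) auto
    ultimately show False using no by blast
  qed
qed

lemma centred_path_stopped: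
  fixes f :: "real \<Rightarrow> real"
  assumes f: "continuous_on {0..} f" and no: "\<And>r. r < \<tau> \<Longrightarrow> \<not> balanced_at d f r"
  shows "centred_path d (\<lambda>t. f (min t \<tau>))"
  unfolding centred_path_def
proof (intro allI impI)
  fix s u i j assume *: "i \<in> {0..s}" "j \<in> {0..s}" "s \<le> u" "f (min j \<tau>) \<le> f (min s \<tau>)" "f (min s \<tau>) \<le> f (min i \<tau>)"
  show "same_wing d (f (min i \<tau>)) (f (min j \<tau>)) (f (min s \<tau>)) (f (min u \<tau>))"
  proof (cases "s < \<tau>")
    case True
    then have "min i \<tau> = i" "min j \<tau> = j" "min s \<tau> = s" using * by auto
    then show ?thesis using * True no by (auto intro!: unbalanced_same_wing[OF f])
  next
    case False
    then show ?thesis using * by (simp add: same_wing_def)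
  qed
qed

lemma centred_path_unbalanced:
  fixes f :: "real \<Rightarrow> real"
  assumes f: "continuous_on {0..} f" and no: "\<And>r. \<not> balanced_at d f r"
  shows "centred_path d f"
  unfolding centred_path_def using unbalanced_same_wing[OF f no] by blast

lemma centred_path_min:
  assumes "centred_path d f"
  shows "centred_path d (\<lambda>s. f (min s t))"
  unfolding centred_path_def
proof (intro allI impI)
  fix s u i j assume *: "i \<in> {0..s}" "j \<in> {0..s}" "s \<le> u" "f (min j t) \<le> f (min s t)" "f (min s t) \<le> f (min i t)"
  show "same_wing d (f (min i t)) (f (min j t)) (f (min s t)) (f (min u t))"
  proof (cases "s \<le> t")
    case True
    then have "min i t \<in> {0..min s t}" "min j t \<in> {0..min s t}" "min s t \<le> min u t" using * by auto
    then show ?thesis using assms * unfolding centred_path_def by blast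
  qed (use * in \<open>simp add: same_wing_def\<close>)
qed

text \<open>The weights switch off at the first grid point not before \<open>\<tau>\<close>, so the
  sum telescopes up to it, or up to \<open>u n\<close> if there is none yet. This \<open>c\<close>
  exceeds \<open>\<tau>\<close> by at most the mesh \<open>h\<close>.\<close>

lemma stopped_increments_sum:
  fixes f u :: "nat \<Rightarrow> real" and g :: "real \<Rightarrow> real"
  assumes u: "\<And>k. u (Suc k) = u k + h" and h: "0 \<le> h" and start: "u 0 < \<tau>"
  shows "\<exists>c. min \<tau> (u n) \<le> c \<and> c \<le> min (\<tau> + h) (u n) \<and>
     (\<Sum>k<n. if u k < \<tau> then g (u (Suc k)) - g (u k) else 0) = g c - g (u 0)"
proof (induction n)
  case 0
  then show ?case using h start by (intro exI[of _ "u 0"]) auto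
next
  case (Suc n)
  then obtain c where c: "min \<tau> (u n) \<le> c" "c \<le> min (\<tau> + h) (u n)"
    "(\<Sum>k<n. if u k < \<tau> then g (u (Suc k)) - g (u k) else 0) = g c - g (u 0)" by blast
  show ?case
  proof (cases "u n < \<tau>")
    case True
    then have "c = u n" using c(1,2) h by auto
    then show ?thesis using c(3) True u[of n] h by (intro exI[of _ "u (Suc n)"]) auto
  next
    case False
    then show ?thesis using c u[of n] h by (intro exI[of _ c]) auto
  qed
qed

text \<open>These are proportions, not times: for \<open>p\<close> and \<open>q\<close> in this set,
  \<open>p * q * u \<le> q * u \<le> u\<close> holds automatically, so triples of times in the
  required order are parametrised by a product of countable sets.\<close>

definition unit_rationals :: "real set" where
  "unit_rationals = {real k / real (Suc n) | k n. k \<le> Suc n}"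

lemma countable_unit_rationals: "countable unit_rationals"
proof -
  have "unit_rationals \<subseteq> (\<lambda>(k, n). real k / real (Suc n)) ` (UNIV :: (nat \<times> nat) set)"
    unfolding unit_rationals_def by auto
  then show ?thesis by (rule countable_subset) auto
qed

lemma unit_rationals_subset: "unit_rationals \<subseteq> {0..1}"
  unfolding unit_rationals_def by (auto simp: divide_le_eq_1)

lemma unit_rationals_dense:
  assumes "p \<in> {0..1}"
  obtains q where "\<And>n. q n \<in> unit_rationals" "q \<longlonglongrightarrow> p"
proof -
  define k where "k n = nat \<lfloor>p * real (Suc n)\<rfloor>" for n
  define q where "q n = real (k n) / real (Suc n)" for n
  have k: "real (k n) = of_int \<lfloor>p * real (Suc n)\<rfloor>" for n using assms by (simp add: k_def)
  have k_le: "real (k n) \<le> p * real (Suc n)" "p * real (Suc n) < real (k n) + 1" for n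
    unfolding k by linarith+
  have le: "k n \<le> Suc n" for n
  proof -
    have "p * real (Suc n) \<le> 1 * real (Suc n)" using assms by (intro mult_right_mono) auto
    then have "real (k n) \<le> real (Suc n)" using order_trans[OF k_le(1)[of n]] by simp
    then show ?thesis by simp
  qed
  have "q n \<in> unit_rationals" for n
    unfolding q_def unit_rationals_def using le[of n] by blast
  moreover have "q \<longlonglongrightarrow> p"
  proof (rule tendsto_sandwich[of "\<lambda>n. p - inverse (real (Suc n))" _ _ "\<lambda>_. p"])
    show "\<forall>\<^sub>F n in sequentially. p - inverse (real (Suc n)) \<le> q n"
    proof (rule always_eventually, rule allI)
      fix n
      have "p - inverse (real (Suc n)) = (p * real (Suc n) - 1) / real (Suc n)" by (simp add: field_simps)
      also have "\<dots> \<le> q n" unfolding q_def using k_le(2)[of n] by (intro divide_right_mono) auto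
      finally show "p - inverse (real (Suc n)) \<le> q n" .
    qed
    show "\<forall>\<^sub>F n in sequentially. q n \<le> p"
      unfolding q_def using k_le(1) by (intro always_eventually allI) (simp add: divide_le_eq)
    show "(\<lambda>n. p - inverse (real (Suc n))) \<longlonglongrightarrow> p"
      using tendsto_diff[OF tendsto_const LIMSEQ_inverse_real_of_nat, of p] by simp
  qed auto
  ultimately show thesis by (rule that)
qed

text \<open>Exact inequalities over a continuum of times become countably many strict ones with
  slack, so that the event can be placed in the filtration. Density of the proportions gives one
  direction. For the other, a continuous function on a cube attains its maximum, which exceeds
  \<open>d\<close> minus every slack and hence is at least \<open>d\<close>.\<close>

lemma balanced_before_iff:
  fixes f :: "real \<Rightarrow> real"
  assumes f: "continuous_on {0..} f" and u: "0 \<le> u"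
  shows "(\<exists>t\<le>u. balanced_at d f t) \<longleftrightarrow> (\<forall>n. \<exists>p\<in>unit_rationals. \<exists>q\<in>unit_rationals. \<exists>r\<in>unit_rationals.
     d - inverse (real (Suc n)) < f (p * q * u) - f (q * u) \<and> d - inverse (real (Suc n)) < f (q * u) - f (r * q * u))"
proof
  assume "\<exists>t\<le>u. balanced_at d f t"
  then obtain t a b where t: "0 \<le> t" "t \<le> u" and a: "a \<in> {0..t}" "d \<le> f a - f t" and b: "b \<in> {0..t}" "d \<le> f t - f b"
    unfolding balanced_at_def by blast
  obtain p where p: "p \<in> {0..1}" "p * t = a"
    using a by (cases "t = 0") (auto intro!: that[of "a / t"])
  obtain r where r: "r \<in> {0..1}" "r * t = b"
    using b by (cases "t = 0") (auto intro!: that[of "b / t"])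
  obtain q where q: "q \<in> {0..1}" "q * u = t"
    using t by (cases "u = 0") (auto intro!: that[of "t / u"])
  obtain p' q' r' where p': "\<And>n. p' n \<in> unit_rationals" "p' \<longlonglongrightarrow> p" and q': "\<And>n. q' n \<in> unit_rationals" "q' \<longlonglongrightarrow> q"
    and r': "\<And>n. r' n \<in> unit_rationals" "r' \<longlonglongrightarrow> r"
    using unit_rationals_dense[OF p(1)] unit_rationals_dense[OF q(1)] unit_rationals_dense[OF r(1)] by metis
  have nn: "0 \<le> p' n" "0 \<le> q' n" "0 \<le> r' n" for n
    using p'(1)[of n] q'(1)[of n] r'(1)[of n] unit_rationals_subset by auto
  have lim: "(\<lambda>n. f (x n)) \<longlonglongrightarrow> f y" if "x \<longlonglongrightarrow> y" "\<And>n. 0 \<le> x n" "0 \<le> y" for x :: "nat \<Rightarrow> real" and y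
    using continuous_on_tendsto_compose[OF f that(1)] that(2,3) by auto
  have l1: "(\<lambda>n. f (p' n * q' n * u) - f (q' n * u)) \<longlonglongrightarrow> f (p * q * u) - f (q * u)"
    and l2: "(\<lambda>n. f (q' n * u) - f (r' n * q' n * u)) \<longlonglongrightarrow> f (q * u) - f (r * q * u)"
    using nn u p q r by (intro tendsto_diff lim tendsto_mult p' q' r' tendsto_const mult_nonneg_nonneg; auto)+
  have e: "p * q * u = a" "r * q * u = b" using p q r by (auto simp: mult.assoc)
  show "\<forall>n. \<exists>p\<in>unit_rationals. \<exists>q\<in>unit_rationals. \<exists>r\<in>unit_rationals.
     d - inverse (real (Suc n)) < f (p * q * u) - f (q * u) \<and> d - inverse (real (Suc n)) < f (q * u) - f (r * q * u)"
  proof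
    fix n
    have pos: "0 < inverse (real (Suc n))" by simp
    have "\<forall>\<^sub>F m in sequentially. d - inverse (real (Suc n)) < f (p' m * q' m * u) - f (q' m * u)"
      using a pos by (intro order_tendstoD(1)[OF l1]) (unfold e q(2), linarith)
    moreover have "\<forall>\<^sub>F m in sequentially. d - inverse (real (Suc n)) < f (q' m * u) - f (r' m * q' m * u)"
      using b pos by (intro order_tendstoD(1)[OF l2]) (unfold e q(2), linarith)
    ultimately have "\<forall>\<^sub>F m in sequentially. d - inverse (real (Suc n)) < f (p' m * q' m * u) - f (q' m * u) \<and>
       d - inverse (real (Suc n)) < f (q' m * u) - f (r' m * q' m * u)" by eventually_elim simp
    then obtain m where "d - inverse (real (Suc n)) < f (p' m * q' m * u) - f (q' m * u) \<and>
       d - inverse (real (Suc n)) < f (q' m * u) - f (r' m * q' m * u)"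
      by (auto simp: eventually_sequentially)
    then show "\<exists>p\<in>unit_rationals. \<exists>q\<in>unit_rationals. \<exists>r\<in>unit_rationals.
     d - inverse (real (Suc n)) < f (p * q * u) - f (q * u) \<and> d - inverse (real (Suc n)) < f (q * u) - f (r * q * u)"
      using p'(1) q'(1) r'(1) by blast
  qed
next
  assume R: "\<forall>n. \<exists>p\<in>unit_rationals. \<exists>q\<in>unit_rationals. \<exists>r\<in>unit_rationals.
     d - inverse (real (Suc n)) < f (p * q * u) - f (q * u) \<and> d - inverse (real (Suc n)) < f (q * u) - f (r * q * u)"
  define \<phi> where "\<phi> x = min (f (fst x * fst (snd x) * u) - f (fst (snd x) * u)) (f (fst (snd x) * u) - f (snd (snd x) * fst (snd x) * u))"
    for x :: "real \<times> real \<times> real"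
  let ?K = "{0..1} \<times> {0..1} \<times> {0..1} :: (real \<times> real \<times> real) set"
  have "continuous_on ?K \<phi>"
    unfolding \<phi>_def using u
    by (intro continuous_on_min continuous_on_diff continuous_on_comp_nonneg[OF f] continuous_intros) auto
  moreover have "compact ?K" by (intro compact_Times compact_Icc)
  ultimately obtain x where x: "x \<in> ?K" "\<And>y. y \<in> ?K \<Longrightarrow> \<phi> y \<le> \<phi> x"
    using continuous_attains_sup[of ?K \<phi>] by auto
  have "d \<le> \<phi> x"
  proof (rule ccontr)
    assume "\<not> d \<le> \<phi> x"
    then obtain n where n: "inverse (real (Suc n)) < d - \<phi> x" using reals_Archimedean[of "d - \<phi> x"] by auto
    obtain p q r where pqr: "p \<in> unit_rationals" "q \<in> unit_rationals" "r \<in> unit_rationals"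
      "d - inverse (real (Suc n)) < f (p * q * u) - f (q * u)" "d - inverse (real (Suc n)) < f (q * u) - f (r * q * u)"
      using R by blast
    then have "(p, q, r) \<in> ?K" using unit_rationals_subset by auto
    then have "\<phi> (p, q, r) \<le> \<phi> x" by (rule x)
    then show False using pqr(4,5) n by (simp add: \<phi>_def min_def split: if_splits)
  qed
  moreover obtain p q r where x_eq: "x = (p, q, r)" by (metis surj_pair)
  ultimately have d: "d \<le> f (p * q * u) - f (q * u)" "d \<le> f (q * u) - f (r * q * u)" by (auto simp: \<phi>_def)
  have pqr: "0 \<le> p" "p \<le> 1" "0 \<le> q" "q \<le> 1" "0 \<le> r" "r \<le> 1" using x(1) x_eq by auto
  have qu: "0 \<le> q * u" "q * u \<le> u" using pqr u by (auto intro: mult_left_le_one_le)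
  have "p * q * u \<in> {0..q * u}" "r * q * u \<in> {0..q * u}"
    using pqr qu(1) mult_left_le_one_le[of "q * u" p] mult_left_le_one_le[of "q * u" r] by (auto simp: mult.assoc)
  then have "balanced_at d f (q * u)" using d qu unfolding balanced_at_def by blast
  then show "\<exists>t\<le>u. balanced_at d f t" using qu by blast
qed

section \<open>Brownian motion stopped at the centring time\<close>

text \<open>Freezing at a fixed time gives eventually constant paths and bounded second moments. It
  is applied to \<open>B\<close> for a majorant on a bounded time interval and to the stopped
  process for its moment bound.\<close>

lemma (in prob_space) martingale_min:
  assumes mart: "martingale M F X" and t: "0 \<le> t"
  shows "martingale M F (\<lambda>s. X (min s t))"
proof (rule martingaleI)
  show "filtration (space M) F" using mart by (simp add: martingale_def)
  show "subalgebra M (F s)" if "0 \<le> s" for s using martingaleD(1)[OF mart that] .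
  show "X (min s t) \<in> borel_measurable (F s)" if "0 \<le> s" for s
    using that t by (intro martingale_adapted[OF mart]) auto
  show "integrable M (X (min s t))" if "0 \<le> s" for s
    using that t by (intro martingaleD(4)[OF mart]) auto
  fix s u A assume su: "0 \<le> s" "s \<le> u" and A: "A \<in> sets (F s)"
  show "expectation (\<lambda>\<omega>. indicator A \<omega> * (X (min u t) \<omega> - X (min s t) \<omega>)) = 0"
  proof (cases "s \<le> t")
    case True
    have AM: "A \<in> sets M" using A martingaleD(1)[OF mart su(1)] by (auto simp: subalgebra_def)
    have i: "integrable M (\<lambda>\<omega>. indicator A \<omega> * X v \<omega>)" if "0 \<le> v" for v
      using integrable_mult_indicator[OF AM martingaleD(4)[OF mart that]] by simp
    have "expectation (\<lambda>\<omega>. indicator A \<omega> * X (min u t) \<omega>) = expectation (\<lambda>\<omega>. indicator A \<omega> * X s \<omega>)"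
      using su t True A i by (intro martingale_increment(2)[OF mart]) auto
    then show ?thesis using i su t True by (simp add: right_diff_distrib)
  next
    case False
    then show ?thesis using su by simp
  qed
qed

lemma (in prob_space) moment2_bound_min:
  assumes mart: "martingale M F X" and L2: "\<And>s. 0 \<le> s \<Longrightarrow> square_integrable M (X s)" and t: "0 \<le> t"
  shows "moment2_bound M (\<lambda>s. X (min s t)) (expectation (\<lambda>\<omega>. (X t \<omega>)\<^sup>2))"
  unfolding moment2_bound_def
proof (intro allI impI conjI)
  fix s :: real assume s: "0 \<le> s"
  show "square_integrable M (X (min s t))" using L2 s t by simp
  have "0 \<le> expectation (\<lambda>\<omega>. (X t \<omega> - X (min s t) \<omega>)\<^sup>2)" by simp
  then show "expectation (\<lambda>\<omega>. (X (min s t) \<omega>)\<^sup>2) \<le> expectation (\<lambda>\<omega>. (X t \<omega>)\<^sup>2)"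
    using s t L2 by (subst (asm) martingale_increment_square[OF mart]) auto
qed

lemma eventually_constant_stopped: "0 \<le> t \<Longrightarrow> eventually_constant (\<lambda>s. f (min s t))"
  unfolding eventually_constant_def by (rule exI[of _ t]) simp

lemma continuous_on_min_nonneg:
  fixes f :: "real \<Rightarrow> real"
  assumes "continuous_on {0..} f" "0 \<le> t"
  shows "continuous_on {0..} (\<lambda>s. f (min s t))"
  by (rule continuous_on_comp_nonneg[OF assms(1)]) (use assms(2) in \<open>auto intro!: continuous_intros\<close>)

locale centring = brownian_motion +
  fixes d :: real
  assumes d_pos: "0 < d"
begin

definition T where "T = centring_time B d"
definition Y where "Y = stopped_process B T"

lemma T_cases:
  assumes "\<omega> \<in> space N"
  obtains (infinite) "T \<omega> = \<infinity>" "\<And>s. \<not> balanced_at d (\<lambda>t. B t \<omega>) s" "\<And>t. 0 \<le> t \<Longrightarrow> Y t \<omega> = B t \<omega>"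
  | (finite) \<tau> where "T \<omega> = ereal \<tau>" "0 \<le> \<tau>" "balanced_at d (\<lambda>t. B t \<omega>) \<tau>"
      "\<And>s. s < \<tau> \<Longrightarrow> \<not> balanced_at d (\<lambda>t. B t \<omega>) s" "\<And>t. Y t \<omega> = B (min t \<tau>) \<omega>"
proof -
  consider (a) "centring_time B d \<omega> = \<infinity>" "\<And>s. \<not> balanced_at d (\<lambda>t. B t \<omega>) s"
    | (b) \<tau> where "centring_time B d \<omega> = ereal \<tau>" "balanced_at d (\<lambda>t. B t \<omega>) \<tau>" "\<And>s. s < \<tau> \<Longrightarrow> \<not> balanced_at d (\<lambda>t. B t \<omega>) s"
    using centring_time_cases[where B = B and \<omega> = \<omega> and d = d, OF B_cont[OF assms]] by metis
  then show thesis
  proof cases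
    case a
    then show thesis by (intro infinite) (auto simp: T_def Y_def stopped_process_def min_def)
  next
    case (b \<tau>)
    have "0 \<le> \<tau>" using b(2) by (simp add: balanced_at_def)
    then show thesis using b by (intro finite) (auto simp: T_def Y_def stopped_process_def min_def)
  qed
qed

lemma Y_0:
  assumes "\<omega> \<in> space N"
  shows "Y 0 \<omega> = 0"
  using assms by (cases rule: T_cases) (simp_all add: B_0[OF assms])

lemma Y_cont:
  assumes "\<omega> \<in> space N"
  shows "continuous_on {0..} (\<lambda>t. Y t \<omega>)"
  using assms
proof (cases rule: T_cases)
  case infinite
  have "continuous_on {0..} (\<lambda>t. Y t \<omega>) \<longleftrightarrow> continuous_on {0..} (\<lambda>t. B t \<omega>)"
    by (rule continuous_on_cong) (auto simp: infinite(3))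
  then show ?thesis using B_cont[OF assms] by simp
next
  case (finite \<tau>)
  show ?thesis unfolding finite(5) by (rule continuous_on_min_nonneg[OF B_cont[OF assms] finite(2)])
qed

lemma Y_centred:
  assumes "\<omega> \<in> space N"
  shows "centred_path d (\<lambda>t. Y t \<omega>)"
  using assms
proof (cases rule: T_cases)
  case infinite
  have "centred_path d (\<lambda>t. B t \<omega>)" using centred_path_unbalanced[OF B_cont[OF assms]] infinite(2) by blast
  then show ?thesis using infinite(3) by (auto simp: centred_path_def)
next
  case (finite \<tau>)
  show ?thesis unfolding finite(5) by (rule centred_path_stopped[OF B_cont[OF assms] finite(4)])
qed

lemma T_finite_path:
  assumes "\<omega> \<in> space N" "T \<omega> < \<infinity>"
  shows "eventually_constant (\<lambda>t. Y t \<omega>) \<and> balanced_end d (\<lambda>t. Y t \<omega>) \<and> ((\<lambda>t. Y t \<omega>) \<longlongrightarrow> at_time B T \<omega>) at_top \<and>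
    path_diameter Y \<omega> = ennreal (at_time (running_max B) T \<omega> - at_time (running_min B) T \<omega>) \<and>
    0 \<le> at_time (running_max B) T \<omega> - at_time (running_min B) T \<omega>"
  using assms(1)
proof (cases rule: T_cases)
  case infinite
  then show ?thesis using assms(2) by simp
next
  case (finite \<tau>)
  have at: "at_time Z T \<omega> = Z \<tau> \<omega>" for Z :: "real \<Rightarrow> 'a \<Rightarrow> real" using finite(1) by (simp add: at_time_def)
  have 1: "eventually_constant (\<lambda>t. Y t \<omega>)" unfolding finite(5) by (rule eventually_constant_stopped[OF finite(2)])
  obtain a b where ab: "a \<in> {0..\<tau>}" "d \<le> B a \<omega> - B \<tau> \<omega>" "b \<in> {0..\<tau>}" "d \<le> B \<tau> \<omega> - B b \<omega>"
    using finite(3) unfolding balanced_at_def by blast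
  have 2: "balanced_end d (\<lambda>t. Y t \<omega>)"
    unfolding balanced_end_def finite(5)
  proof (rule exI[of _ \<tau>], intro conjI)
    show "\<exists>i\<ge>0. d \<le> B (min i \<tau>) \<omega> - B (min \<tau> \<tau>) \<omega>" using ab by (intro exI[of _ a]) auto
    show "\<exists>j\<ge>0. d \<le> B (min \<tau> \<tau>) \<omega> - B (min j \<tau>) \<omega>" using ab by (intro exI[of _ b]) auto
  qed (use finite(2) in auto)
  have 3: "((\<lambda>t. Y t \<omega>) \<longlongrightarrow> at_time B T \<omega>) at_top"
    by (rule tendsto_eventually) (use finite(5) at in \<open>auto intro!: eventually_mono[OF eventually_ge_at_top[of \<tau>]]\<close>)
  obtain p where p: "p \<in> {0..\<tau>}" "running_max B \<tau> \<omega> = B p \<omega>" "\<And>s. s \<in> {0..\<tau>} \<Longrightarrow> B s \<omega> \<le> B p \<omega>"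
    using running_max_attained[where B = B and \<omega> = \<omega>, OF B_cont[OF assms(1)] finite(2)] by metis
  obtain q where q: "q \<in> {0..\<tau>}" "running_min B \<tau> \<omega> = B q \<omega>" "\<And>s. s \<in> {0..\<tau>} \<Longrightarrow> B q \<omega> \<le> B s \<omega>"
    using running_min_attained[where B = B and \<omega> = \<omega>, OF B_cont[OF assms(1)] finite(2)] by metis
  have 4: "path_diameter Y \<omega> = ennreal (at_time (running_max B) T \<omega> - at_time (running_min B) T \<omega>)"
    unfolding at p(2) q(2)
  proof (rule antisym)
    \<comment> \<open>\<open>Y\<close> has the form \<open>B (min t \<tau>)\<close> at this
      \<open>\<omega>\<close> only, since \<open>\<tau>\<close> depends on it; so the diameter is
      unfolded, rewritten, and folded again for the process with constant
      \<open>\<tau>\<close>.\<close>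
    show "path_diameter Y \<omega> \<le> ennreal (B p \<omega> - B q \<omega>)"
      unfolding path_diameter_def[of Y] finite(5) path_diameter_def[of "\<lambda>t \<omega>. B (min t \<tau>) \<omega>", symmetric]
      using p(3) q(3) finite(2) by (intro path_diameter_le ennreal_leI diff_mono) auto
    show "ennreal (B p \<omega> - B q \<omega>) \<le> path_diameter Y \<omega>"
      using path_diameter_ge[of p q Y \<omega>] p(1) q(1) finite(5) by simp
  qed
  have 5: "0 \<le> at_time (running_max B) T \<omega> - at_time (running_min B) T \<omega>"
    unfolding at p(2) q(2) using p(3)[OF q(1)] by simp
  show ?thesis using 1 2 3 4 5 by blast
qed

lemma T_finite_Y:
  assumes "\<omega> \<in> space N" "T \<omega> < \<infinity>"
  shows "eventually_constant (\<lambda>t. Y t \<omega>)" "balanced_end d (\<lambda>t. Y t \<omega>)" "((\<lambda>t. Y t \<omega>) \<longlongrightarrow> at_time B T \<omega>) at_top"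
    "path_diameter Y \<omega> = ennreal (at_time (running_max B) T \<omega> - at_time (running_min B) T \<omega>)"
    "0 \<le> at_time (running_max B) T \<omega> - at_time (running_min B) T \<omega>"
  using T_finite_path[OF assms] by blast+

lemma subalgebra_F: "subalgebra N (\<F> t)"
  by (rule subalgebra_natural) (rule B_measurable)

lemma T_le_iff:
  assumes "\<omega> \<in> space N"
  shows "T \<omega> \<le> ereal u \<longleftrightarrow> (\<exists>t\<le>u. balanced_at d (\<lambda>t. B t \<omega>) t)"
  using assms
proof (cases rule: T_cases)
  case (finite \<tau>)
  then show ?thesis by (auto simp: not_le[symmetric]) (metis linorder_not_le order_trans)
qed auto

text \<open>The countable description of balance before \<open>u\<close> involves values of
  \<open>B\<close> at times up to \<open>u\<close> only, so the event lies in the natural filtration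
  at \<open>u\<close> as it stands.\<close>

lemma T_stopping:
  assumes u: "0 \<le> u"
  shows "{\<omega> \<in> space N. ereal u < T \<omega>} \<in> sets (\<F> u)"
proof -
  define P where "P n p q r \<omega> \<longleftrightarrow> d - inverse (real (Suc n)) < B (p * q * u) \<omega> - B (q * u) \<omega> \<and> 
    d - inverse (real (Suc n)) < B (q * u) \<omega> - B (r * q * u) \<omega>" for n p q r \<omega>
  have P: "{\<omega> \<in> space (\<F> u). P n p q r \<omega>} \<in> sets (\<F> u)"
    if "p \<in> unit_rationals" "q \<in> unit_rationals" "r \<in> unit_rationals" for n p q r
  proof -
    have pqr: "0 \<le> p" "p \<le> 1" "0 \<le> q" "q \<le> 1" "0 \<le> r" "r \<le> 1" using that unit_rationals_subset by auto
    have qu: "0 \<le> q * u" "q * u \<le> u" using pqr u by (auto intro: mult_left_le_one_le)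
    have pq: "p * q * u \<le> u" "r * q * u \<le> u"
      using mult_left_le_one_le[OF qu(1), of p] mult_left_le_one_le[OF qu(1), of r] pqr qu by (auto simp: mult.assoc)
    have [measurable]: "B (p * q * u) \<in> borel_measurable (\<F> u)" "B (q * u) \<in> borel_measurable (\<F> u)" "B (r * q * u) \<in> borel_measurable (\<F> u)"
      using pqr qu pq u by (auto intro!: adapted_natural)
    show ?thesis unfolding P_def by measurable
  qed
  have "{\<omega> \<in> space N. ereal u < T \<omega>} = space (\<F> u) - (\<Inter>n. \<Union>p\<in>unit_rationals. \<Union>q\<in>unit_rationals. \<Union>r\<in>unit_rationals. {\<omega> \<in> space (\<F> u). P n p q r \<omega>})"
  proof -
    define Q where "Q \<omega> \<longleftrightarrow> (\<forall>n. \<exists>p\<in>unit_rationals. \<exists>q\<in>unit_rationals. \<exists>r\<in>unit_rationals. P n p q r \<omega>)" for \<omega>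
    have "ereal u < T \<omega> \<longleftrightarrow> \<not> Q \<omega>" if "\<omega> \<in> space N" for \<omega>
      using T_le_iff[OF that, of u] unfolding balanced_before_iff[OF B_cont[OF that] u] P_def Q_def
      by (metis linorder_not_le)
    then have "{\<omega> \<in> space N. ereal u < T \<omega>} = space N - {\<omega> \<in> space N. Q \<omega>}" by blast
    also have "{\<omega> \<in> space N. Q \<omega>} = (\<Inter>n. \<Union>p\<in>unit_rationals. \<Union>q\<in>unit_rationals. \<Union>r\<in>unit_rationals. {\<omega> \<in> space N. P n p q r \<omega>})"
      unfolding Q_def by blast
    finally show ?thesis by simp
  qed
  also have "\<dots> \<in> sets (\<F> u)"
  proof -
    have "(\<Union>p\<in>unit_rationals. \<Union>q\<in>unit_rationals. \<Union>r\<in>unit_rationals. {\<omega> \<in> space (\<F> u). P n p q r \<omega>}) \<in> sets (\<F> u)" for n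
      by (intro sets.countable_UN'' countable_unit_rationals P)
    then show ?thesis by (intro sets.compl_sets sets.countable_INT) auto
  qed
  finally show ?thesis .
qed

section \<open>Riemann sums for the stopped Brownian motion\<close>

definition step :: "real \<Rightarrow> real \<Rightarrow> nat \<Rightarrow> nat \<Rightarrow> real" where
  "step s t n k = s + (t - s) / real (Suc n) * real k"

text \<open>The Riemann sum of the stochastic integral of the indicator of \<open>u < T\<close>
  against \<open>B\<close> over the interval from \<open>s\<close> to \<open>t\<close>. The
  integrand is taken at left endpoints, so each summand is orthogonal to its past.\<close>

definition increments :: "real \<Rightarrow> real \<Rightarrow> nat \<Rightarrow> 'a \<Rightarrow> real" where
  "increments s t n \<omega> = (\<Sum>k<Suc n. indicator {\<omega> \<in> space N. ereal (step s t n k) < T \<omega>} \<omega> * (B (step s t n (Suc k)) \<omega> - B (step s t n k) \<omega>))"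

lemma step_props:
  assumes "0 \<le> s" "s \<le> t"
  shows "step s t n (Suc k) = step s t n k + (t - s) / real (Suc n)" "step s t n 0 = s" "step s t n (Suc n) = t"
    "s \<le> step s t n k" "k \<le> Suc n \<Longrightarrow> step s t n k \<le> t" "step s t n k \<le> step s t n (Suc k)"
proof -
  have h: "0 \<le> (t - s) / real (Suc n)" using assms by simp
  show "step s t n (Suc k) = step s t n k + (t - s) / real (Suc n)" by (simp add: step_def ring_distribs)
  then show "step s t n k \<le> step s t n (Suc k)" using h by simp
  show "step s t n 0 = s" by (simp add: step_def)
  show l: "step s t n (Suc n) = t" unfolding step_def by simp
  show "s \<le> step s t n k" using mult_nonneg_nonneg[OF h, of "real k"] by (simp add: step_def)
  assume "k \<le> Suc n"
  then have "step s t n k \<le> step s t n (Suc n)" unfolding step_def using h by (intro add_left_mono mult_left_mono) auto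
  then show "step s t n k \<le> t" using l by simp
qed

text \<open>Along each path the Riemann sum collapses to one increment of \<open>B\<close>, up to a
  time that is within one mesh of the stopped one. That this time lies in \<open>{0..t}\<close>
  yields the majorant.\<close>

lemma increments_eq:
  assumes st: "0 \<le> s" "s \<le> t" and \<omega>: "\<omega> \<in> space N"
  shows "\<exists>c. (\<forall>n. c n \<in> {0..t}) \<and> (\<lambda>n. B (c n) \<omega>) \<longlonglongrightarrow> B s \<omega> + (Y t \<omega> - Y s \<omega>) \<and> (\<forall>n. increments s t n \<omega> = B (c n) \<omega> - B s \<omega>)"
proof -
  obtain \<tau> where \<tau>: "\<And>u. u \<in> {0..t} \<Longrightarrow> ereal u < T \<omega> \<longleftrightarrow> u < \<tau>" "\<And>u. u \<in> {0..t} \<Longrightarrow> Y u \<omega> = B (min u \<tau>) \<omega>" "0 \<le> \<tau>"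
    using \<omega>
  proof (cases rule: T_cases)
    case infinite
    \<comment> \<open>If the centring time is infinite, any level beyond \<open>t\<close> acts the
      same way on \<open>{0..t}\<close>.\<close>
    then show thesis using st by (intro that[of "t + 1"]) auto
  next
    case (finite \<tau>)
    then show thesis by (intro that[of \<tau>]) auto
  qed
  have sum_eq: "increments s t n \<omega> = (\<Sum>k<Suc n. if step s t n k < \<tau> then B (step s t n (Suc k)) \<omega> - B (step s t n k) \<omega> else 0)" for n
    unfolding increments_def
  proof (rule sum.cong)
    fix k assume "k \<in> {..<Suc n}"
    then have "step s t n k \<in> {0..t}" using step_props(4,5)[OF st, where n = n and k = k] st by auto
    then show "indicator {\<omega> \<in> space N. ereal (step s t n k) < T \<omega>} \<omega> * (B (step s t n (Suc k)) \<omega> - B (step s t n k) \<omega>) =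
      (if step s t n k < \<tau> then B (step s t n (Suc k)) \<omega> - B (step s t n k) \<omega> else 0)" using \<tau>(1) \<omega> by simp
  qed simp
  show ?thesis
  proof (cases "s < \<tau>")
    case True
    have "\<exists>c. min \<tau> t \<le> c \<and> c \<le> min (\<tau> + (t - s) / real (Suc n)) t \<and> increments s t n \<omega> = B c \<omega> - B s \<omega>" for n
      unfolding sum_eq
      using stopped_increments_sum[of "step s t n" "(t - s) / real (Suc n)" \<tau> "Suc n" "\<lambda>u. B u \<omega>"] step_props[OF st] st True by simp
    then obtain c where c: "\<And>n. min \<tau> t \<le> c n" "\<And>n. c n \<le> min (\<tau> + (t - s) / real (Suc n)) t" "\<And>n. increments s t n \<omega> = B (c n) \<omega> - B s \<omega>"
      by metis
    have lim0: "(\<lambda>n. (t - s) / real (Suc n)) \<longlonglongrightarrow> 0"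
      using tendsto_mult[OF tendsto_const LIMSEQ_inverse_real_of_nat, of "t - s"] by (simp add: divide_inverse)
    have "(\<lambda>n. min (\<tau> + (t - s) / real (Suc n)) t) \<longlonglongrightarrow> min (\<tau> + 0) t"
      by (intro tendsto_intros lim0)
    then have "c \<longlonglongrightarrow> min \<tau> t"
      using c(1,2) by (intro tendsto_sandwich[of "\<lambda>_. min \<tau> t" c sequentially "\<lambda>n. min (\<tau> + (t - s) / real (Suc n)) t"]) auto
    moreover have cpos: "c n \<in> {0..t}" for n using c(1,2)[of n] \<tau>(3) st by auto
    ultimately have "(\<lambda>n. B (c n) \<omega>) \<longlonglongrightarrow> B (min \<tau> t) \<omega>"
      using st \<tau>(3) by (intro continuous_on_tendsto_compose[OF B_cont[OF \<omega>]]) auto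
    moreover have "B (min \<tau> t) \<omega> = B s \<omega> + (Y t \<omega> - Y s \<omega>)" using \<tau>(2)[of t] \<tau>(2)[of s] True st by (simp add: min.commute)
    ultimately show ?thesis using c(3) cpos by (intro exI[of _ c]) auto
  next
    case False
    have "increments s t n \<omega> = 0" for n
    proof -
      have "\<not> step s t n k < \<tau>" for k using step_props(4)[OF st, where n = n and k = k] False by linarith
      then show ?thesis unfolding sum_eq by simp
    qed
    moreover have "Y t \<omega> = Y s \<omega>"
    proof -
      have "min t \<tau> = \<tau>" "min s \<tau> = \<tau>" using False st by auto
      then show ?thesis using \<tau>(2)[of t] \<tau>(2)[of s] st by simp
    qed
    ultimately show ?thesis using st by (intro exI[of _ "\<lambda>_. s"]) auto
  qed
qed

lemma increments_tendsto:
  assumes "0 \<le> s" "s \<le> t" "\<omega> \<in> space N"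
  shows "(\<lambda>n. increments s t n \<omega>) \<longlonglongrightarrow> Y t \<omega> - Y s \<omega>"
proof -
  obtain c where c: "(\<lambda>n. B (c n) \<omega>) \<longlonglongrightarrow> B s \<omega> + (Y t \<omega> - Y s \<omega>)" "\<forall>n. increments s t n \<omega> = B (c n) \<omega> - B s \<omega>"
    using increments_eq[OF assms] by blast
  show ?thesis using tendsto_diff[OF c(1) tendsto_const, of "B s \<omega>"] c(2) by simp
qed

text \<open>The range of \<open>B\<close> on \<open>{0..t}\<close>, a common majorant of all Riemann
  sums; it is square integrable by Doob's inequality.\<close>

definition W :: "real \<Rightarrow> 'a \<Rightarrow> real" where
  "W t \<omega> = enn2real (path_diameter (\<lambda>s. B (min s t)) \<omega>)"

lemma W_bound:
  assumes "0 \<le> t" "\<omega> \<in> space N" "u \<in> {0..t}" "v \<in> {0..t}"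
  shows "\<bar>B u \<omega> - B v \<omega>\<bar> \<le> W t \<omega>"
proof -
  have fin: "path_diameter (\<lambda>s. B (min s t)) \<omega> < \<infinity>"
    by (intro path_diameter_eventually_constant eventually_constant_stopped continuous_on_min_nonneg B_cont assms)
  have "B u \<omega> - B v \<omega> \<le> W t \<omega>" if "u \<in> {0..t}" "v \<in> {0..t}" for u v
  proof -
    have "ennreal (B u \<omega> - B v \<omega>) \<le> path_diameter (\<lambda>s. B (min s t)) \<omega>"
      using path_diameter_ge[of u v "\<lambda>s. B (min s t)" \<omega>] that by simp
    then have "enn2real (ennreal (B u \<omega> - B v \<omega>)) \<le> W t \<omega>"
      unfolding W_def using fin by (intro enn2real_mono) auto
    moreover have "B u \<omega> - B v \<omega> \<le> enn2real (ennreal (B u \<omega> - B v \<omega>))" 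
      by (cases "0 \<le> B u \<omega> - B v \<omega>") (auto simp: ennreal_neg)
    ultimately show ?thesis by linarith
  qed
  from this[OF assms(3,4)] this[OF assms(4,3)] show ?thesis by (simp add: abs_le_iff)
qed

lemma W_L2:
  assumes t: "0 \<le> t"
  shows "square_integrable N (W t)"
proof -
  have "square_integrable N (\<lambda>\<omega>. enn2real (path_diameter (\<lambda>s. B (min s t)) \<omega>))"
  proof (rule square_integrable_path_diameter[OF martingale_min[OF martingale_B t] moment2_bound_min[OF martingale_B B_L2 t]])
    show "continuous (at_right u) (\<lambda>s. B (min s t) \<omega>)" if "\<omega> \<in> space N" "0 \<le> u" for \<omega> u
      by (intro continuous_on_imp_right_continuous continuous_on_min_nonneg B_cont that t)
    show "AE \<omega> in N. path_diameter (\<lambda>s. B (min s t)) \<omega> < \<infinity>"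
      by (intro AE_I2 path_diameter_eventually_constant eventually_constant_stopped continuous_on_min_nonneg B_cont t)
  qed
  then show ?thesis by (simp add: W_def[abs_def])
qed

lemma increments_bound:
  assumes "0 \<le> s" "s \<le> t" "\<omega> \<in> space N"
  shows "\<bar>increments s t n \<omega>\<bar> \<le> W t \<omega>"
proof -
  obtain c where "c n \<in> {0..t}" "increments s t n \<omega> = B (c n) \<omega> - B s \<omega>"
    using increments_eq[OF assms] by blast
  then show ?thesis using W_bound[of t \<omega> "c n" s] assms by simp
qed

lemma increments_adapted:
  assumes "0 \<le> s" "s \<le> t"
  shows "increments s t n \<in> borel_measurable (\<F> t)"
  unfolding increments_def
proof (intro borel_measurable_sum borel_measurable_times borel_measurable_diff borel_measurable_indicator)
  fix k assume k: "k \<in> {..<Suc n}"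
  have *: "0 \<le> step s t n k" "step s t n k \<le> t" "0 \<le> step s t n (Suc k)" "step s t n (Suc k) \<le> t"
    using step_props(4,5)[OF assms, where n = n and k = k] step_props(4,5)[OF assms, where n = n and k = "Suc k"] assms k by auto
  show "{\<omega> \<in> space N. ereal (step s t n k) < T \<omega>} \<in> sets (\<F> t)"
    using T_stopping[OF *(1)] filtration.sets_F_mono[OF filtration_natural *(2)] by blast
  show "B (step s t n (Suc k)) \<in> borel_measurable (\<F> t)" "B (step s t n k) \<in> borel_measurable (\<F> t)"
    using * by (auto intro: adapted_natural)
qed

text \<open>Since \<open>Y 0\<close> vanishes, \<open>Y t\<close> is the pointwise limit of the
  adapted Riemann sums that start at time 0.\<close>

lemma Y_adapted:
  assumes "0 \<le> t"
  shows "Y t \<in> borel_measurable (\<F> t)"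
proof (rule borel_measurable_LIMSEQ_real)
  show "increments 0 t n \<in> borel_measurable (\<F> t)" for n using assms by (intro increments_adapted) auto
  show "(\<lambda>n. increments 0 t n \<omega>) \<longlonglongrightarrow> Y t \<omega>" if "\<omega> \<in> space (\<F> t)" for \<omega>
    using increments_tendsto[of 0 t \<omega>] that assms Y_0[of \<omega>] by simp
qed

lemma Y_measurable: "0 \<le> t \<Longrightarrow> Y t \<in> borel_measurable N"
  by (rule measurable_from_subalg[OF subalgebra_F Y_adapted])

lemma Y_L2:
  assumes "0 \<le> t"
  shows "square_integrable N (Y t)"
proof (rule square_integrable_add_bound[OF W_L2[OF assms] W_L2[OF assms] Y_measurable[OF assms]])
  fix \<omega> assume \<omega>: "\<omega> \<in> space N"
  have "\<bar>Y t \<omega> - Y 0 \<omega>\<bar> \<le> W t \<omega>"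
    using increments_tendsto[OF order_refl assms \<omega>] increments_bound[OF order_refl assms \<omega>]
    by (intro LIMSEQ_le_const2[OF tendsto_rabs]) auto
  then show "\<bar>Y t \<omega>\<bar> \<le> \<bar>W t \<omega>\<bar> + \<bar>W t \<omega>\<bar>" using Y_0[OF \<omega>] by simp
qed

text \<open>For \<open>A\<close> in the past of \<open>s\<close>, its intersection with the event
  \<open>u < T\<close> belongs to the past of every grid time \<open>u \<ge> s\<close>, so each
  summand of the Riemann sum has mean zero on \<open>A\<close>. Dominated convergence with majorant
  \<open>W t\<close> passes to the limit.\<close>

lemma martingale_Y: "martingale N \<F> Y"
proof (rule martingaleI)
  show "filtration (space N) \<F>" by (rule filtration_natural)
  show "subalgebra N (\<F> t)" for t by (rule subalgebra_F)
  show "Y t \<in> borel_measurable (\<F> t)" if "0 \<le> t" for t using Y_adapted[OF that] .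
  show "integrable N (Y t)" if "0 \<le> t" for t using square_integrable_integrable[OF Y_L2[OF that]] .
  fix s t A assume st: "0 \<le> s" "s \<le> t" and A: "A \<in> sets (\<F> s)"
  have t: "0 \<le> t" using st by simp
  have AN: "A \<in> sets N" using A subalgebra_F by (auto simp: subalgebra_def)
  have incr_m: "increments s t n \<in> borel_measurable N" for n
    using measurable_from_subalg[OF subalgebra_F increments_adapted[OF st]] .
  have "(\<lambda>n. expectation (\<lambda>\<omega>. indicator A \<omega> * increments s t n \<omega>)) \<longlonglongrightarrow> expectation (\<lambda>\<omega>. indicator A \<omega> * (Y t \<omega> - Y s \<omega>))"
  proof (rule integral_dominated_convergence[where w = "W t"])
    show "integrable N (W t)" using square_integrable_integrable[OF W_L2[OF t]] .
    show "AE \<omega> in N. (\<lambda>n. indicator A \<omega> * increments s t n \<omega>) \<longlonglongrightarrow> indicator A \<omega> * (Y t \<omega> - Y s \<omega>)"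
      by (intro AE_I2 tendsto_mult tendsto_const increments_tendsto st)
    show "AE \<omega> in N. norm (indicator A \<omega> * increments s t n \<omega>) \<le> W t \<omega>" for n
    proof (rule AE_I2)
      fix \<omega> assume "\<omega> \<in> space N"
      then have "\<bar>increments s t n \<omega>\<bar> \<le> W t \<omega>" by (rule increments_bound[OF st])
      then show "norm (indicator A \<omega> * increments s t n \<omega>) \<le> W t \<omega>"
        by (auto simp: indicator_def)
    qed
    show "(\<lambda>\<omega>. indicator A \<omega> * (Y t \<omega> - Y s \<omega>)) \<in> borel_measurable N"
      using Y_measurable st t AN by (intro borel_measurable_times borel_measurable_diff borel_measurable_indicator) auto
    show "(\<lambda>\<omega>. indicator A \<omega> * increments s t n \<omega>) \<in> borel_measurable N" for n
      using incr_m AN by (intro borel_measurable_times borel_measurable_indicator) auto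
  qed
  moreover have "expectation (\<lambda>\<omega>. indicator A \<omega> * increments s t n \<omega>) = 0" for n
  proof -
    let ?E = "\<lambda>k. A \<inter> {\<omega> \<in> space N. ereal (step s t n k) < T \<omega>}"
    let ?D = "\<lambda>k \<omega>. B (step s t n (Suc k)) \<omega> - B (step s t n k) \<omega>"
    have *: "expectation (\<lambda>\<omega>. indicator (?E k) \<omega> * ?D k \<omega>) = 0" "integrable N (\<lambda>\<omega>. indicator (?E k) \<omega> * ?D k \<omega>)" for k
    proof -
      have k: "0 \<le> step s t n k" "s \<le> step s t n k" "step s t n k \<le> step s t n (Suc k)" using step_props(4,6)[OF st, where n = n and k = k] st by auto
      have "A \<in> sets (\<F> (step s t n k))" using A filtration.sets_F_mono[OF filtration_natural k(2)] by blast
      then have E: "?E k \<in> sets (\<F> (step s t n k))" using T_stopping[OF k(1)] by blast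
      then show "expectation (\<lambda>\<omega>. indicator (?E k) \<omega> * ?D k \<omega>) = 0" by (intro past_orthogonal k)
      have "?E k \<in> sets N" using E subalgebra_F by (auto simp: subalgebra_def)
      then show "integrable N (\<lambda>\<omega>. indicator (?E k) \<omega> * ?D k \<omega>)"
        using integrable_mult_indicator[OF _ square_integrable_integrable[OF increment_L2(1)[OF k(1,3)]]] by simp
    qed
    have "(\<lambda>\<omega>. indicator A \<omega> * increments s t n \<omega>) = (\<lambda>\<omega>. \<Sum>k<Suc n. indicator (?E k) \<omega> * ?D k \<omega>)"
      unfolding increments_def sum_distrib_left indicator_inter_arith by (simp only: mult.assoc)
    then have "expectation (\<lambda>\<omega>. indicator A \<omega> * increments s t n \<omega>) = (\<Sum>k<Suc n. expectation (\<lambda>\<omega>. indicator (?E k) \<omega> * ?D k \<omega>))"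
      by (simp only: Bochner_Integration.integral_sum[OF *(2)])
    then show ?thesis by (simp only: *(1) sum.neutral_const)
  qed
  ultimately show "expectation (\<lambda>\<omega>. indicator A \<omega> * (Y t \<omega> - Y s \<omega>)) = 0"
    by (simp add: LIMSEQ_const_iff)
qed

section \<open>Moments and limit of the stopped Brownian motion\<close>

lemma AE_T_finite: "AE \<omega> in N. T \<omega> < \<infinity>"
  using AE_up_down[OF d_pos] AE_space
proof eventually_elim
  case (elim \<omega>)
  then obtain n :: nat where n: "3 * d \<le> B (2 * real n + 1) \<omega> - B (2 * real n) \<omega>"
    "B (2 * real n + 2) \<omega> - B (2 * real n + 1) \<omega> \<in> {- 2 * d .. - d}"
    by blast
  then have "balanced_at d (\<lambda>t. B t \<omega>) (2 * real n + 2)"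
    unfolding balanced_at_def
    by (intro conjI bexI[of _ "2 * real n + 1"] bexI[of _ "2 * real n"]) auto
  then have "T \<omega> \<le> ereal (2 * real n + 2)" using T_le_iff[OF elim(2)] by blast
  then show ?case by (auto intro: le_less_trans)
qed

text \<open>Frozen at \<open>t\<close>, the process has second moments bounded by that of
  \<open>Y t\<close>, which is finite but may depend on \<open>t\<close>. This suffices to enter the
  locale, whose estimate is then free of \<open>t\<close>.\<close>

lemma Y_moment2_bound: "moment2_bound N Y (12 * d\<^sup>2)"
  unfolding moment2_bound_def
proof (intro allI impI conjI)
  fix t :: real assume t: "0 \<le> t"
  show "square_integrable N (Y t)" by (rule Y_L2[OF t])
  interpret c: centred_martingale N \<F> "\<lambda>s. Y (min s t)" "expectation (\<lambda>\<omega>. (Y t \<omega>)\<^sup>2)" d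
  proof unfold_locales
    show "martingale N \<F> (\<lambda>s. Y (min s t))" by (rule martingale_min[OF martingale_Y t])
    show "moment2_bound N (\<lambda>s. Y (min s t)) (expectation (\<lambda>\<omega>. (Y t \<omega>)\<^sup>2))" by (rule moment2_bound_min[OF martingale_Y Y_L2 t])
    show "continuous_on {0..} (\<lambda>s. Y (min s t) \<omega>)" if "\<omega> \<in> space N" for \<omega>
      by (rule continuous_on_min_nonneg[OF Y_cont[OF that] t])
    show "AE \<omega> in N. eventually_constant (\<lambda>s. Y (min s t) \<omega>)" by (intro AE_I2 eventually_constant_stopped t)
    show "centred_path d (\<lambda>s. Y (min s t) \<omega>)" if "\<omega> \<in> space N" for \<omega> by (rule centred_path_min[OF Y_centred[OF that]])
  qed (rule d_pos)
  have "expectation (\<lambda>\<omega>. (Y 0 \<omega>)\<^sup>2) = 0" using Y_0 by (simp cong: Bochner_Integration.integral_cong)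
  then show "expectation (\<lambda>\<omega>. (Y t \<omega>)\<^sup>2) \<le> 12 * d\<^sup>2" using c.moment2_le[OF t] t by simp
qed

text \<open>With the uniform moment bound at hand the whole stopped process qualifies; eventual
  constancy of its paths comes from almost sure finiteness of \<open>T\<close>.\<close>

sublocale centred_martingale N \<F> Y "12 * d\<^sup>2" d
proof unfold_locales
  show "AE \<omega> in N. eventually_constant (\<lambda>t. Y t \<omega>)" using AE_T_finite AE_space by eventually_elim (rule T_finite_Y(1))
qed (rule martingale_Y Y_moment2_bound d_pos Y_cont Y_centred; assumption?)+

lemma T_finite_sets: "{\<omega> \<in> space N. T \<omega> < \<infinity>} \<in> sets N"
proof -
  have "{\<omega> \<in> space N. T \<omega> < \<infinity>} = space N - (\<Inter>n::nat. {\<omega> \<in> space N. ereal (real n) < T \<omega>})"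
  proof -
    have "T \<omega> < \<infinity> \<longleftrightarrow> (\<exists>n::nat. \<not> ereal (real n) < T \<omega>)" for \<omega>
    proof (cases "T \<omega>")
      case (real r)
      obtain n :: nat where "r \<le> real n" using real_arch_simple by blast
      then have "\<not> ereal (real n) < T \<omega>" using real by simp
      then show ?thesis using real by auto
    qed auto
    then show ?thesis by blast
  qed
  also have "\<dots> \<in> sets N"
  proof -
    have "{\<omega> \<in> space N. ereal (real n) < T \<omega>} \<in> sets N" for n :: nat
      using T_stopping[of "real n"] subalgebra_F[of "real n"] unfolding subalgebra_def by auto
    then show ?thesis by (intro sets.compl_sets sets.countable_INT) auto
  qed
  finally show ?thesis .
qed

lemma at_time_infinite: "T \<omega> = \<infinity> \<Longrightarrow> at_time Z T \<omega> = Z 0 \<omega>"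
  by (simp add: at_time_def)

lemma last_term_Y: "last_term N Y (at_time B T)"
  unfolding last_term_def
proof
  show "AE \<omega> in N. ((\<lambda>t. Y t \<omega>) \<longlongrightarrow> at_time B T \<omega>) at_top"
    using AE_T_finite AE_space by eventually_elim (rule T_finite_Y(3))
  \<comment> \<open>Measurability must hold on the null set of infinite \<open>T\<close> as well;
    there the value is \<open>B 0 \<omega> = 0\<close> and not the limit of the path.\<close>
  have eq: "at_time B T \<omega> = (if T \<omega> < \<infinity> then lim (\<lambda>n. Y (real n) \<omega>) else 0)" if \<omega>: "\<omega> \<in> space N" for \<omega>
  proof (cases "T \<omega> < \<infinity>")
    case True
    have "(\<lambda>n. Y (real n) \<omega>) \<longlonglongrightarrow> at_time B T \<omega>"
      by (rule filterlim_compose[OF T_finite_Y(3)[OF \<omega> True] filterlim_real_sequentially])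
    then show ?thesis using True by (simp add: limI)
  next
    case False
    then show ?thesis using at_time_infinite[of \<omega> B] B_0[OF \<omega>] by simp
  qed
  have "(\<lambda>\<omega>. if T \<omega> < \<infinity> then lim (\<lambda>n. Y (real n) \<omega>) else 0) \<in> borel_measurable N"
    using T_finite_sets Y_measurable by (intro measurable_If borel_measurable_lim_metric) auto
  then show "at_time B T \<in> borel_measurable N" by (simp add: eq cong: measurable_cong)
qed

definition D where "D \<omega> = at_time (running_max B) T \<omega> - at_time (running_min B) T \<omega>"

lemma AE_path_diameter: "AE \<omega> in N. path_diameter Y \<omega> = ennreal (D \<omega>)"
  using AE_T_finite AE_space by eventually_elim (unfold D_def, rule T_finite_Y(4))

lemma D_eq:
  assumes \<omega>: "\<omega> \<in> space N"
  shows "D \<omega> = (if T \<omega> < \<infinity> then enn2real (path_diameter Y \<omega>) else 0)"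
proof (cases "T \<omega> < \<infinity>")
  case True
  then show ?thesis using T_finite_Y(4,5)[OF \<omega> True] by (simp add: D_def)
next
  case False
  \<comment> \<open>For infinite \<open>T\<close> both extrema are read off at time 0, where they
    coincide; hence the default 0.\<close>
  then show ?thesis using at_time_infinite[of \<omega>] by (simp add: D_def running_max_def running_min_def)
qed

lemma D_integrable: "integrable N D" and D_expectation: "expectation D = sqrt 3 * sqrt (variance (at_time B T))"
proof -
  note dL2 = diameter_L2
  have "(\<lambda>\<omega>. if T \<omega> < \<infinity> then enn2real (path_diameter Y \<omega>) else 0) \<in> borel_measurable N"
    using T_finite_sets square_integrable_measurable[OF dL2] by (intro measurable_If) auto
  then have D_m: "D \<in> borel_measurable N" by (simp add: D_eq cong: measurable_cong)
  have ae: "AE \<omega> in N. enn2real (path_diameter Y \<omega>) = D \<omega>"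
    using AE_T_finite AE_space by eventually_elim (simp add: D_eq)
  show "integrable N D"
    using integrable_cong_AE[OF square_integrable_measurable[OF dL2] D_m ae] square_integrable_integrable[OF dL2] by blast
  have "AE \<omega> in N. balanced_end d (\<lambda>t. Y t \<omega>)" using AE_T_finite AE_space by eventually_elim (rule T_finite_Y(2))
  then have "expectation (\<lambda>\<omega>. enn2real (path_diameter Y \<omega>)) = sqrt 3 * sqrt (variance (at_time B T))"
    by (rule expected_diameter_eq[OF _ last_term_Y Y_0])
  then show "expectation D = sqrt 3 * sqrt (variance (at_time B T))"
    using integral_cong_AE[OF square_integrable_measurable[OF dL2] D_m ae] by simp
qed

lemma Y_right_continuous: "right_continuous_paths N Y"
  unfolding right_continuous_paths_def by (intro AE_I2 allI impI continuous_on_imp_right_continuous Y_cont)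

lemma Y_L2_bounded: "L2_bounded N Y"
  by (rule L2_bounded_iff_moment2_bound[THEN iffD2, OF Y_measurable exI, OF _ Y_moment2_bound])

end

theorem corollary1:
  shows "(\<forall>(M :: 'a measure) F X X_inf.
            prob_space M \<and> martingale M F X \<and> right_continuous_paths M X \<and>
            L2_bounded M X \<and> last_term M X X_inf \<longrightarrow>
            (\<integral>\<^sup>+ \<omega>. path_diameter X \<omega> \<partial>M)
              \<le> ennreal (sqrt 3 * sqrt (prob_space.variance M X_inf)))
       \<and>
         (\<forall>(N :: 'b measure) B (d :: real) T Y D.
            standard_Brownian_motion N B \<and> 0 < d \<and>
            T = centring_time B d \<and>
            Y = stopped_process B T \<and>
            D = (\<lambda>\<omega>. at_time (running_max B) T \<omega> - at_time (running_min B) T \<omega>) \<longrightarrow>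
            (AE \<omega> in N. T \<omega> < \<infinity>) \<and>
            martingale N (natural_filtration N B) Y \<and>
            right_continuous_paths N Y \<and>
            L2_bounded N Y \<and>
            last_term N Y (at_time B T) \<and>
            (AE \<omega> in N. path_diameter Y \<omega> = ennreal (D \<omega>)) \<and>
            integrable N D \<and>
            prob_space.expectation N D
              = sqrt 3 * sqrt (prob_space.variance N (at_time B T)))"
proof (rule conjI; intro allI impI; elim conjE)
  fix M :: "'a measure" and F X X_inf
  assume "prob_space M" "martingale M F X" "right_continuous_paths M X" "L2_bounded M X" "last_term M X X_inf"
  then show "(\<integral>\<^sup>+ \<omega>. path_diameter X \<omega> \<partial>M) \<le> ennreal (sqrt 3 * sqrt (prob_space.variance M X_inf))"
    by (intro prob_space.expected_path_diameter_le)
next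
  fix N :: "'b measure" and B and d :: real and T Y D
  assume BM: "standard_Brownian_motion N B" and d: "0 < d" and T: "T = centring_time B d" and Y: "Y = stopped_process B T"
    and D: "D = (\<lambda>\<omega>. at_time (running_max B) T \<omega> - at_time (running_min B) T \<omega>)"
  interpret prob_space N using BM by (simp add: standard_Brownian_motion_def)
  interpret c: centring N B d by unfold_locales (fact BM d)+
  have T': "T = c.T" and Y': "Y = c.Y" and D': "D = c.D"
    by (simp_all add: T Y D c.T_def c.Y_def c.D_def[abs_def])
  show "(AE \<omega> in N. T \<omega> < \<infinity>) \<and> martingale N (natural_filtration N B) Y \<and> right_continuous_paths N Y \<and>
    L2_bounded N Y \<and> last_term N Y (at_time B T) \<and> (AE \<omega> in N. path_diameter Y \<omega> = ennreal (D \<omega>)) \<and>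
    integrable N D \<and> expectation D = sqrt 3 * sqrt (variance (at_time B T))"
    unfolding T' Y' D'
    by (intro conjI c.AE_T_finite c.martingale_Y c.Y_right_continuous c.Y_L2_bounded c.last_term_Y
      c.AE_path_diameter c.D_integrable c.D_expectation)
qed

end
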